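(* Let $H$ be a separable complex Hilbert space, $D=D^*$ with compact resolvent, $\{h_m\}_{m\ge1}$ an orthonormal basis of eigenvectors, $Dh_m=\lambda_mh_m$, $G$ a positive bounded Borel function with $0<G(D)\in\mathcal{L}^{1,\infty}(H)$, and $U:H\to L^2(F,\mu)$ a joint spectral representation of commuting bounded selfadjoint operators $A_1,\dots,A_n$ acting non-degenerately on $H$. For $\omega\in DL_2$ and Borel $J\subset F$ put $\nu_{G,\omega}(J):=\mathrm{Tr}_\omega(T_{\chi_J}G(D)T_{\chi_J})$, where $T_f=U^*M_fU$. Then (i) $\Rightarrow$ (ii) $\Rightarrow$ (iii) $\Rightarrow$ (iv), where: (i) the sequence $\{|Uh_m|^2\}_{m=1}^\infty\subset L^1(F,\mu)$ is dominated by some $l\in L^1(F,\mu)$; (ii) for all sequences of disjoint Borel sets $F_j\subset F$, $$\lim_{N\to\infty}\limsup_{k\to\infty}\Big(\frac1k\sum_mG(\lambda_m)^{1+\frac1k}\int_{\bigcup_{j=N}^\infty F_j}|(Uh_m)(x)|^2\,d\mu(x)\Big)=0;$$ (iii) for any sequence $Q_j$ of mutually orthogonal projections belonging to $U^*L^\infty(F,\mu)U$, $\|P_NG(D)P_N\|_0\to0$ as $N\to\infty$, where $P_N=\sum_{j=N}^\infty Q_j$; (iv) $\nu_{G,\omega}$ is a finite Borel measure on $F$, absolutely continuous with respect to $\mu$, for all $\omega\in DL_2$.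
   Context: $\mu_n(T)$ are the singular values of a compact operator $T$; $\mathcal{L}^{1,\infty}(H)$ is the ideal of compact $T$ with $\|T\|_{1,\infty}=\sup_{k}\frac{1}{\log(1+k)}\sum_{n=1}^k\mu_n(T)<\infty$; $\|T\|_0:=\limsup_k\frac{1}{\log(1+k)}\sum_{n=1}^k\mu_n(T)=\inf\{\|T-V\|_{1,\infty}: V\in\mathcal{L}^{1,\infty},\ \|V\|_0=0\}$. For $0<T\in\mathcal{L}^{1,\infty}$, $\gamma(T)=\{\frac{1}{\log(1+k)}\sum_{n=1}^k\mu_n(T)\}_{k}$. With $D_2(\{a_k\})=\{a_{\lceil k/2\rceil}\}_{k}$ on $\ell^\infty$, $DL_2$ is the set of positive functionals $\omega\in(\ell^\infty)^*$ with $\omega(1)=1$, $\liminf_k a_k\le\omega(\{a_k\})\le\limsup_k a_k$ for bounded $a_k\ge0$, and $\omega(D_2(\gamma(T)))=\omega(\gamma(T))$ for all $0<T\in\mathcal{L}^{1,\infty}$. $\mathrm{Tr}_\omega$ is the linear extension to $\mathcal{L}^{1,\infty}$ of $T\mapsto\omega(\gamma(T))$, $T>0$. A joint spectral representation is a unitary $U:H\to L^2(F,\mu)$, $(F,\mu)$ a finite Borel measure space, with $UA_iU^*=M_{e_i}$, $e_i$ bounded; it is assumed that there is a normal $^*$-homomorphism $f\mapsto f\circ e$, $e=(e_1,\dots,e_n)$, from the von Neumann algebra $\mathcal{M}\cong L^\infty(E,\mu_\eta)$ generated by the $A_i$ ($E$ the joint spectrum) into $L^\infty(F,\mu)$ with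 $Uf(A_1,\dots,A_n)U^*=M_{f\circ e}$. $M_f$ is multiplication by $f$, $\chi_J$ the characteristic function of $J$; $L^\infty(F,\mu)$ is identified with multiplication operators. *)

theory Defs
  imports "HOL-Analysis.Analysis"
begin

section \<open>Complex Hilbert spaces and bounded operators\<close>

text \<open>The inner product is conjugate linear in its first argument. Positivity of
  \<open>cinner x x\<close> and definiteness follow from \<open>cinner_commute\<close>, \<open>norm_eq_sqrt_cinner\<close> and the
  norm axioms.\<close>

class chilbert_space = banach +
  fixes scaleC :: "complex \<Rightarrow> 'a \<Rightarrow> 'a" (infixr "*\<^sub>C" 75)
    and cinner :: "'a \<Rightarrow> 'a \<Rightarrow> complex"
  assumes scaleC_add_right: "c *\<^sub>C (x + y) = c *\<^sub>C x + c *\<^sub>C y"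
    and scaleC_add_left: "(c + d) *\<^sub>C x = c *\<^sub>C x + d *\<^sub>C x"
    and scaleC_scaleC: "c *\<^sub>C (d *\<^sub>C x) = (c * d) *\<^sub>C x"
    and scaleC_of_real: "complex_of_real r *\<^sub>C x = r *\<^sub>R x"
    and cinner_commute: "cinner x y = cnj (cinner y x)"
    and cinner_add_right: "cinner x (y + z) = cinner x y + cinner x z"
    and cinner_scaleC_right: "cinner x (c *\<^sub>C y) = c * cinner x y"
    and norm_eq_sqrt_cinner: "norm x = sqrt (Re (cinner x x))"

definition bounded_clinear :: "('h::chilbert_space \<Rightarrow> 'h) \<Rightarrow> bool" where
  "bounded_clinear T \<longleftrightarrow> bounded_linear T \<and> (\<forall>c x. T (c *\<^sub>C x) = c *\<^sub>C T x)"

definition cadjoint :: "('h::chilbert_space \<Rightarrow> 'h) \<Rightarrow> ('h \<Rightarrow> 'h)" where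
  "cadjoint T = (THE S. bounded_clinear S \<and> (\<forall>x y. cinner (S x) y = cinner x (T y)))"

definition selfadjoint_op :: "('h::chilbert_space \<Rightarrow> 'h) \<Rightarrow> bool" where
  "selfadjoint_op T \<longleftrightarrow> bounded_clinear T \<and> cadjoint T = T"

definition projection_op :: "('h::chilbert_space \<Rightarrow> 'h) \<Rightarrow> bool" where
  "projection_op P \<longleftrightarrow> selfadjoint_op P \<and> P \<circ> P = P"

text \<open>\<open>0 < T\<close>: positive and nonzero (not: injective).\<close>

definition positive_op :: "('h::chilbert_space \<Rightarrow> 'h) \<Rightarrow> bool" where
  "positive_op T \<longleftrightarrow> bounded_clinear T \<and> (\<forall>x. cinner x (T x) \<in> nonneg_Reals) \<and> T \<noteq> (\<lambda>_. 0)"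

definition compact_op :: "('h::chilbert_space \<Rightarrow> 'h) \<Rightarrow> bool" where
  "compact_op T \<longleftrightarrow> bounded_clinear T \<and> compact (closure (T ` cball 0 1))"

definition orthonormal_on :: "nat set \<Rightarrow> (nat \<Rightarrow> 'h::chilbert_space) \<Rightarrow> bool" where
  "orthonormal_on I e \<longleftrightarrow> (\<forall>i\<in>I. \<forall>j\<in>I. cinner (e i) (e j) = (if i = j then 1 else 0))"

definition orthonormal_basis :: "(nat \<Rightarrow> 'h::chilbert_space) \<Rightarrow> bool" where
  "orthonormal_basis h \<longleftrightarrow>
     orthonormal_on UNIV h \<and> (\<forall>x. (\<lambda>m. cinner (h m) x *\<^sub>C h m) sums x)"


section \<open>Singular values, the ideal \<open>\<L>\<^sup>1\<^sup>,\<^sup>\<infinity>\<close>, Dixmier traces\<close>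

text \<open>For \<open>n \<ge> 1\<close>, the square root of the \<open>n\<close>-th largest eigenvalue of \<open>T\<^sup>* T\<close>, counted with
  multiplicity: at least \<open>n\<close> of the singular values are \<open>\<ge> t\<close> iff there are \<open>n\<close> orthonormal
  eigenvectors of \<open>T\<^sup>* T\<close> with eigenvalues \<open>\<ge> t\<^sup>2\<close>.\<close>

definition singular_value :: "('h::chilbert_space \<Rightarrow> 'h) \<Rightarrow> nat \<Rightarrow> real" where
  "singular_value T n = Sup (insert 0 {t. 0 \<le> t \<and>
     (\<exists>e s. orthonormal_on {1..n} e \<and>
       (\<forall>i\<in>{1..n}. t \<le> s i \<and> cadjoint T (T (e i)) = (s i)\<^sup>2 *\<^sub>R e i))})"

definition log_average :: "('h::chilbert_space \<Rightarrow> 'h) \<Rightarrow> nat \<Rightarrow> real" where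
  "log_average T k = (\<Sum>n=1..k. singular_value T n) / ln (1 + real k)"

definition norm_1_inf :: "('h::chilbert_space \<Rightarrow> 'h) \<Rightarrow> ereal" where
  "norm_1_inf T = (SUP k\<in>{1..}. ereal (log_average T k))"

definition L1_inf :: "('h::chilbert_space \<Rightarrow> 'h) set" where
  "L1_inf = {T. compact_op T \<and> norm_1_inf T < \<infinity>}"

definition seminorm_0 :: "('h::chilbert_space \<Rightarrow> 'h) \<Rightarrow> ereal" where
  "seminorm_0 T = limsup (\<lambda>k. ereal (log_average T k))"

text \<open>Sequences \<open>{a\<^sub>k}\<close>, \<open>k \<ge> 1\<close>, are elements of \<open>\<ell>\<^sup>\<infinity> = (nat \<Rightarrow>\<^sub>C real)\<close> with \<open>a\<^sub>k\<close> at position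
  \<open>k - 1\<close>; hence \<open>\<lceil>k / 2\<rceil>\<close> becomes \<open>i div 2\<close> for \<open>i = k - 1\<close>. Positive functionals on the complex
  \<open>\<ell>\<^sup>\<infinity>\<close> are the complexifications of those on the real one.\<close>

definition gamma_seq :: "('h::chilbert_space \<Rightarrow> 'h) \<Rightarrow> (nat \<Rightarrow>\<^sub>C real)" where
  "gamma_seq T = Bcontfun (\<lambda>i. log_average T (Suc i))"

definition dilation2 :: "(nat \<Rightarrow>\<^sub>C real) \<Rightarrow> (nat \<Rightarrow>\<^sub>C real)" where
  "dilation2 a = Bcontfun (\<lambda>i. apply_bcontfun a (i div 2))"

definition DL2 :: "'h::chilbert_space itself \<Rightarrow> ((nat \<Rightarrow>\<^sub>C real) \<Rightarrow>\<^sub>L real) set" where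
  "DL2 _ = {\<omega>.
     (\<forall>a. (\<forall>k. 0 \<le> apply_bcontfun a k) \<longrightarrow> 0 \<le> blinfun_apply \<omega> a) \<and>
     blinfun_apply \<omega> (const_bcontfun 1) = 1 \<and>
     (\<forall>a. (\<forall>k. 0 \<le> apply_bcontfun a k) \<longrightarrow>
        liminf (\<lambda>k. ereal (apply_bcontfun a k)) \<le> ereal (blinfun_apply \<omega> a) \<and>
        ereal (blinfun_apply \<omega> a) \<le> limsup (\<lambda>k. ereal (apply_bcontfun a k))) \<and>
     (\<forall>T :: 'h \<Rightarrow> 'h. positive_op T \<and> T \<in> L1_inf \<longrightarrow>
        blinfun_apply \<omega> (dilation2 (gamma_seq T)) = blinfun_apply \<omega> (gamma_seq T))}"

text \<open>The linear extension is unique on \<open>L1_inf\<close>, which is spanned by its positive elements; values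
  outside \<open>L1_inf\<close> are irrelevant.\<close>

definition dixmier_trace ::
    "((nat \<Rightarrow>\<^sub>C real) \<Rightarrow>\<^sub>L real) \<Rightarrow> ('h::chilbert_space \<Rightarrow> 'h) \<Rightarrow> complex" where
  "dixmier_trace \<omega> = (SOME \<phi>.
     (\<forall>S\<in>L1_inf. \<forall>T\<in>L1_inf. \<phi> (\<lambda>x. S x + T x) = \<phi> S + \<phi> T) \<and>
     (\<forall>c. \<forall>T\<in>L1_inf. \<phi> (\<lambda>x. c *\<^sub>C T x) = c * \<phi> T) \<and>
     (\<forall>T\<in>L1_inf. positive_op T \<longrightarrow> \<phi> T = complex_of_real (blinfun_apply \<omega> (gamma_seq T))))"


section \<open>Spectral measures and functional calculus\<close>

definition projection_valued_measure ::
    "('a::topological_space set \<Rightarrow> 'h::chilbert_space \<Rightarrow> 'h) \<Rightarrow> bool" where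
  "projection_valued_measure P \<longleftrightarrow>
     (\<forall>B\<in>sets borel. projection_op (P B)) \<and> P UNIV = id \<and>
     (\<forall>B :: nat \<Rightarrow> 'a set. range B \<subseteq> sets borel \<and> disjoint_family B \<longrightarrow>
        (\<forall>x. (\<lambda>j. P (B j) x) sums P (\<Union>j. B j) x))"

definition scalar_spectral_measure ::
    "('a::topological_space set \<Rightarrow> 'h::chilbert_space \<Rightarrow> 'h) \<Rightarrow> 'h \<Rightarrow> 'a measure" where
  "scalar_spectral_measure P x =
     measure_of UNIV (sets borel) (\<lambda>B. ennreal (Re (cinner x (P B x))))"

text \<open>\<open>\<integral> f dP\<close> for bounded Borel \<open>f\<close>; by polarization the quadratic form determines the
  operator.\<close>

definition spectral_integral ::
    "('a::topological_space set \<Rightarrow> 'h::chilbert_space \<Rightarrow> 'h) \<Rightarrow> ('a \<Rightarrow> complex) \<Rightarrow> ('h \<Rightarrow> 'h)" where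
  "spectral_integral P f = (THE T. bounded_clinear T \<and>
     (\<forall>x. cinner x (T x) = (LINT t|scalar_spectral_measure P x. f t)))"

text \<open>An unbounded operator is given by its domain \<open>dm\<close> and a function \<open>D\<close>, whose values outside
  \<open>dm\<close> play no role. The last conjunct says that the graphs of \<open>D\<^sup>*\<close> and \<open>D\<close> coincide.\<close>

definition selfadjoint_unbounded :: "'h::chilbert_space set \<Rightarrow> ('h \<Rightarrow> 'h) \<Rightarrow> bool" where
  "selfadjoint_unbounded dm D \<longleftrightarrow>
     0 \<in> dm \<and>
     (\<forall>x\<in>dm. \<forall>y\<in>dm. x + y \<in> dm \<and> D (x + y) = D x + D y) \<and>
     (\<forall>c. \<forall>x\<in>dm. c *\<^sub>C x \<in> dm \<and> D (c *\<^sub>C x) = c *\<^sub>C D x) \<and>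
     closure dm = UNIV \<and>
     (\<forall>y z. (\<forall>x\<in>dm. cinner y (D x) = cinner z x) \<longleftrightarrow> y \<in> dm \<and> D y = z)"

definition compact_resolvent :: "'h::chilbert_space set \<Rightarrow> ('h \<Rightarrow> 'h) \<Rightarrow> bool" where
  "compact_resolvent dm D \<longleftrightarrow>
     (\<exists>z. bij_betw (\<lambda>x. D x - z *\<^sub>C x) dm UNIV \<and>
          compact_op (inv_into dm (\<lambda>x. D x - z *\<^sub>C x)))"

definition spectral_measure_of ::
    "'h::chilbert_space set \<Rightarrow> ('h \<Rightarrow> 'h) \<Rightarrow> (real set \<Rightarrow> 'h \<Rightarrow> 'h) \<Rightarrow> bool" where
  "spectral_measure_of dm D P \<longleftrightarrow>
     projection_valued_measure P \<and>
     dm = {x. integrable (scalar_spectral_measure P x) (\<lambda>t. t\<^sup>2)} \<and>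
     (\<forall>x\<in>dm. cinner x (D x) = complex_of_real (LINT t|scalar_spectral_measure P x. t))"

text \<open>\<open>G(D)\<close>. The spectral measure is unique on Borel sets only, so the operator rather than \<open>P\<close>
  is described.\<close>

definition borel_calculus ::
    "'h::chilbert_space set \<Rightarrow> ('h \<Rightarrow> 'h) \<Rightarrow> (real \<Rightarrow> real) \<Rightarrow> ('h \<Rightarrow> 'h)" where
  "borel_calculus dm D G = (THE T. \<exists>P. spectral_measure_of dm D P \<and>
     T = spectral_integral P (\<lambda>t. complex_of_real (G t)))"

text \<open>Commuting bounded selfadjoint operators are a family \<open>A\<close> over a finite index type \<open>'n\<close>, of
  cardinality \<open>n\<close>.\<close>

definition joint_spectral_measure_of ::
    "('n::finite \<Rightarrow> 'h::chilbert_space \<Rightarrow> 'h) \<Rightarrow> ((real ^ 'n) set \<Rightarrow> 'h \<Rightarrow> 'h) \<Rightarrow> bool" where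
  "joint_spectral_measure_of A P \<longleftrightarrow>
     projection_valued_measure P \<and>
     (\<forall>i x. integrable (scalar_spectral_measure P x) (\<lambda>t. t $ i) \<and>
        cinner x (A i x) = complex_of_real (LINT t|scalar_spectral_measure P x. t $ i))"

definition joint_spectrum :: "('n::finite \<Rightarrow> 'h::chilbert_space \<Rightarrow> 'h) \<Rightarrow> (real ^ 'n) set" where
  "joint_spectrum A =
     {t. \<forall>\<epsilon>>0. \<exists>x. norm x = 1 \<and> (\<forall>i. norm (A i x - (t $ i) *\<^sub>R x) < \<epsilon>)}"

text \<open>The closed linear span of the ranges is all of \<open>H\<close> (the ranges being complex subspaces, the
  real span is the complex one).\<close>

definition acts_nondegenerately :: "('n \<Rightarrow> 'h::chilbert_space \<Rightarrow> 'h) \<Rightarrow> bool" where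
  "acts_nondegenerately A \<longleftrightarrow> closure (span (\<Union>i. range (A i))) = UNIV"

definition commutant :: "('h::chilbert_space \<Rightarrow> 'h) set \<Rightarrow> ('h \<Rightarrow> 'h) set" where
  "commutant S = {T. bounded_clinear T \<and> (\<forall>R\<in>S. T \<circ> R = R \<circ> T)}"

text \<open>For a selfadjoint, nondegenerate set of operators the generated von Neumann algebra is the
  bicommutant.\<close>

definition von_neumann_generated :: "('n \<Rightarrow> 'h::chilbert_space \<Rightarrow> 'h) \<Rightarrow> ('h \<Rightarrow> 'h) set" where
  "von_neumann_generated A = commutant (commutant (range A))"


section \<open>Joint spectral representations\<close>

text \<open>Elements of \<open>L\<^sup>2(F, \<mu>)\<close> and \<open>L\<^sup>\<infinity>(F, \<mu>)\<close> are given by representatives: \<open>U x\<close> is a chosen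
  representative of the class that the unitary assigns to \<open>x\<close>, and identities hold almost
  everywhere.\<close>

definition L2 :: "'f measure \<Rightarrow> ('f \<Rightarrow> complex) set" where
  "L2 \<mu> = {\<phi> \<in> borel_measurable \<mu>. integrable \<mu> (\<lambda>x. (cmod (\<phi> x))\<^sup>2)}"

definition L_inf :: "'f measure \<Rightarrow> ('f \<Rightarrow> complex) set" where
  "L_inf \<mu> = {f \<in> borel_measurable \<mu>. \<exists>C. AE x in \<mu>. cmod (f x) \<le> C}"

definition unitary_to_L2 :: "'f measure \<Rightarrow> ('h::chilbert_space \<Rightarrow> 'f \<Rightarrow> complex) \<Rightarrow> bool" where
  "unitary_to_L2 \<mu> U \<longleftrightarrow>
     (\<forall>x. U x \<in> L2 \<mu>) \<and>
     (\<forall>x y. AE p in \<mu>. U (x + y) p = U x p + U y p) \<and>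
     (\<forall>c x. AE p in \<mu>. U (c *\<^sub>C x) p = c * U x p) \<and>
     (\<forall>x y. cinner x y = (LINT p|\<mu>. cnj (U x p) * U y p)) \<and>
     (\<forall>\<phi>\<in>L2 \<mu>. \<exists>x. AE p in \<mu>. U x p = \<phi> p)"

text \<open>\<open>T\<^sub>f = U\<^sup>* M\<^sub>f U\<close>\<close>

definition mult_op ::
    "'f measure \<Rightarrow> ('h::chilbert_space \<Rightarrow> 'f \<Rightarrow> complex) \<Rightarrow> ('f \<Rightarrow> complex) \<Rightarrow> ('h \<Rightarrow> 'h)" where
  "mult_op \<mu> U f x = (THE y. AE p in \<mu>. U y p = f p * U x p)"

text \<open>The map \<open>f \<mapsto> f \<circ> e\<close> from \<open>L\<^sup>\<infinity>(E, \<mu>\<^sub>\<eta>)\<close> to \<open>L\<^sup>\<infinity>(F, \<mu>)\<close> is well defined, normal and implements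
  the functional calculus. Here \<open>\<eta>\<close> is a separating vector for the von Neumann algebra generated by
  the \<open>A i\<close> and \<open>\<mu>\<^sub>\<eta>\<close> its scalar spectral measure, which lives on the joint spectrum \<open>E\<close>; classes in
  \<open>L\<^sup>\<infinity>(E, \<mu>\<^sub>\<eta>)\<close> are represented by functions on the whole of \<open>real ^ 'n\<close>. A composition map is
  automatically a \<open>*\<close>-homomorphism; normality is weak-\<open>*\<close> continuity, i.e. composing with an \<open>L\<^sup>1(F, \<mu>)\<close>
  functional gives an \<open>L\<^sup>1(E, \<mu>\<^sub>\<eta>)\<close> functional.\<close>

definition normal_composition ::
    "('n::finite \<Rightarrow> 'h::chilbert_space \<Rightarrow> 'h) \<Rightarrow> 'f measure \<Rightarrow>
     ('h \<Rightarrow> 'f \<Rightarrow> complex) \<Rightarrow> ('f \<Rightarrow> real ^ 'n) \<Rightarrow> bool" where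
  "normal_composition A \<mu> U e \<longleftrightarrow>
     (\<exists>P \<eta>. joint_spectral_measure_of A P \<and>
        (\<forall>T\<in>von_neumann_generated A. T \<eta> = 0 \<longrightarrow> T = (\<lambda>_. 0)) \<and>
        (let \<mu>\<eta> = scalar_spectral_measure P \<eta> in
          (AE p in \<mu>. e p \<in> joint_spectrum A) \<and>
          (\<forall>f\<in>L_inf \<mu>\<eta>. \<forall>g\<in>L_inf \<mu>\<eta>.
             (AE t in \<mu>\<eta>. f t = g t) \<longrightarrow> (AE p in \<mu>. f (e p) = g (e p))) \<and>
          (\<forall>g :: 'f \<Rightarrow> complex. integrable \<mu> g \<longrightarrow>
             (\<exists>g' :: real ^ 'n \<Rightarrow> complex. integrable \<mu>\<eta> g' \<and>
               (\<forall>f\<in>L_inf \<mu>\<eta>. (LINT p|\<mu>. f (e p) * g p) = (LINT t|\<mu>\<eta>. f t * g' t)))) \<and>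
          (\<forall>f\<in>L_inf \<mu>\<eta>. \<forall>x. AE p in \<mu>. U (spectral_integral P f x) p = f (e p) * U x p)))"

definition joint_spectral_representation ::
    "('n::finite \<Rightarrow> 'h::chilbert_space \<Rightarrow> 'h) \<Rightarrow> 'f measure \<Rightarrow>
     ('h \<Rightarrow> 'f \<Rightarrow> complex) \<Rightarrow> ('f \<Rightarrow> real ^ 'n) \<Rightarrow> bool" where
  "joint_spectral_representation A \<mu> U e \<longleftrightarrow>
     unitary_to_L2 \<mu> U \<and>
     e \<in> borel_measurable \<mu> \<and> bounded (e ` space \<mu>) \<and>
     (\<forall>i x. AE p in \<mu>. U (A i x) p = complex_of_real (e p $ i) * U x p)"


section \<open>The set function \<open>\<nu>\<close> and the four conditions\<close>

text \<open>\<open>GD\<close> stands for \<open>G(D)\<close>.\<close>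

definition nu ::
    "'f measure \<Rightarrow> ('h::chilbert_space \<Rightarrow> 'f \<Rightarrow> complex) \<Rightarrow> ('h \<Rightarrow> 'h) \<Rightarrow>
     ((nat \<Rightarrow>\<^sub>C real) \<Rightarrow>\<^sub>L real) \<Rightarrow> 'f set \<Rightarrow> complex" where
  "nu \<mu> U GD \<omega> J =
     dixmier_trace \<omega> (mult_op \<mu> U (indicator J) \<circ> GD \<circ> mult_op \<mu> U (indicator J))"

definition dominated_basis ::
    "'f measure \<Rightarrow> ('h::chilbert_space \<Rightarrow> 'f \<Rightarrow> complex) \<Rightarrow> (nat \<Rightarrow> 'h) \<Rightarrow> bool" where
  "dominated_basis \<mu> U h \<longleftrightarrow>
     (\<exists>l :: 'f \<Rightarrow> real. integrable \<mu> l \<and> (\<forall>m. AE p in \<mu>. (cmod (U (h m) p))\<^sup>2 \<le> l p))"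

definition zeta_tails_vanish ::
    "'f measure \<Rightarrow> ('h::chilbert_space \<Rightarrow> 'f \<Rightarrow> complex) \<Rightarrow> (nat \<Rightarrow> 'h) \<Rightarrow> (nat \<Rightarrow> real) \<Rightarrow>
     (real \<Rightarrow> real) \<Rightarrow> bool" where
  "zeta_tails_vanish \<mu> U h ev G \<longleftrightarrow>
     (\<forall>F :: nat \<Rightarrow> 'f set. range F \<subseteq> sets \<mu> \<and> disjoint_family F \<longrightarrow>
        (\<lambda>N. limsup (\<lambda>k. ereal (1 / real k *
           (\<Sum>m. G (ev m) powr (1 + 1 / real k) *
              (LINT p:(\<Union>j\<in>{N..}. F j)|\<mu>. (cmod (U (h m) p))\<^sup>2))))) \<longlonglongrightarrow> 0)"

definition projection_tails_vanish ::
    "'f measure \<Rightarrow> ('h::chilbert_space \<Rightarrow> 'f \<Rightarrow> complex) \<Rightarrow> ('h \<Rightarrow> 'h) \<Rightarrow> bool" where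
  "projection_tails_vanish \<mu> U GD \<longleftrightarrow>
     (\<forall>Q :: nat \<Rightarrow> 'h \<Rightarrow> 'h.
        (\<forall>j. projection_op (Q j) \<and> Q j \<in> mult_op \<mu> U ` L_inf \<mu>) \<and>
        (\<forall>i j. i \<noteq> j \<longrightarrow> Q i \<circ> Q j = (\<lambda>_. 0)) \<longrightarrow>
        (let P = (\<lambda>N x. \<Sum>j. Q (N + j) x)
         in (\<lambda>N. seminorm_0 (P N \<circ> GD \<circ> P N)) \<longlonglongrightarrow> 0))"

definition is_finite_ac_measure :: "'f measure \<Rightarrow> ('f set \<Rightarrow> complex) \<Rightarrow> bool" where
  "is_finite_ac_measure \<mu> \<nu> \<longleftrightarrow>
     (\<exists>M. finite_measure M \<and> sets M = sets \<mu> \<and> absolutely_continuous \<mu> M \<and>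
        (\<forall>J\<in>sets \<mu>. \<nu> J = complex_of_real (measure M J)))"

end

theory Submission
  imports Defs "HOL-Library.Function_Algebras"
begin

text \<open>Several notions are fixed by description or choice operators, and this shapes the proof:
  nothing can be said about \<open>dixmier_trace\<close> before some linear extension exists, about
  \<open>borel_calculus\<close> before the spectral measure of D is known to be unique on Borel
  sets, or about \<open>cadjoint\<close> before an adjoint exists. The eigenbasis \<open>h\<close>
  serves throughout: it witnesses infinite dimension, yields adjoints coordinatewise, and turns
  integrals against the spectral measure of D into series.

  G(D) need not commute with the projections coming from L^inf. So the eigenvectors of a compression
  are unrelated to \<open>h\<close>, and its eigenvalues are compared with G at the eigenvalues of D
  only as averages of them; this is where convexity enters.

  The choice k = ceil(ln(1 + n)) makes n to the power 1/k at most e. Passing between power sums with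
  exponent 1 + 1/k and plain sums of n singular values then costs only a constant factor, while k
  itself has the size of the logarithm in the definition of the ideal.\<close>

text \<open>
  Everything rests on Ky Fan's principle: for a positive compact \<open>T\<close>, the sum of the first \<open>k\<close>
  singular values is the maximum of \<open>\<Sum>i<k. \<langle>x\<^sub>i, T x\<^sub>i\<rangle>\<close> over orthonormal systems. Hence
  \<open>T \<mapsto> \<omega>(\<gamma>(T))\<close> is subadditive on the positive cone, and superadditive because \<open>\<omega>\<close> does not see
  the doubling of indices; so it extends linearly.

  For (i) to (ii), weak majorization of \<open>G(\<lambda>\<^sub>m)\<close> by \<open>C (ln (n + 1) - ln n)\<close> bounds
  \<open>1/k \<Sum>\<^sub>m G(\<lambda>\<^sub>m)\<^sup>1\<^sup>+\<^sup>1\<^sup>/\<^sup>k\<close>. For (ii) to (iii), Jensen's inequality bounds the sum of the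
  powers \<open>1 + 1/k\<close> of the singular values of \<open>P G(D) P\<close> by \<open>\<Sum>\<^sub>m G(\<lambda>\<^sub>m)\<^sup>1\<^sup>+\<^sup>1\<^sup>/\<^sup>k \<parallel>P h\<^sub>m\<parallel>\<^sup>2\<close>, and the
  power mean inequality with \<open>k = \<lceil>ln (1 + n)\<rceil>\<close> turns this into a bound for the first \<open>n\<close>
  singular values. For (iii) to (iv), finite additivity of \<open>\<nu>\<close> follows from unitary invariance by
  pinching with a reflection, and (iii) makes the tails vanish.
\<close>

section \<open>Inner products and positive operators\<close>

lemma cinner_add_left: "cinner (x + y) z = cinner x z + cinner y z"
  by (metis cinner_commute cinner_add_right complex_cnj_add)

lemma cinner_scaleC_left: "cinner (c *\<^sub>C x) y = cnj c * cinner x y"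
  by (metis cinner_commute cinner_scaleC_right complex_cnj_mult)

lemma cinner_scaleR_right: "cinner x (r *\<^sub>R y) = r *\<^sub>R cinner x y"
  by (simp add: scaleC_of_real[symmetric] cinner_scaleC_right scaleR_conv_of_real)

lemma cinner_scaleR_left: "cinner (r *\<^sub>R x) y = r *\<^sub>R cinner x y"
  by (simp add: scaleC_of_real[symmetric] cinner_scaleC_left scaleR_conv_of_real)

lemma cinner_self: "cinner x x = complex_of_real ((norm x)\<^sup>2)"
proof -
  have "Im (cinner x x) = - Im (cinner x x)"
    using arg_cong[OF cinner_commute[of x x], of Im] by simp
  then have "Im (cinner x x) = 0" by simp
  moreover have "0 \<le> Re (cinner x x)"
    using norm_ge_zero[of x] unfolding norm_eq_sqrt_cinner by simp
  ultimately show ?thesis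
    by (simp add: norm_eq_sqrt_cinner complex_eq_iff)
qed

lemma scaleC_zero_left [simp]: "0 *\<^sub>C (x::'h::chilbert_space) = 0"
  using scaleC_of_real[of 0 x] by simp

lemma scaleC_one [simp]: "1 *\<^sub>C (x::'h::chilbert_space) = x"
  using scaleC_of_real[of 1 x] by simp

lemma scaleC_zero_right [simp]: "c *\<^sub>C (0::'h::chilbert_space) = 0"
  using scaleC_add_right[of c "0::'h" 0] by simp

lemma scaleC_minus_right: "c *\<^sub>C (- x) = - (c *\<^sub>C (x::'h::chilbert_space))"
  using scaleC_add_right[of c x "- x"] by (simp add: eq_neg_iff_add_eq_0 add.commute)

lemma scaleC_diff_right: "c *\<^sub>C (x - y) = c *\<^sub>C x - c *\<^sub>C (y::'h::chilbert_space)"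
  using scaleC_add_right[of c x "- y"] by (simp add: scaleC_minus_right)

lemma scaleC_scaleR: "c *\<^sub>C (r *\<^sub>R x) = r *\<^sub>R (c *\<^sub>C (x::'h::chilbert_space))"
  by (simp add: scaleC_of_real[symmetric] scaleC_scaleC mult.commute)

lemma norm_scaleC: "norm (c *\<^sub>C (x::'h::chilbert_space)) = cmod c * norm x"
proof -
  have "complex_of_real ((norm (c *\<^sub>C x))\<^sup>2) = c * cnj c * of_real ((norm x)\<^sup>2)"
    by (simp only: cinner_self[symmetric] cinner_scaleC_left cinner_scaleC_right mult.assoc
        mult.left_commute)
  then have "(norm (c *\<^sub>C x))\<^sup>2 = (cmod c * norm x)\<^sup>2"
    by (metis complex_norm_square of_real_eq_iff of_real_mult power_mult_distrib)
  then show ?thesis by simp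
qed

text \<open>\<open>positive_op\<close> excludes the zero operator, so it is not stable under
  compression or scaling by 0. This variant is a convex cone containing 0.\<close>

definition psd_op :: "('h::chilbert_space \<Rightarrow> 'h) \<Rightarrow> bool" where
  "psd_op T \<longleftrightarrow> bounded_clinear T \<and> (\<forall>x. cinner x (T x) \<in> nonneg_Reals)"

lemma positive_op_iff: "positive_op T \<longleftrightarrow> psd_op T \<and> T \<noteq> (\<lambda>_. 0)"
  by (auto simp: positive_op_def psd_op_def)

lemma bounded_clinear_linear: "bounded_clinear T \<Longrightarrow> linear T"
  by (simp add: bounded_clinear_def bounded_linear.linear)

lemma bounded_clinear_bounded_linear: "bounded_clinear T \<Longrightarrow> bounded_linear T"
  by (simp add: bounded_clinear_def)

lemma bounded_clinear_scaleC: "bounded_clinear T \<Longrightarrow> T (c *\<^sub>C x) = c *\<^sub>C T x"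
  by (simp add: bounded_clinear_def)

lemma bounded_clinear_add: "bounded_clinear T \<Longrightarrow> T (x + y) = T x + T y"
  by (simp add: bounded_clinear_linear linear_add)

lemma bounded_clinear_id: "bounded_clinear id"
  by (simp add: bounded_clinear_def id_def)

lemma psd_op_id: "psd_op (id :: 'h::chilbert_space \<Rightarrow> 'h)"
  by (auto simp: psd_op_def bounded_clinear_id cinner_self)

lemma psd_op_Re_nonneg: "psd_op T \<Longrightarrow> 0 \<le> Re (cinner x (T x))"
  by (auto simp: psd_op_def complex_nonneg_Reals_iff)

lemma psd_op_self: "psd_op T \<Longrightarrow> cinner x (T x) = of_real (Re (cinner x (T x)))"
  by (auto simp: psd_op_def complex_nonneg_Reals_iff complex_eq_iff)

text \<open>Special values of c isolate the off-diagonal terms: 1 and \<i> in polarization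
  arguments, a real multiple of the conjugate of <x, T y> for Cauchy-Schwarz.\<close>

lemma cinner_quadratic_add:
  assumes "bounded_clinear T"
  shows "cinner (x + c *\<^sub>C y) (T (x + c *\<^sub>C y)) = cinner x (T x) + c * cinner x (T y)
    + cnj c * cinner y (T x) + c * cnj c * cinner y (T y)"
  using assms by (simp add: bounded_clinear_add bounded_clinear_scaleC cinner_add_left
      cinner_add_right cinner_scaleC_left cinner_scaleC_right algebra_simps)

text \<open>Real form values at x + y and x + i y give the two real equations saying that <y, T x>
  is the conjugate of <x, T y>.\<close>

lemma psd_op_symmetric:
  assumes T: "psd_op T"
  shows "cinner (T x) y = cinner x (T y)"
proof -
  have b: "bounded_clinear T" using T by (simp add: psd_op_def)
  have im: "Im (cinner z (T z)) = 0" for z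
    using T by (auto simp: psd_op_def complex_nonneg_Reals_iff)
  have "Im (cinner x (T y)) + Im (cinner y (T x)) = 0"
    using cinner_quadratic_add[OF b, of x 1 y] im[of "x + 1 *\<^sub>C y"] im[of x] im[of y]
    by (simp add: complex_eq_iff)
  moreover have "Re (cinner x (T y)) - Re (cinner y (T x)) = 0"
    using cinner_quadratic_add[OF b, of x \<i> y] im[of "x + \<i> *\<^sub>C y"] im[of x] im[of y]
    by (simp add: complex_eq_iff)
  ultimately have "cinner y (T x) = cnj (cinner x (T y))"
    by (simp add: complex_eq_iff)
  then show ?thesis
    using cinner_commute[of "T x" y] by simp
qed

text \<open>The discriminant argument for the semidefinite form <x, T y>: a multiplier proportional
  to the conjugate of b rotates the cross term onto the real line and leaves a real quadratic in
  t.\<close>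

lemma psd_op_Cauchy_Schwarz:
  assumes T: "psd_op T"
  shows "(cmod (cinner x (T y)))\<^sup>2 \<le> Re (cinner x (T x)) * Re (cinner y (T y))"
proof -
  define b a d where "b = cinner x (T y)" and "a = Re (cinner x (T x))" and "d = Re (cinner y (T y))"
  have bc: "bounded_clinear T" using T by (simp add: psd_op_def)
  have yx: "cinner y (T x) = cnj b"
    unfolding b_def using psd_op_symmetric[OF T, of x y] cinner_commute[of y "T x"] by simp
  have q: "0 \<le> a - 2 * t * (cmod b)\<^sup>2 + t\<^sup>2 * (cmod b)\<^sup>2 * d" for t :: real
  proof -
    let ?c = "- complex_of_real t * cnj b"
    have "cinner (x + ?c *\<^sub>C y) (T (x + ?c *\<^sub>C y)) = of_real a + ?c * b + cnj ?c * cnj b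
        + ?c * cnj ?c * of_real d"
      unfolding cinner_quadratic_add[OF bc] yx
      using psd_op_self[OF T, of x] psd_op_self[OF T, of y] by (simp add: a_def b_def d_def)
    also have "\<dots> = of_real (a - 2 * t * (cmod b)\<^sup>2 + t\<^sup>2 * (cmod b)\<^sup>2 * d)"
      unfolding of_real_add of_real_diff of_real_mult complex_norm_square
      by (simp add: algebra_simps power2_eq_square)
    finally show ?thesis
      using psd_op_Re_nonneg[OF T, of "x + ?c *\<^sub>C y"] by simp
  qed
  have a: "0 \<le> a" and d: "0 \<le> d" unfolding a_def d_def using T by (auto intro: psd_op_Re_nonneg)
  have "(cmod b)\<^sup>2 \<le> a * d"
  proof (cases "d = 0")
    case True
    have "(cmod b)\<^sup>2 = 0"
    proof (rule ccontr)
      assume "(cmod b)\<^sup>2 \<noteq> 0"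
      \<comment> \<open>With d = 0 the quadratic is affine in t, and this t gives it the value
        -1.\<close>
      then show False using q[of "(a + 1) / (2 * (cmod b)\<^sup>2)"] True a by (simp add: field_simps)
    qed
    then show ?thesis using True by simp
  next
    case False
    then have d: "d > 0" using d by simp
    have "0 \<le> a - 2 * (1/d) * (cmod b)\<^sup>2 + (1/d)\<^sup>2 * (cmod b)\<^sup>2 * d" by (rule q)
    also have "\<dots> = a - (cmod b)\<^sup>2 / d" using d by (simp add: field_simps power2_eq_square)
    finally show ?thesis using d by (simp add: field_simps)
  qed
  then show ?thesis by (simp add: a_def b_def d_def)
qed

lemma Cauchy_Schwarz_cinner: "cmod (cinner x y) \<le> norm x * norm (y::'h::chilbert_space)"
proof -
  have "(cmod (cinner x y))\<^sup>2 \<le> (norm x * norm y)\<^sup>2"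
    using psd_op_Cauchy_Schwarz[OF psd_op_id, of x y] by (simp add: cinner_self power_mult_distrib)
  then show ?thesis by (simp add: power2_le_iff_abs_le)
qed

interpretation cinner: bounded_bilinear "cinner :: 'h::chilbert_space \<Rightarrow> 'h \<Rightarrow> complex"
proof
  show "\<exists>K. \<forall>a b. cmod (cinner a b) \<le> norm (a::'h) * norm (b::'h) * K"
    by (intro exI[of _ 1]) (simp add: Cauchy_Schwarz_cinner)
qed (simp_all add: cinner_add_left cinner_add_right cinner_scaleR_left cinner_scaleR_right)

lemma bounded_clinear_scaleC_right: "bounded_linear (\<lambda>x::'h::chilbert_space. c *\<^sub>C x)"
  by (rule bounded_linear_intro[of _ "cmod c"])
    (auto simp: scaleC_add_right scaleC_scaleR norm_scaleC)

lemma scaleC_diff_left: "(c - d) *\<^sub>C (x::'h::chilbert_space) = c *\<^sub>C x - d *\<^sub>C x"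
  using scaleC_add_left[of "c - d" d x] by simp

lemma scaleC_minus_left: "(- c) *\<^sub>C (x::'h::chilbert_space) = - (c *\<^sub>C x)"
  using scaleC_diff_left[of 0 c x] by simp

lemma cinner_eqI: "(\<And>z. cinner z x = cinner z y) \<Longrightarrow> x = (y::'h::chilbert_space)"
  using cinner_self[of "x - y"] by (simp add: cinner.diff_right)

text \<open>The multipliers 1 and \<i> separate the two off-diagonal terms. Over the reals, rotation
  by a right angle would be a counterexample.\<close>

lemma polarization_zero:
  assumes b: "bounded_clinear T" and z: "\<And>x. cinner x (T x) = 0"
  shows "T x = 0"
proof -
  have "cinner y (T x) = 0" for y
  proof -
    have 1: "cinner y (T x) + cinner x (T y) = 0"
      using cinner_quadratic_add[OF b, of y 1 x] z by simp
    have 2: "\<i> * cinner y (T x) - \<i> * cinner x (T y) = 0"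
      using cinner_quadratic_add[OF b, of y \<i> x] z by simp
    have "2 * cinner y (T x) = 0" using 1 2 by (simp add: complex_eq_iff)
    then show ?thesis by simp
  qed
  then show ?thesis by (intro cinner_eqI) (simp add: cinner.zero_right)
qed

section \<open>Algebra of bounded and positive operators, adjoints\<close>

lemma bounded_clinear_intro:
  assumes "\<And>x y. T (x + y) = T x + T y" "\<And>c x. T (c *\<^sub>C x) = c *\<^sub>C T x"
    "\<And>x. norm (T x) \<le> norm x * K"
  shows "bounded_clinear T"
  unfolding bounded_clinear_def
  using bounded_linear_intro[of T K] assms by (auto simp flip: scaleC_of_real)

lemma bounded_clinear_compose:
  "bounded_clinear S \<Longrightarrow> bounded_clinear T \<Longrightarrow> bounded_clinear (S \<circ> T)"
  unfolding bounded_clinear_def by (simp add: bounded_linear_compose o_def)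

lemma bounded_clinear_plus:
  "bounded_clinear S \<Longrightarrow> bounded_clinear T \<Longrightarrow> bounded_clinear (\<lambda>x. S x + T x)"
  unfolding bounded_clinear_def by (simp add: bounded_linear_add scaleC_add_right)

lemma bounded_clinear_minus:
  "bounded_clinear S \<Longrightarrow> bounded_clinear T \<Longrightarrow> bounded_clinear (\<lambda>x. S x - T x)"
  unfolding bounded_clinear_def by (simp add: bounded_linear_sub scaleC_diff_right)

lemma bounded_clinear_scale: "bounded_clinear T \<Longrightarrow> bounded_clinear (\<lambda>x. c *\<^sub>C T x)"
  unfolding bounded_clinear_def
  by (simp add: bounded_linear_compose[OF bounded_clinear_scaleC_right] scaleC_scaleC mult.commute)

lemma bounded_clinear_scaleR: "bounded_clinear T \<Longrightarrow> bounded_clinear (\<lambda>x. r *\<^sub>R T x)"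
  using bounded_clinear_scale[of T "of_real r"] by (simp add: scaleC_of_real)

lemma bounded_clinear_zero: "bounded_clinear (\<lambda>_. 0)"
  by (simp add: bounded_clinear_def)

lemma bounded_clinear_bound:
  assumes "bounded_clinear T"
  obtains K where "0 < K" "\<And>x. norm (T x) \<le> norm x * K"
  using bounded_linear.pos_bounded[OF bounded_clinear_bounded_linear[OF assms]] by blast

lemma quadratic_form_eqI:
  assumes "bounded_clinear S" "bounded_clinear T" "\<And>x. cinner x (S x) = cinner x (T x)"
  shows "S = T"
proof
  fix x
  show "S x = T x"
    using polarization_zero[OF bounded_clinear_minus[OF assms(1,2)], of x] assms(3)
    by (simp add: cinner.diff_right)
qed

lemma psd_op_plus: "psd_op S \<Longrightarrow> psd_op T \<Longrightarrow> psd_op (\<lambda>x. S x + T x)"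
  unfolding psd_op_def by (simp add: bounded_clinear_plus cinner_add_right nonneg_Reals_add_I)

lemma psd_op_scaleR: "0 \<le> r \<Longrightarrow> psd_op T \<Longrightarrow> psd_op (\<lambda>x. r *\<^sub>R T x)"
  unfolding psd_op_def
  by (simp add: bounded_clinear_scaleR cinner_scaleR_right scaleR_conv_of_real nonneg_Reals_mult_I)

lemma psd_op_zero: "psd_op (\<lambda>_. 0)"
  by (simp add: psd_op_def bounded_clinear_zero cinner.zero_right)

lemma psd_op_conj:
  assumes T: "psd_op T" and P: "bounded_clinear P" "\<And>x y. cinner (P x) y = cinner x (P y)"
  shows "psd_op (P \<circ> T \<circ> P)"
  using T P(1) unfolding psd_op_def
  by (auto simp: P(2)[symmetric] intro!: bounded_clinear_compose)

text \<open>Testing against all vectors leaves only one candidate, so any operator satisfying the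
  adjoint relation resolves the description in \<open>cadjoint\<close>.\<close>

lemma cadjoint_eqI:
  assumes "bounded_clinear S" "\<And>x y. cinner (S x) y = cinner x (T y)"
  shows "cadjoint T = S"
  unfolding cadjoint_def
proof (rule the_equality)
  fix S' assume S': "bounded_clinear S' \<and> (\<forall>x y. cinner (S' x) y = cinner x (T y))"
  show "S' = S"
  proof
    fix x show "S' x = S x"
    proof (rule cinner_eqI)
      fix z show "cinner z (S' x) = cinner z (S x)"
        using S' assms(2) cinner_commute[of z "S' x"] cinner_commute[of z "S x"] by simp
    qed
  qed
qed (use assms in auto)

lemma cadjoint_symmetric:
  assumes "bounded_clinear T" "\<And>x y. cinner (T x) y = cinner x (T y)"
  shows "cadjoint T = T"
  using assms by (rule cadjoint_eqI)

lemma projection_opI: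
  assumes "bounded_clinear P" "\<And>x y. cinner (P x) y = cinner x (P y)" "\<And>x. P (P x) = P x"
  shows "projection_op P"
  using assms by (auto simp: projection_op_def selfadjoint_op_def cadjoint_symmetric)

section \<open>Finite orthonormal systems\<close>

text \<open>For an orthonormal system this is the orthogonal projection onto its span. The equation
  \<open>onproj I e x = x\<close> serves as the statement that x lies in the span.\<close>

definition onproj :: "nat set \<Rightarrow> (nat \<Rightarrow> 'h::chilbert_space) \<Rightarrow> 'h \<Rightarrow> 'h" where
  "onproj I e x = (\<Sum>i\<in>I. cinner (e i) x *\<^sub>C e i)"

lemma orthonormal_on_subset: "orthonormal_on I e \<Longrightarrow> J \<subseteq> I \<Longrightarrow> orthonormal_on J e"
  unfolding orthonormal_on_def by blast

lemma orthonormal_on_norm: "orthonormal_on I e \<Longrightarrow> i \<in> I \<Longrightarrow> norm (e i) = 1"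
  by (auto simp: orthonormal_on_def norm_eq_sqrt_cinner)

lemma cinner_onproj:
  assumes "orthonormal_on I e" "finite I" "i \<in> I"
  shows "cinner (e i) (onproj I e x) = cinner (e i) x"
proof -
  have "cinner (e i) (onproj I e x) = (\<Sum>j\<in>I. cinner (e j) x * (if i = j then 1 else 0))"
    unfolding onproj_def cinner.sum_right
    by (rule sum.cong) (use assms in \<open>auto simp: cinner_scaleC_right orthonormal_on_def\<close>)
  also have "\<dots> = cinner (e i) x"
    using assms by (simp add: if_distrib cong: if_cong)
  finally show ?thesis .
qed

lemma cinner_onproj_residual:
  assumes "orthonormal_on I e" "finite I" "i \<in> I"
  shows "cinner (e i) (x - onproj I e x) = 0"
  using cinner_onproj[OF assms] by (simp add: cinner.diff_right)

lemma cinner_onproj_left: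
  assumes "\<And>i. i \<in> I \<Longrightarrow> cinner (e i) y = 0"
  shows "cinner (onproj I e x) y = 0" "cinner y (onproj I e x) = 0"
proof -
  have "cinner y (e i) = 0" if "i \<in> I" for i
    by (subst cinner_commute) (simp add: assms[OF that])
  then show "cinner (onproj I e x) y = 0" "cinner y (onproj I e x) = 0"
    by (simp_all add: onproj_def cinner.sum_left cinner.sum_right cinner_scaleC_left
        cinner_scaleC_right assms)
qed

lemma cinner_onproj_self:
  assumes "orthonormal_on I e" "finite I"
  shows "cinner x (onproj I e x) = of_real (\<Sum>i\<in>I. (cmod (cinner (e i) x))\<^sup>2)"
  unfolding onproj_def cinner.sum_right of_real_sum complex_norm_square cinner_scaleC_right
  by (rule sum.cong) (simp_all flip: cinner_commute)

lemma norm_onproj_residual: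
  assumes "orthonormal_on I e" "finite I"
  shows "(norm (x - onproj I e x))\<^sup>2 = (norm x)\<^sup>2 - (\<Sum>i\<in>I. (cmod (cinner (e i) x))\<^sup>2)"
proof -
  let ?y = "x - onproj I e x"
  have "cinner ?y ?y = cinner x ?y - cinner (onproj I e x) ?y"
    by (rule cinner.diff_left)
  also have "cinner (onproj I e x) ?y = 0"
    by (rule cinner_onproj_left(1)) (rule cinner_onproj_residual[OF assms])
  also have "cinner x ?y - 0 = of_real ((norm x)\<^sup>2 - (\<Sum>i\<in>I. (cmod (cinner (e i) x))\<^sup>2))"
    by (simp only: cinner.diff_right cinner_onproj_self[OF assms] cinner_self of_real_diff diff_0_right)
  finally show ?thesis unfolding cinner_self of_real_eq_iff .
qed

lemma bessel:
  assumes "orthonormal_on I e" "finite I"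
  shows "(\<Sum>i\<in>I. (cmod (cinner (e i) x))\<^sup>2) \<le> (norm x)\<^sup>2"
  using norm_onproj_residual[OF assms, of x] zero_le_power2[of "norm (x - onproj I e x)"] by linarith

lemma onproj_eq_iff:
  assumes "orthonormal_on I e" "finite I"
  shows "onproj I e x = x \<longleftrightarrow> (\<Sum>i\<in>I. (cmod (cinner (e i) x))\<^sup>2) = (norm x)\<^sup>2"
  using norm_onproj_residual[OF assms, of x]
  by auto

lemma cmod_cinner_commute: "cmod (cinner x y) = cmod (cinner y x)"
  using cinner_commute[of x y] by simp

text \<open>Counting the double sum of \<open>\<bar>\<langle>e\<^sub>i, f\<^sub>j\<rangle>\<bar>\<^sup>2\<close> in both orders replaces dimension theory.\<close>

lemma orthonormal_exceeds_span:
  assumes e: "orthonormal_on I e" "finite I" and f: "orthonormal_on J f" "finite J"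
    and "card I < card J"
  shows "\<exists>j\<in>J. onproj I e (f j) \<noteq> f j"
proof (rule ccontr)
  assume "\<not> ?thesis"
  then have "(\<Sum>i\<in>I. (cmod (cinner (e i) (f j)))\<^sup>2) = 1" if "j \<in> J" for j
    using onproj_eq_iff[OF e] orthonormal_on_norm[OF f(1)] that by force
  then have "real (card J) = (\<Sum>j\<in>J. \<Sum>i\<in>I. (cmod (cinner (e i) (f j)))\<^sup>2)" by simp
  also have "\<dots> = (\<Sum>i\<in>I. \<Sum>j\<in>J. (cmod (cinner (f j) (e i)))\<^sup>2)"
    by (subst sum.swap) (simp add: cmod_cinner_commute)
  also have "\<dots> \<le> (\<Sum>i\<in>I. 1)"
  proof (rule sum_mono)
    fix i assume "i \<in> I"
    then show "(\<Sum>j\<in>J. (cmod (cinner (f j) (e i)))\<^sup>2) \<le> 1"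
      using bessel[OF f, of "e i"] orthonormal_on_norm[OF e(1)] by simp
  qed
  finally show False using assms(5) by simp
qed

text \<open>An infinite orthonormal system cannot lie in the span of n vectors: one of h 0, ..., h n
  has a nonzero residual, which is then normalised.\<close>

lemma orthogonal_unit_vector:
  fixes e h :: "nat \<Rightarrow> 'h::chilbert_space"
  assumes e: "orthonormal_on {..<n} e" and h: "orthonormal_on (UNIV::nat set) h"
  obtains u where "norm u = 1" "\<And>i. i < n \<Longrightarrow> cinner (e i) u = 0"
proof -
  have "\<exists>j\<in>{..n}. onproj {..<n} e (h j) \<noteq> h j"
    by (rule orthonormal_exceeds_span[OF e]) (use h orthonormal_on_subset in auto)
  then obtain j where j: "onproj {..<n} e (h j) \<noteq> h j" by blast
  let ?y = "h j - onproj {..<n} e (h j)"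
  have "cinner (e i) ?y = 0" if "i < n" for i
    by (rule cinner_onproj_residual[OF e]) (use that in auto)
  then show thesis
    using j that[of "(1 / norm ?y) *\<^sub>R ?y"] by (simp add: cinner_scaleR_right)
qed

lemma orthonormal_on_Suc:
  assumes "orthonormal_on {..<n} e" "norm (e n) = 1" "\<And>i. i < n \<Longrightarrow> cinner (e i) (e n) = 0"
  shows "orthonormal_on {..<Suc n} e"
proof -
  have "cinner (e n) (e n) = 1" using assms(2) by (simp add: cinner_self)
  moreover have "cinner (e n) (e i) = 0" if "i < n" for i
    by (subst cinner_commute) (simp add: assms(3) that)
  ultimately show ?thesis
    using assms unfolding orthonormal_on_def by (auto simp: less_Suc_eq)
qed

lemma orthonormal_on_cong:
  "orthonormal_on I e \<Longrightarrow> (\<And>i. i \<in> I \<Longrightarrow> e i = f i) \<Longrightarrow> orthonormal_on I f"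
  by (simp add: orthonormal_on_def)

text \<open>The system has exactly m members even if the vectors v i are dependent: a vanishing
  residual is replaced by an arbitrary orthogonal unit vector. The exact count later yields the
  index 2k.\<close>

lemma gram_schmidt:
  fixes v h :: "nat \<Rightarrow> 'h::chilbert_space"
  assumes h: "orthonormal_on UNIV h"
  shows "\<exists>g. orthonormal_on {..<m} g \<and> (\<forall>i<m. onproj {..<m} g (v i) = v i)"
proof (induction m)
  case 0
  then show ?case by (simp add: orthonormal_on_def)
next
  case (Suc m)
  then obtain g where g: "orthonormal_on {..<m} g" "\<And>i. i < m \<Longrightarrow> onproj {..<m} g (v i) = v i"
    by blast
  let ?y = "v m - onproj {..<m} g (v m)"
  have y: "cinner (g i) ?y = 0" if "i < m" for i
    by (rule cinner_onproj_residual[OF g(1)]) (use that in auto)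
  obtain u where u: "norm u = 1" "\<And>i. i < m \<Longrightarrow> cinner (g i) u = 0" "cinner u ?y *\<^sub>C u = ?y"
  proof (cases "?y = 0")
    case True
    obtain u where "norm u = 1" "\<And>i. i < m \<Longrightarrow> cinner (g i) u = 0"
      by (rule orthogonal_unit_vector[OF g(1) h]) blast
    with True that show thesis by (simp add: cinner.zero_right)
  next
    case False
    let ?u = "(1 / norm ?y) *\<^sub>R ?y"
    have "cinner ?u ?y = of_real (norm ?y)"
      using False
      by (simp add: cinner_scaleR_left cinner_self scaleR_conv_of_real power2_eq_square)
    then have "cinner ?u ?y *\<^sub>C ?u = ?y" using False by (simp add: scaleC_of_real)
    then show thesis using False y by (intro that[of ?u]) (auto simp: cinner_scaleR_right)
  qed
  define g' where "g' = g(m := u)"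
  have g': "g' i = g i" if "i < m" for i using that by (simp add: g'_def)
  have on: "orthonormal_on {..<Suc m} g'"
    by (rule orthonormal_on_Suc[OF orthonormal_on_cong[OF g(1)]]) (use u in \<open>auto simp: g'_def\<close>)
  have split: "onproj {..<Suc m} g' x = onproj {..<m} g x + cinner u x *\<^sub>C u" for x
    using g' by (simp add: onproj_def g'_def)
  have u': "cinner u (onproj {..<m} g x) = 0" for x
    by (rule cinner_onproj_left(2)) (use u in auto)
  have "onproj {..<Suc m} g' (v i) = v i" if "i < Suc m" for i
  proof (cases "i = m")
    case True
    have "cinner u (v m) = cinner u ?y" using u'[of "v m"] by (simp add: cinner.diff_right)
    then show ?thesis using u(3) True by (simp add: split)
  next
    case False
    then have i: "i < m" using that by simp
    have "cinner u (v i) = 0" using u'[of "v i"] g(2)[OF i] by simp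
    then show ?thesis by (simp add: split g(2)[OF i])
  qed
  then show ?case using on by blast
qed

section \<open>Compact positive operators and their singular values\<close>

lemma compact_opI:
  assumes "bounded_clinear T" "compact K" "T ` cball 0 1 \<subseteq> K"
  shows "compact_op T"
proof -
  have "closure (T ` cball 0 1) \<subseteq> K"
    by (rule closure_minimal[OF assms(3)]) (simp add: assms(2) compact_imp_closed)
  then have "K \<inter> closure (T ` cball 0 1) = closure (T ` cball 0 1)" by blast
  then have "compact (closure (T ` cball 0 1))"
    using compact_Int_closed[OF assms(2) closed_closure] by metis
  then show ?thesis using assms(1) by (simp add: compact_op_def)
qed

lemma compact_op_plus:
  assumes S: "compact_op S" and T: "compact_op T"
  shows "compact_op (\<lambda>x. S x + T x)"
proof (rule compact_opI)
  let ?A = "closure (S ` cball 0 1)" and ?B = "closure (T ` cball 0 1)"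
  show "bounded_clinear (\<lambda>x. S x + T x)"
    using S T by (simp add: compact_op_def bounded_clinear_plus)
  show "compact {x + y |x y. x \<in> ?A \<and> y \<in> ?B}"
    by (rule compact_sums) (use S T in \<open>simp_all add: compact_op_def\<close>)
  show "(\<lambda>x. S x + T x) ` cball 0 1 \<subseteq> {x + y |x y. x \<in> ?A \<and> y \<in> ?B}"
    using closure_subset[of "S ` cball 0 1"] closure_subset[of "T ` cball 0 1"] by blast
qed

lemma compact_op_compose_left:
  assumes S: "bounded_clinear S" and T: "compact_op T"
  shows "compact_op (S \<circ> T)"
proof (rule compact_opI)
  show "bounded_clinear (S \<circ> T)"
    using assms by (simp add: compact_op_def bounded_clinear_compose)
  show "compact (S ` closure (T ` cball 0 1))"
    using T by (intro compact_continuous_image linear_continuous_on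
        bounded_clinear_bounded_linear[OF S]) (simp add: compact_op_def)
  show "(S \<circ> T) ` cball 0 1 \<subseteq> S ` closure (T ` cball 0 1)"
    using closure_subset[of "T ` cball 0 1"] by auto
qed

lemma compact_op_compose_right:
  assumes S: "bounded_clinear S" and T: "compact_op T"
  shows "compact_op (T \<circ> S)"
proof -
  obtain K where K: "0 < K" "\<And>x. norm (S x) \<le> norm x * K" using bounded_clinear_bound[OF S] by blast
  have T': "bounded_clinear T" using T by (simp add: compact_op_def)
  show ?thesis
  proof (rule compact_opI)
    show "bounded_clinear (T \<circ> S)"
      using S T' by (simp add: bounded_clinear_compose)
    show "compact ((\<lambda>z. K *\<^sub>R z) ` closure (T ` cball 0 1))"
      using T by (intro compact_scaling) (simp add: compact_op_def)
    show "(T \<circ> S) ` cball 0 1 \<subseteq> (\<lambda>z. K *\<^sub>R z) ` closure (T ` cball 0 1)"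
    proof clarify
      fix x :: 'a assume x: "x \<in> cball 0 1"
      let ?z = "(1 / K) *\<^sub>R S x"
      have "norm x * K \<le> 1 * K" using x K(1) by (intro mult_right_mono) auto
      then have "norm (S x) \<le> K" using K(2)[of x] by linarith
      then have "?z \<in> cball 0 1" using K(1) by simp
      then have "T ?z \<in> closure (T ` cball 0 1)"
        by (meson closure_subset imageI subsetD)
      moreover have "(T \<circ> S) x = K *\<^sub>R T ?z"
        using K(1) by (simp add: linear_scale[OF bounded_clinear_linear[OF T']])
      ultimately show "(T \<circ> S) x \<in> (\<lambda>z. K *\<^sub>R z) ` closure (T ` cball 0 1)" by blast
    qed
  qed
qed

lemma compact_op_scaleR: "compact_op T \<Longrightarrow> compact_op (\<lambda>x. r *\<^sub>R T x)"
  using compact_op_compose_left[OF bounded_clinear_scaleR[OF bounded_clinear_id], of T r]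
  by (simp add: o_def)

lemma compact_op_zero: "compact_op (\<lambda>_. 0)"
  by (rule compact_opI[of _ "{0}"]) (auto simp: bounded_clinear_zero)

lemma compact_op_convergent_subseq:
  assumes "compact_op T" "\<And>n::nat. norm (x n) \<le> 1"
  obtains l r where "strict_mono r" "(\<lambda>n. T (x (r n))) \<longlonglongrightarrow> l"
proof -
  have "seq_compact (closure (T ` cball 0 1))"
    using assms(1) by (simp add: compact_op_def compact_imp_seq_compact)
  moreover have "T (x n) \<in> closure (T ` cball 0 1)" for n
    using assms(2)[of n] closure_subset by (metis dist_0_norm image_eqI mem_cball subsetD)
  ultimately obtain l r where "strict_mono r" "((\<lambda>n. T (x n)) \<circ> r) \<longlonglongrightarrow> l"
    using seq_compactE[of "closure (T ` cball 0 1)" "\<lambda>n. T (x n)"] by metis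
  then show thesis using that by (auto simp: o_def)
qed

text \<open>Cauchy-Schwarz for the form of T, applied to T x and x, bounds the fourth power of norm
  (T x) by the product of the two form values. As only x and T x are tested, the lemma applies on an
  invariant subspace.\<close>

lemma psd_op_norm_le:
  assumes T: "psd_op T" and "0 \<le> l"
    and x: "Re (cinner x (T x)) \<le> l * (norm x)\<^sup>2"
    and Tx: "Re (cinner (T x) (T (T x))) \<le> l * (norm (T x))\<^sup>2"
  shows "norm (T x) \<le> l * norm x"
proof (cases "T x = 0")
  case False
  have "(cmod (cinner (T x) (T x)))\<^sup>2 \<le> Re (cinner (T x) (T (T x))) * Re (cinner x (T x))"
    by (rule psd_op_Cauchy_Schwarz[OF T])
  also have "\<dots> \<le> (l * (norm (T x))\<^sup>2) * (l * (norm x)\<^sup>2)"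
    using assms by (intro mult_mono) (auto simp: psd_op_Re_nonneg)
  finally have "(norm (T x))\<^sup>2 * (norm (T x))\<^sup>2 \<le> (norm (T x))\<^sup>2 * (l * norm x)\<^sup>2"
    unfolding cinner_self norm_of_real power2_eq_square by (simp add: mult_ac)
  then have "(norm (T x))\<^sup>2 \<le> (l * norm x)\<^sup>2"
    using False by (subst (asm) mult_le_cancel_left_pos) auto
  then show ?thesis using \<open>0 \<le> l\<close> by (simp add: power2_le_iff_abs_le)
qed (use assms in simp)

text \<open>The supremum l of the Rayleigh quotient on M is attained: unit vectors that nearly
  attain it are approximate eigenvectors, and compactness makes a subsequence of their images
  converge. Invariance of M gives norm (T x) <= l norm x there.\<close>

lemma compact_psd_max_eigenvector:
  fixes T :: "'h::chilbert_space \<Rightarrow> 'h"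
  assumes T: "psd_op T" "compact_op T"
    and M: "closed M" "\<And>r x. x \<in> M \<Longrightarrow> r *\<^sub>R x \<in> M" "\<And>x. x \<in> M \<Longrightarrow> T x \<in> M"
    and z: "z \<in> M" "z \<noteq> 0"
  shows "\<exists>u l. u \<in> M \<and> norm u = 1 \<and> 0 \<le> l \<and> T u = l *\<^sub>R u \<and>
    (\<forall>x\<in>M. Re (cinner x (T x)) \<le> l * (norm x)\<^sup>2)"
proof -
  have bc: "bounded_clinear T" using T(1) by (simp add: psd_op_def)
  note lin = bounded_clinear_linear[OF bc]
  obtain K where K: "0 < K" "\<And>x. norm (T x) \<le> norm x * K" using bounded_clinear_bound[OF bc] by blast
  define S where "S = {Re (cinner x (T x)) |x. x \<in> M \<and> norm x = 1}"
  define l where "l = Sup S"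
  have bdd: "bdd_above S"
  proof (rule bdd_aboveI[of _ K])
    fix t assume "t \<in> S"
    then obtain x where x: "norm x = 1" "t = Re (cinner x (T x))" by (auto simp: S_def)
    have "t \<le> cmod (cinner x (T x))" unfolding x by (rule complex_Re_le_cmod)
    also have "\<dots> \<le> norm x * norm (T x)" by (rule Cauchy_Schwarz_cinner)
    also have "\<dots> \<le> K" using K(2)[of x] x by simp
    finally show "t \<le> K" .
  qed
  define z' where "z' = (1 / norm z) *\<^sub>R z"
  have z': "z' \<in> M" "norm z' = 1" using z M(2) by (auto simp: z'_def)
  have ne: "S \<noteq> {}" using z' by (auto simp: S_def)
  have le: "Re (cinner x (T x)) \<le> l * (norm x)\<^sup>2" if "x \<in> M" for x
  proof (cases "x = 0")
    case True
    then show ?thesis by (simp add: cinner.zero_left)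
  next
    case False
    let ?x = "(1 / norm x) *\<^sub>R x"
    have "Re (cinner ?x (T ?x)) \<in> S" using False M(2)[OF that] by (auto simp: S_def)
    then have "Re (cinner ?x (T ?x)) \<le> l" unfolding l_def by (rule cSup_upper) (rule bdd)
    moreover have "Re (cinner ?x (T ?x)) = Re (cinner x (T x)) / (norm x)\<^sup>2"
      by (simp add: linear_scale[OF lin] cinner_scaleR_left cinner_scaleR_right power2_eq_square)
    ultimately show ?thesis using False by (simp add: field_simps)
  qed
  have l0: "0 \<le> l" using le[OF z'(1)] psd_op_Re_nonneg[OF T(1), of z'] z'(2) by simp
  have nle: "norm (T x) \<le> l * norm x" if "x \<in> M" for x
    by (rule psd_op_norm_le[OF T(1) l0 le[OF that] le[OF M(3)[OF that]]])
  \<comment> \<open>If l = 0, then T vanishes on M and any unit vector of M serves. If l > 0,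
    division by l recovers the maximizing vectors from their images.\<close>
  show ?thesis
  proof (cases "l = 0")
    case True
    then show ?thesis using nle[OF z'(1)] z' le by (intro exI[of _ z'] exI[of _ 0]) auto
  next
    case False
    then have l: "0 < l" using l0 by simp
    have "\<exists>x. x \<in> M \<and> norm x = 1 \<and> l - 1 / real (Suc n) < Re (cinner x (T x))" for n
    proof -
      have "\<exists>t\<in>S. l - 1 / real (Suc n) < t"
        using less_cSup_iff[OF ne bdd, of "l - 1 / real (Suc n)"] by (simp add: l_def)
      then show ?thesis by (auto simp: S_def)
    qed
    then obtain x where x: "\<And>n. x n \<in> M" "\<And>n. norm (x n) = 1"
      "\<And>n. l - 1 / real (Suc n) < Re (cinner (x n) (T (x n)))" by metis
    obtain y r where r: "strict_mono r" "(\<lambda>n. T (x (r n))) \<longlonglongrightarrow> y"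
      by (rule compact_op_convergent_subseq[OF T(2), of x]) (use x in auto)
    define w where "w = (\<lambda>n. T (x (r n)) - l *\<^sub>R x (r n))"
    \<comment> \<open>After expansion, norm (T x) <= l and the near-maximality of <x, T x> cancel
      everything but the error term; the index r n is at least n.\<close>
    have wle: "(norm (w n))\<^sup>2 \<le> 2 * l * (1 / real (Suc n))" for n
    proof -
      let ?x = "x (r n)"
      have sym: "cinner (T ?x) ?x = cinner ?x (T ?x)" by (rule psd_op_symmetric[OF T(1)])
      have "complex_of_real ((norm (w n))\<^sup>2)
          = cinner (T ?x) (T ?x) - l *\<^sub>R cinner ?x (T ?x) - l *\<^sub>R cinner ?x (T ?x)
            + (l * l) *\<^sub>R cinner ?x ?x"
        unfolding w_def cinner_self[symmetric]
        by (simp add: cinner.diff_left cinner.diff_right cinner_scaleR_left cinner_scaleR_right sym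
            algebra_simps)
      then have "(norm (w n))\<^sup>2 = Re (\<dots>)" by (metis Re_complex_of_real)
      also have "\<dots> = (norm (T ?x))\<^sup>2 - 2 * l * Re (cinner ?x (T ?x)) + l * l"
        using x(2)[of "r n"] by (simp add: cinner_self)
      also have "\<dots> \<le> l * l - 2 * l * (l - 1 / real (Suc (r n))) + l * l"
      proof -
        have "(norm (T ?x))\<^sup>2 \<le> l\<^sup>2" using nle[OF x(1)[of "r n"]] x(2)[of "r n"]
          by (simp add: power_mono)
        moreover have "2 * l * (l - 1 / real (Suc (r n))) \<le> 2 * l * Re (cinner ?x (T ?x))"
          using x(3)[of "r n"] l by (intro mult_left_mono) auto
        ultimately show ?thesis by (simp add: power2_eq_square)
      qed
      also have "\<dots> = 2 * l * (1 / real (Suc (r n)))" by (simp add: algebra_simps)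
      also have "\<dots> \<le> 2 * l * (1 / real (Suc n))"
        using l seq_suble[OF r(1), of n] by (intro mult_left_mono divide_left_mono) auto
      finally show ?thesis .
    qed
    have "(\<lambda>n. (norm (w n))\<^sup>2) \<longlonglongrightarrow> 0"
    proof (rule tendsto_sandwich[OF _ _ tendsto_const])
      show "(\<lambda>n. 2 * l * (1 / real (Suc n))) \<longlonglongrightarrow> 0"
        using tendsto_mult_right_zero[OF LIMSEQ_inverse_real_of_nat, of "2 * l"]
        by (simp add: inverse_eq_divide)
    qed (use wle in auto)
    then have "w \<longlonglongrightarrow> 0"
      using tendsto_real_sqrt[of "\<lambda>n. (norm (w n))\<^sup>2" 0 sequentially] by (simp add: tendsto_norm_zero_iff)
    then have "(\<lambda>n. (1 / l) *\<^sub>R (T (x (r n)) - w n)) \<longlonglongrightarrow> (1 / l) *\<^sub>R (y - 0)"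
      by (intro tendsto_intros r)
    then have lim: "(\<lambda>n. x (r n)) \<longlonglongrightarrow> (1 / l) *\<^sub>R y" using l by (simp add: w_def)
    let ?u = "(1 / l) *\<^sub>R y"
    have "?u \<in> M" by (rule closed_sequentially[OF M(1) _ lim]) (use x in auto)
    moreover have "norm ?u = 1"
    proof -
      have "(\<lambda>n. norm (x (r n))) \<longlonglongrightarrow> 1" using x(2) by simp
      then show ?thesis by (rule LIMSEQ_unique[OF tendsto_norm[OF lim]])
    qed
    moreover have "T ?u = l *\<^sub>R ?u"
    proof -
      have "(\<lambda>n. T (x (r n))) \<longlonglongrightarrow> T ?u"
        by (rule bounded_linear.tendsto[OF bounded_clinear_bounded_linear[OF bc] lim])
      then have "T ?u = y" by (rule LIMSEQ_unique[OF _ r(2)])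
      then show ?thesis using l by simp
    qed
    ultimately show ?thesis using l0 le by blast
  qed
qed

text \<open>Eigenvectors by decreasing eigenvalue, described greedily: \<tau> n is the maximum of
  the Rayleigh quotient on the complement of the earlier vectors. The system need not be complete;
  kernel vectors are missed when infinitely many eigenvalues are positive.\<close>

definition eigen_system ::
    "('h::chilbert_space \<Rightarrow> 'h) \<Rightarrow> (nat \<Rightarrow> 'h) \<Rightarrow> (nat \<Rightarrow> real) \<Rightarrow> bool" where
  "eigen_system T e \<tau> \<longleftrightarrow> orthonormal_on UNIV e \<and>
     (\<forall>n. T (e n) = \<tau> n *\<^sub>R e n \<and> 0 \<le> \<tau> n \<and>
       (\<forall>x. (\<forall>j<n. cinner (e j) x = 0) \<longrightarrow> Re (cinner x (T x)) \<le> \<tau> n * (norm x)\<^sup>2))"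

lemma orthonormal_on_lessI:
  assumes "\<And>n. n < N \<Longrightarrow> norm (e n) = 1" "\<And>j n. j < n \<Longrightarrow> n < N \<Longrightarrow> cinner (e j) (e n) = 0"
  shows "orthonormal_on {..<N} e"
  using assms
proof (induction N)
  case 0
  then show ?case by (simp add: orthonormal_on_def)
next
  case (Suc N)
  then show ?case by (intro orthonormal_on_Suc) auto
qed

text \<open>Greedy recursion: the complement of finitely many eigenvectors is closed, nonzero by
  infinite dimension, and invariant by symmetry of T, so it contains a maximal eigenvector.
  \<open>Q\<close> relates each pair of vector and eigenvalue to the pairs chosen before.\<close>

lemma eigen_system_exists:
  fixes T :: "'h::chilbert_space \<Rightarrow> 'h" and h :: "nat \<Rightarrow> 'h"
  assumes T: "psd_op T" "compact_op T" and h: "orthonormal_on UNIV h"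
  shows "\<exists>e \<tau>. eigen_system T e \<tau>"
proof -
  define Q where "Q = (\<lambda>(f::nat \<Rightarrow> 'h \<times> real) n r.
    norm (fst r) = 1 \<and> (\<forall>j<n. cinner (fst (f j)) (fst r) = 0) \<and> T (fst r) = snd r *\<^sub>R fst r \<and>
    0 \<le> snd r \<and> (\<forall>x. (\<forall>j<n. cinner (fst (f j)) x = 0) \<longrightarrow> Re (cinner x (T x)) \<le> snd r * (norm x)\<^sup>2))"
  have "\<exists>f. \<forall>n. Q f n (f n)"
  proof (rule dependent_wellorder_choice)
    show "Q f n r = Q g n r" if "\<And>j. j < n \<Longrightarrow> f j = g j" for r f g n
      using that by (simp add: Q_def)
  next
    fix n f assume f: "\<And>j. j < n \<Longrightarrow> Q f j (f j)"
    define M where "M = {x. \<forall>j<n. cinner (fst (f j)) x = 0}"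
    have on: "orthonormal_on {..<n} (\<lambda>j. fst (f j))"
      by (rule orthonormal_on_lessI) (use f in \<open>auto simp: Q_def\<close>)
    obtain z where z: "norm z = 1" "\<And>i. i < n \<Longrightarrow> cinner (fst (f i)) z = 0"
      using orthogonal_unit_vector[OF on h] by blast
    have "\<exists>u l. u \<in> M \<and> norm u = 1 \<and> 0 \<le> l \<and> T u = l *\<^sub>R u \<and>
      (\<forall>x\<in>M. Re (cinner x (T x)) \<le> l * (norm x)\<^sup>2)"
    proof (rule compact_psd_max_eigenvector[OF T])
      have "M = (\<Inter>j\<in>{..<n}. {x. cinner (fst (f j)) x = 0})" by (auto simp: M_def)
      also have "closed \<dots>"
        by (intro closed_INT ballI closed_Collect_eq continuous_intros
            bounded_linear.continuous_on[OF cinner.bounded_linear_right])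
      finally show "closed M" .
      show "r *\<^sub>R x \<in> M" if "x \<in> M" for r x
        using that by (simp add: M_def cinner_scaleR_right)
      show "T x \<in> M" if "x \<in> M" for x
        unfolding M_def
      proof clarify
        fix j assume j: "j < n"
        have "cinner (fst (f j)) (T x) = cinner (T (fst (f j))) x"
          by (rule psd_op_symmetric[OF T(1), symmetric])
        also have "\<dots> = 0"
          using f[OF j] that j by (simp add: Q_def M_def cinner_scaleR_left)
        finally show "cinner (fst (f j)) (T x) = 0" .
      qed
      show "z \<in> M" "z \<noteq> 0" using z by (auto simp: M_def)
    qed
    then show "\<exists>r. Q f n r" by (auto simp: Q_def M_def)
  qed
  then obtain f where f: "\<And>n. Q f n (f n)" by blast
  have "orthonormal_on {..<N} (\<lambda>n. fst (f n))" for N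
    by (rule orthonormal_on_lessI) (use f in \<open>auto simp: Q_def\<close>)
  then have "orthonormal_on UNIV (\<lambda>n. fst (f n))"
    unfolding orthonormal_on_def by (metis UNIV_I lessI lessThan_iff max.strict_coboundedI1 max.strict_coboundedI2)
  then have "eigen_system T (\<lambda>n. fst (f n)) (\<lambda>n. snd (f n))"
    using f by (simp add: eigen_system_def Q_def)
  then show ?thesis by blast
qed

section \<open>Quadratic form and singular values in terms of an eigen system\<close>

context
  fixes T :: "'h::chilbert_space \<Rightarrow> 'h" and e :: "nat \<Rightarrow> 'h" and \<tau> :: "nat \<Rightarrow> real"
  assumes T: "psd_op T" and es: "eigen_system T e \<tau>"
begin

lemma eigen_system_orthonormal: "orthonormal_on I e"
  using es by (auto simp: eigen_system_def orthonormal_on_def)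

lemma eigen_system_eigen: "T (e n) = \<tau> n *\<^sub>R e n"
  and eigen_system_nonneg: "0 \<le> \<tau> n"
  and eigen_system_le: "(\<And>j. j < n \<Longrightarrow> cinner (e j) x = 0) \<Longrightarrow> Re (cinner x (T x)) \<le> \<tau> n * (norm x)\<^sup>2"
  using es by (auto simp: eigen_system_def)

lemma eigen_system_quadratic: "Re (cinner (e n) (T (e n))) = \<tau> n"
  using orthonormal_on_norm[OF eigen_system_orthonormal[of UNIV], of n]
  by (simp add: eigen_system_eigen cinner_scaleR_right cinner_self)

lemma eigen_system_antimono:
  assumes "m \<le> n" shows "\<tau> n \<le> \<tau> m"
proof -
  have "Re (cinner (e n) (T (e n))) \<le> \<tau> m * (norm (e n))\<^sup>2"
    by (rule eigen_system_le)
      (use assms eigen_system_orthonormal[of UNIV] in \<open>auto simp: orthonormal_on_def\<close>)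
  then show ?thesis
    using orthonormal_on_norm[OF eigen_system_orthonormal[of UNIV], of n]
    by (simp add: eigen_system_quadratic)
qed

lemma eigen_system_residual:
  fixes n x defines "y \<equiv> x - onproj {..<n} e x"
  shows "j < n \<Longrightarrow> cinner (e j) y = 0" and "j < n \<Longrightarrow> cinner (e j) (T y) = 0"
proof -
  assume j: "j < n"
  show 1: "cinner (e j) y = 0"
    unfolding y_def by (rule cinner_onproj_residual[OF eigen_system_orthonormal]) (use j in auto)
  show "cinner (e j) (T y) = 0"
    using 1 by (simp add: psd_op_symmetric[OF T, symmetric] eigen_system_eigen cinner_scaleR_left)
qed

lemma eigen_system_onproj:
  "T (onproj I e x) = (\<Sum>i\<in>I. (\<tau> i * cinner (e i) x) *\<^sub>C e i)"
proof -
  have bc: "bounded_clinear T" using T by (simp add: psd_op_def)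
  show ?thesis
    unfolding onproj_def linear_sum[OF bounded_clinear_linear[OF bc]]
    by (simp add: bounded_clinear_scaleC[OF bc] eigen_system_eigen scaleC_of_real[symmetric]
        scaleC_scaleC mult.commute)
qed

text \<open>The span of the first n eigenvectors and its complement are both invariant, so the cross
  terms vanish.\<close>

lemma eigen_system_quadratic_form:
  "Re (cinner x (T x)) = (\<Sum>i<n. \<tau> i * (cmod (cinner (e i) x))\<^sup>2)
    + Re (cinner (x - onproj {..<n} e x) (T (x - onproj {..<n} e x)))"
proof -
  define p y where "p = onproj {..<n} e x" and "y = x - onproj {..<n} e x"
  have bc: "bounded_clinear T" using T by (simp add: psd_op_def)
  have pTy: "cinner p (T y) = 0"
    unfolding p_def by (rule cinner_onproj_left) (use eigen_system_residual in \<open>auto simp: y_def\<close>)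
  have yTp: "cinner y (T p) = 0"
    using pTy psd_op_symmetric[OF T, of y p] cinner_commute[of "T y" p] by simp
  have x: "x = p + y" by (simp add: p_def y_def)
  have "cinner x (T x) = cinner p (T p) + cinner y (T y)"
    unfolding x by (simp add: bounded_clinear_add[OF bc] cinner_add_left cinner_add_right pTy yTp)
  also have "cinner p (T p) = cinner x (T p)"
    using yTp unfolding x by (simp add: cinner_add_left)
  also have "\<dots> = of_real (\<Sum>i<n. \<tau> i * (cmod (cinner (e i) x))\<^sup>2)"
    unfolding p_def eigen_system_onproj cinner.sum_right of_real_sum of_real_mult complex_norm_square
      cinner_scaleC_right mult.assoc
    by (rule sum.cong) (simp_all flip: cinner_commute)
  finally show ?thesis by (simp add: y_def)
qed

lemma eigen_system_quadratic_ge: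
  "(\<Sum>i<n. \<tau> i * (cmod (cinner (e i) x))\<^sup>2) \<le> Re (cinner x (T x))"
  using eigen_system_quadratic_form[of x n] psd_op_Re_nonneg[OF T, of "x - onproj {..<n} e x"]
  by simp

text \<open>The upper half of Ky Fan's principle. By Bessel each e n carries total weight at most 1
  over the system x. Splitting off \<tau> k makes the coefficients \<tau> n - \<tau> k nonnegative
  for n < k, so these weights may be replaced by 1.\<close>

lemma eigen_system_sum_le:
  assumes x: "orthonormal_on I x" "finite I"
  shows "(\<Sum>i\<in>I. Re (cinner (x i) (T (x i)))) \<le> (\<Sum>n<card I. \<tau> n)"
proof -
  define k where "k = card I"
  define a where "a = (\<lambda>n. \<Sum>i\<in>I. (cmod (cinner (e n) (x i)))\<^sup>2)"
  have a1: "a n \<le> 1" for n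
    using bessel[OF x, of "e n"] orthonormal_on_norm[OF eigen_system_orthonormal[of UNIV], of n]
    by (simp add: a_def cmod_cinner_commute)
  have "Re (cinner (x i) (T (x i))) \<le> (\<Sum>n<k. (\<tau> n - \<tau> k) * (cmod (cinner (e n) (x i)))\<^sup>2) + \<tau> k"
    if i: "i \<in> I" for i
  proof -
    let ?y = "x i - onproj {..<k} e (x i)"
    have "Re (cinner ?y (T ?y)) \<le> \<tau> k * (norm ?y)\<^sup>2"
      by (rule eigen_system_le) (rule eigen_system_residual)
    also have "(norm ?y)\<^sup>2 = 1 - (\<Sum>n<k. (cmod (cinner (e n) (x i)))\<^sup>2)"
      using norm_onproj_residual[OF eigen_system_orthonormal, of "{..<k}" "x i"]
        orthonormal_on_norm[OF x(1) i] by simp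
    finally show ?thesis
      unfolding eigen_system_quadratic_form[of "x i" k]
      by (simp add: left_diff_distrib sum_subtractf right_diff_distrib sum_distrib_left)
  qed
  then have "(\<Sum>i\<in>I. Re (cinner (x i) (T (x i))))
      \<le> (\<Sum>i\<in>I. (\<Sum>n<k. (\<tau> n - \<tau> k) * (cmod (cinner (e n) (x i)))\<^sup>2) + \<tau> k)"
    by (rule sum_mono)
  also have "\<dots> = (\<Sum>n<k. (\<tau> n - \<tau> k) * a n) + k * \<tau> k"
    unfolding a_def sum_distrib_left sum.distrib by (subst sum.swap) (simp add: k_def)
  also have "\<dots> \<le> (\<Sum>n<k. (\<tau> n - \<tau> k) * 1) + k * \<tau> k"
    by (intro add_right_mono sum_mono mult_left_mono a1)
      (simp add: eigen_system_antimono)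
  also have "\<dots> = (\<Sum>n<k. \<tau> n)" by (simp add: sum_subtractf)
  finally show ?thesis by (simp add: k_def)
qed

text \<open>The first n + 1 eigenvectors show that the supremum is at least \<tau> n. A larger t
  would come with n + 1 orthonormal eigenvectors of T T; one of them leaves the span of the first n
  vectors e j, and its residual contradicts the maximality of \<tau> n.\<close>

lemma eigen_system_singular_value: "singular_value T (Suc n) = \<tau> n"
proof -
  have bc: "bounded_clinear T" using T by (simp add: psd_op_def)
  have adj: "cadjoint T = T" by (rule cadjoint_symmetric[OF bc psd_op_symmetric[OF T]])
  let ?P = "\<lambda>t x s. orthonormal_on {1..Suc n} x \<and>
       (\<forall>i\<in>{1..Suc n}. t \<le> s i \<and> T (T (x i)) = (s i)\<^sup>2 *\<^sub>R x i)"
  have "\<exists>x s. ?P (\<tau> n) x s"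
  proof (intro exI)
    show "?P (\<tau> n) (\<lambda>i. e (i - 1)) (\<lambda>i. \<tau> (i - 1))"
    using eigen_system_orthonormal[of UNIV] linear_scale[OF bounded_clinear_linear[OF bc]]
    by (auto simp: orthonormal_on_def eigen_system_eigen power2_eq_square intro!: eigen_system_antimono)
  qed
  then have mem: "\<tau> n \<in> insert 0 {t. 0 \<le> t \<and> (\<exists>x s. ?P t x s)}"
    using eigen_system_nonneg[of n] by simp
  have "t \<le> \<tau> n" if "0 \<le> t" "?P t x s" for t x s
  proof (rule ccontr)
    assume t: "\<not> t \<le> \<tau> n"
    have x: "orthonormal_on {1..Suc n} x" using that by blast
    have "\<exists>i\<in>{1..Suc n}. onproj {..<n} e (x i) \<noteq> x i"
      by (rule orthonormal_exceeds_span[OF eigen_system_orthonormal _ x]) auto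
    then obtain i where i: "i \<in> {1..Suc n}" "onproj {..<n} e (x i) \<noteq> x i" by blast
    define p y where "p = onproj {..<n} e (x i)" and "y = x i - onproj {..<n} e (x i)"
    have y: "y \<noteq> 0" using i by (simp add: y_def)
    have Ty: "norm (T y) \<le> \<tau> n * norm y"
      by (rule psd_op_norm_le[OF T eigen_system_nonneg])
        (rule eigen_system_le, simp add: y_def eigen_system_residual)+
    have pTy: "cinner (T p) (T y) = 0"
    proof -
      have "cinner p (T (T y)) = 0"
        unfolding p_def
      proof (rule cinner_onproj_left)
        fix j assume "j \<in> {..<n}"
        then show "cinner (e j) (T (T y)) = 0"
          using eigen_system_residual(2)[of j n "x i", folded y_def]
            psd_op_symmetric[OF T, of "e j" "T y", symmetric]
          by (simp add: eigen_system_eigen cinner_scaleR_left)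
      qed
      then show ?thesis using psd_op_symmetric[OF T, of p "T y"] by simp
    qed
    have py: "cinner p y = 0"
      unfolding p_def by (rule cinner_onproj_left)
        (use eigen_system_residual in \<open>auto simp: y_def\<close>)
    have xi: "x i = p + y" by (simp add: p_def y_def)
    \<comment> \<open>The residual y inherits the eigenvalue relation of x i in the form norm (T y)
      = s i * norm y, because the part p is orthogonal to y and T p is orthogonal to T y.\<close>
    have "cinner (T y) (T y) = cinner (T (x i)) (T y)"
      unfolding xi by (simp add: bounded_clinear_add[OF bc] cinner_add_left pTy)
    also have "\<dots> = cinner (T (T (x i))) y"
      by (simp add: psd_op_symmetric[OF T, of "T (x i)" y])
    also have "\<dots> = (s i)\<^sup>2 *\<^sub>R cinner (x i) y" using that i by (simp add: cinner_scaleR_left)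
    also have "\<dots> = (s i)\<^sup>2 *\<^sub>R cinner y y" using py unfolding xi by (simp add: cinner_add_left)
    finally have "(norm (T y))\<^sup>2 = (s i)\<^sup>2 * (norm y)\<^sup>2"
      unfolding cinner_self scaleR_conv_of_real of_real_mult[symmetric] of_real_eq_iff .
    also have "\<dots> > (\<tau> n)\<^sup>2 * (norm y)\<^sup>2"
      using that i t y eigen_system_nonneg[of n]
      by (intro mult_strict_right_mono power_strict_mono) force+
    finally show False
      using power_mono[OF Ty norm_ge_zero, of 2] by (simp add: power_mult_distrib)
  qed
  then show ?thesis
    unfolding singular_value_def adj
    using mem eigen_system_nonneg[of n] by (intro cSup_eq_maximum) auto
qed

lemma eigen_system_sum_singular_values: "(\<Sum>n=1..k. singular_value T n) = (\<Sum>n<k. \<tau> n)"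
proof -
  have "(\<Sum>n=1..k. singular_value T n) = (\<Sum>n<k. singular_value T (Suc n))"
    by (rule sum.reindex_bij_witness[of _ Suc "\<lambda>n. n - 1"]) auto
  then show ?thesis by (simp add: eigen_system_singular_value)
qed

end

section \<open>Ky Fan inequalities\<close>

definition ky_fan :: "('h::chilbert_space \<Rightarrow> 'h) \<Rightarrow> nat \<Rightarrow> real" where
  "ky_fan T k = (\<Sum>n=1..k. singular_value T n)"

lemma log_average_ky_fan: "log_average T k = ky_fan T k / ln (1 + real k)"
  by (simp add: log_average_def ky_fan_def)

text \<open>The sequence is a witness of infinite dimension; completeness is added only in
  \<open>hilbert_basis\<close>.\<close>

locale infinite_orthonormal =
  fixes h :: "nat \<Rightarrow> 'h::chilbert_space"
  assumes orthonormal: "orthonormal_on UNIV h"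
begin

lemma ky_fan_ge:
  fixes T :: "'h \<Rightarrow> 'h"
  assumes T: "psd_op T" "compact_op T" and x: "orthonormal_on I x" "finite I" "card I = k"
  shows "(\<Sum>i\<in>I. Re (cinner (x i) (T (x i)))) \<le> ky_fan T k"
proof -
  obtain e \<tau> where es: "eigen_system T e \<tau>" using eigen_system_exists[OF T orthonormal] by blast
  show ?thesis
    using eigen_system_sum_le[OF T(1) es x(1,2)] x(3)
    by (simp only: ky_fan_def eigen_system_sum_singular_values[OF T(1) es])
qed

text \<open>The last clause says that T dominates its truncation to the top k eigenvectors; it feeds
  the lower bound for sums of operators.\<close>

lemma ky_fan_attained:
  fixes T :: "'h \<Rightarrow> 'h"
  assumes T: "psd_op T" "compact_op T"
  obtains e where "orthonormal_on {..<k} e" "(\<Sum>i<k. Re (cinner (e i) (T (e i)))) = ky_fan T k"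
    "\<And>i. i < k \<Longrightarrow> T (e i) = singular_value T (Suc i) *\<^sub>R e i"
    "\<And>x. (\<Sum>i<k. singular_value T (Suc i) * (cmod (cinner (e i) x))\<^sup>2) \<le> Re (cinner x (T x))"
proof -
  obtain e \<tau> where es: "eigen_system T e \<tau>" using eigen_system_exists[OF T orthonormal] by blast
  note sv = eigen_system_singular_value[OF T(1) es]
  show thesis
  proof (rule that[of e])
    show "orthonormal_on {..<k} e" by (rule eigen_system_orthonormal[OF T(1) es])
    show "(\<Sum>i<k. Re (cinner (e i) (T (e i)))) = ky_fan T k"
      by (simp only: eigen_system_quadratic[OF T(1) es] ky_fan_def
          eigen_system_sum_singular_values[OF T(1) es])
  qed (use eigen_system_eigen[OF T(1) es] eigen_system_quadratic_ge[OF T(1) es] in \<open>auto simp: sv\<close>)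
qed

lemma singular_value_nonneg:
  fixes T :: "'h \<Rightarrow> 'h"
  assumes T: "psd_op T" "compact_op T"
  shows "0 \<le> singular_value T (Suc n)"
proof -
  obtain e \<tau> where es: "eigen_system T e \<tau>" using eigen_system_exists[OF T orthonormal] by blast
  then show ?thesis
    using eigen_system_singular_value[OF T(1) es] eigen_system_nonneg[OF T(1) es] by simp
qed

lemma singular_value_le_first:
  fixes T :: "'h \<Rightarrow> 'h"
  assumes T: "psd_op T" "compact_op T"
  shows "singular_value T (Suc n) \<le> ky_fan T 1"
proof -
  obtain e \<tau> where es: "eigen_system T e \<tau>" using eigen_system_exists[OF T orthonormal] by blast
  then show ?thesis
    using eigen_system_singular_value[OF T(1) es] eigen_system_antimono[OF T(1) es, of 0 n]
    by (simp add: ky_fan_def)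
qed

lemma ky_fan_nonneg:
  fixes T :: "'h \<Rightarrow> 'h"
  assumes T: "psd_op T" "compact_op T"
  shows "0 \<le> ky_fan T k"
  unfolding ky_fan_def
  by (rule sum_nonneg) (metis One_nat_def T atLeastAtMost_iff not0_implies_Suc not_one_le_zero singular_value_nonneg)

lemma ky_fan_Suc: "ky_fan T (Suc k) = ky_fan T k + singular_value T (Suc k)"
  by (simp add: ky_fan_def)

lemma ky_fan_mono:
  fixes T :: "'h \<Rightarrow> 'h"
  assumes T: "psd_op T" "compact_op T" and "k \<le> l"
  shows "ky_fan T k \<le> ky_fan T l"
  using assms(3) by (induction rule: dec_induct)
    (auto simp: ky_fan_Suc singular_value_nonneg[OF T] add_increasing2)

lemma ky_fan_leI:
  fixes S T :: "'h \<Rightarrow> 'h"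
  assumes S: "psd_op S" "compact_op S"
    and le: "\<And>x. orthonormal_on {..<k} x \<Longrightarrow> (\<Sum>i<k. Re (cinner (x i) (S (x i)))) \<le> b"
  shows "ky_fan S k \<le> b"
  using ky_fan_attained[OF S, of k] le by metis

lemma ky_fan_plus_le:
  fixes S T :: "'h \<Rightarrow> 'h"
  assumes S: "psd_op S" "compact_op S" and T: "psd_op T" "compact_op T"
  shows "ky_fan (\<lambda>x. S x + T x) k \<le> ky_fan S k + ky_fan T k"
proof (rule ky_fan_leI)
  show "psd_op (\<lambda>x. S x + T x)" "compact_op (\<lambda>x. S x + T x)"
    using S T by (auto intro: psd_op_plus compact_op_plus)
  fix x :: "nat \<Rightarrow> 'h" assume x: "orthonormal_on {..<k} x"
  show "(\<Sum>i<k. Re (cinner (x i) (S (x i) + T (x i)))) \<le> ky_fan S k + ky_fan T k"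
    using ky_fan_ge[OF S x] ky_fan_ge[OF T x] by (simp add: cinner_add_right sum.distrib)
qed

lemma ky_fan_mono_op:
  fixes S T :: "'h \<Rightarrow> 'h"
  assumes S: "psd_op S" "compact_op S" and T: "psd_op T" "compact_op T"
    and le: "\<And>x. Re (cinner x (S x)) \<le> Re (cinner x (T x))"
  shows "ky_fan S k \<le> ky_fan T k"
proof (rule ky_fan_leI[OF S])
  fix x :: "nat \<Rightarrow> 'h" assume x: "orthonormal_on {..<k} x"
  have "(\<Sum>i<k. Re (cinner (x i) (S (x i)))) \<le> (\<Sum>i<k. Re (cinner (x i) (T (x i))))"
    by (intro sum_mono le)
  then show "(\<Sum>i<k. Re (cinner (x i) (S (x i)))) \<le> ky_fan T k" using ky_fan_ge[OF T x] by simp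
qed

text \<open>T dominates its truncation to the top k eigenvectors e i, and the truncation has trace
  \<open>ky_fan T k\<close> over any orthonormal system whose span contains them. Quantifying over g
  lets two operators share one system.\<close>

lemma ky_fan_le_trace_on_span:
  fixes T :: "'h \<Rightarrow> 'h"
  assumes T: "psd_op T" "compact_op T"
  obtains e where "\<And>g m. orthonormal_on {..<m} g \<Longrightarrow> (\<And>i. i < k \<Longrightarrow> onproj {..<m} g (e i) = e i)
    \<Longrightarrow> ky_fan T k \<le> (\<Sum>j<m. Re (cinner (g j) (T (g j))))"
proof -
  obtain e where e: "orthonormal_on {..<k} e"
    "\<And>x. (\<Sum>i<k. singular_value T (Suc i) * (cmod (cinner (e i) x))\<^sup>2) \<le> Re (cinner x (T x))"
    using ky_fan_attained[OF T, of k] by metis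
  show thesis
  proof (rule that[of e])
    fix g :: "nat \<Rightarrow> 'h" and m
    assume g: "orthonormal_on {..<m} g" and ge: "\<And>i. i < k \<Longrightarrow> onproj {..<m} g (e i) = e i"
    have "ky_fan T k = (\<Sum>i<k. singular_value T (Suc i))"
      unfolding ky_fan_def by (rule sum.reindex_bij_witness[of _ Suc "\<lambda>n. n - 1"]) auto
    also have "\<dots> = (\<Sum>i<k. singular_value T (Suc i) * (\<Sum>j<m. (cmod (cinner (e i) (g j)))\<^sup>2))"
    proof (rule sum.cong)
      fix i assume i: "i \<in> {..<k}"
      then have "(\<Sum>j<m. (cmod (cinner (g j) (e i)))\<^sup>2) = 1"
        using onproj_eq_iff[OF g, of "e i"] ge[of i] orthonormal_on_norm[OF e(1) i] by simp
      then show "singular_value T (Suc i) = singular_value T (Suc i) * (\<Sum>j<m. (cmod (cinner (e i) (g j)))\<^sup>2)"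
        by (simp add: cmod_cinner_commute)
    qed simp
    also have "\<dots> = (\<Sum>j<m. \<Sum>i<k. singular_value T (Suc i) * (cmod (cinner (e i) (g j)))\<^sup>2)"
      unfolding sum_distrib_left by (rule sum.swap)
    also have "\<dots> \<le> (\<Sum>j<m. Re (cinner (g j) (T (g j))))" by (intro sum_mono e(2))
    finally show "ky_fan T k \<le> (\<Sum>j<m. Re (cinner (g j) (T (g j))))" .
  qed
qed

text \<open>The top k eigenvectors of S and those of T fit into the span of one orthonormal system
  of 2k vectors, on which the traces add up.\<close>

lemma ky_fan_plus_ge:
  fixes S T :: "'h \<Rightarrow> 'h"
  assumes S: "psd_op S" "compact_op S" and T: "psd_op T" "compact_op T"
  shows "ky_fan S k + ky_fan T k \<le> ky_fan (\<lambda>x. S x + T x) (2 * k)"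
proof -
  obtain e where e: "\<And>g m. orthonormal_on {..<m} g \<Longrightarrow> (\<And>i. i < k \<Longrightarrow> onproj {..<m} g (e i) = e i)
    \<Longrightarrow> ky_fan S k \<le> (\<Sum>j<m. Re (cinner (g j) (S (g j))))"
    using ky_fan_le_trace_on_span[OF S] by blast
  obtain f where f: "\<And>g m. orthonormal_on {..<m} g \<Longrightarrow> (\<And>i. i < k \<Longrightarrow> onproj {..<m} g (f i) = f i)
    \<Longrightarrow> ky_fan T k \<le> (\<Sum>j<m. Re (cinner (g j) (T (g j))))"
    using ky_fan_le_trace_on_span[OF T] by blast
  obtain g where g: "orthonormal_on {..<2 * k} g"
    "\<And>i. i < 2 * k \<Longrightarrow> onproj {..<2 * k} g (if i < k then e i else f (i - k)) = (if i < k then e i else f (i - k))"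
    using gram_schmidt[OF orthonormal, of "2 * k" "\<lambda>i. if i < k then e i else f (i - k)"] by blast
  have "onproj {..<2 * k} g (e i) = e i" "onproj {..<2 * k} g (f i) = f i" if "i < k" for i
    using that g(2)[of i] g(2)[of "i + k"] by auto
  then have "ky_fan S k + ky_fan T k
      \<le> (\<Sum>j<2 * k. Re (cinner (g j) (S (g j)))) + (\<Sum>j<2 * k. Re (cinner (g j) (T (g j))))"
    using e[OF g(1)] f[OF g(1)] by (intro add_mono) auto
  also have "\<dots> = (\<Sum>j<2 * k. Re (cinner (g j) (S (g j) + T (g j))))"
    by (simp add: cinner_add_right sum.distrib)
  also have "\<dots> \<le> ky_fan (\<lambda>x. S x + T x) (2 * k)"
    using S T by (intro ky_fan_ge[OF psd_op_plus compact_op_plus g(1)]) auto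
  finally show ?thesis .
qed

lemma ky_fan_scaleR:
  fixes T :: "'h \<Rightarrow> 'h"
  assumes T: "psd_op T" "compact_op T" and r: "0 \<le> r"
  shows "ky_fan (\<lambda>x. r *\<^sub>R T x) k = r * ky_fan T k"
proof (rule antisym)
  note rT = psd_op_scaleR[OF r T(1)] compact_op_scaleR[OF T(2), of r]
  show "ky_fan (\<lambda>x. r *\<^sub>R T x) k \<le> r * ky_fan T k"
  proof (rule ky_fan_leI[OF rT])
    fix x :: "nat \<Rightarrow> 'h" assume x: "orthonormal_on {..<k} x"
    show "(\<Sum>i<k. Re (cinner (x i) (r *\<^sub>R T (x i)))) \<le> r * ky_fan T k"
      using mult_left_mono[OF ky_fan_ge[OF T x] r]
      by (simp add: cinner_scaleR_right sum_distrib_left)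
  qed
  obtain e where e: "orthonormal_on {..<k} e" "(\<Sum>i<k. Re (cinner (e i) (T (e i)))) = ky_fan T k"
    using ky_fan_attained[OF T, of k] by metis
  show "r * ky_fan T k \<le> ky_fan (\<lambda>x. r *\<^sub>R T x) k"
    using ky_fan_ge[OF rT e(1)] by (simp add: cinner_scaleR_right e(2)[symmetric] sum_distrib_left)
qed

text \<open>W is a selfadjoint unitary, so it maps orthonormal systems, over which Ky Fan's maximum
  runs, to orthonormal systems.\<close>

lemma ky_fan_symmetry_conj_le:
  fixes T W :: "'h \<Rightarrow> 'h"
  assumes T: "psd_op T" "compact_op T"
    and W: "bounded_clinear W" "\<And>x y. cinner (W x) y = cinner x (W y)" "\<And>x. W (W x) = x"
  shows "ky_fan (W \<circ> T \<circ> W) k \<le> ky_fan T k"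
proof (rule ky_fan_leI)
  show "psd_op (W \<circ> T \<circ> W)" by (rule psd_op_conj[OF T(1) W(1,2)])
  show "compact_op (W \<circ> T \<circ> W)"
    by (intro compact_op_compose_left compact_op_compose_right W T)
  fix x :: "nat \<Rightarrow> 'h" assume x: "orthonormal_on {..<k} x"
  have "orthonormal_on {..<k} (\<lambda>i. W (x i))"
    using x by (simp add: orthonormal_on_def W)
  from ky_fan_ge[OF T this]
  show "(\<Sum>i<k. Re (cinner (x i) ((W \<circ> T \<circ> W) (x i)))) \<le> ky_fan T k"
    by (simp add: W(2)[symmetric])
qed

lemma ky_fan_symmetry_conj:
  fixes T W :: "'h \<Rightarrow> 'h"
  assumes T: "psd_op T" "compact_op T"
    and W: "bounded_clinear W" "\<And>x y. cinner (W x) y = cinner x (W y)" "\<And>x. W (W x) = x"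
  shows "ky_fan (W \<circ> T \<circ> W) k = ky_fan T k"
proof (rule antisym[OF ky_fan_symmetry_conj_le[OF assms]])
  have "W \<circ> (W \<circ> T \<circ> W) \<circ> W = T" using W(3) by (simp add: fun_eq_iff)
  moreover have "psd_op (W \<circ> T \<circ> W)" by (rule psd_op_conj[OF T(1) W(1,2)])
  moreover have "compact_op (W \<circ> T \<circ> W)"
    by (intro compact_op_compose_left compact_op_compose_right W T)
  ultimately show "ky_fan T k \<le> ky_fan (W \<circ> T \<circ> W) k"
    using ky_fan_symmetry_conj_le[of "W \<circ> T \<circ> W" W k] W by metis
qed

end

section \<open>Dixmier traces on the positive cone\<close>

lemma bounded_seq_bcontfun: "bounded (range (f :: nat \<Rightarrow> real)) \<Longrightarrow> f \<in> bcontfun"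
  by (simp add: bcontfun_def)

lemma apply_dilation2: "apply_bcontfun (dilation2 a) i = apply_bcontfun a (i div 2)"
proof -
  have "bounded (range (\<lambda>i. apply_bcontfun a (i div 2)))"
    by (rule bounded_subset[OF bounded_apply_bcontfun[of a]]) auto
  then show ?thesis
    unfolding dilation2_def by (simp add: Bcontfun_inverse bounded_seq_bcontfun)
qed

lemma DL2_mono:
  assumes "\<omega> \<in> DL2 TYPE('h::chilbert_space)" "\<And>i. apply_bcontfun a i \<le> apply_bcontfun b i"
  shows "blinfun_apply \<omega> a \<le> blinfun_apply \<omega> b"
proof -
  have "\<forall>i. 0 \<le> apply_bcontfun (b - a) i" using assms(2) by simp
  then have "0 \<le> blinfun_apply \<omega> (b - a)" using assms(1) unfolding DL2_def by blast
  then show ?thesis by (simp add: blinfun.diff_right)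
qed

lemma DL2_le_limsup:
  assumes "\<omega> \<in> DL2 TYPE('h::chilbert_space)" "\<And>i. 0 \<le> apply_bcontfun a i"
  shows "ereal (blinfun_apply \<omega> a) \<le> limsup (\<lambda>k. ereal (apply_bcontfun a k))"
  using assms unfolding DL2_def by blast

lemma DL2_null:
  assumes "\<omega> \<in> DL2 TYPE('h::chilbert_space)" "\<And>i. 0 \<le> apply_bcontfun a i"
    and "apply_bcontfun a \<longlonglongrightarrow> 0"
  shows "blinfun_apply \<omega> a \<le> 0"
proof -
  have "(\<lambda>k. ereal (apply_bcontfun a k)) \<longlonglongrightarrow> ereal 0" using assms(3) by simp
  then have "limsup (\<lambda>k. ereal (apply_bcontfun a k)) = ereal 0"
    by (intro lim_imp_Limsup) auto
  then show ?thesis using DL2_le_limsup[OF assms(1,2)] by simp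
qed

definition positive_L1_inf :: "('h::chilbert_space \<Rightarrow> 'h) set" where
  "positive_L1_inf = {T. psd_op T \<and> T \<in> L1_inf}"

text \<open>The trace on the positive cone, studied before a linear extension is known to
  exist.\<close>

definition dixmier_value :: "((nat \<Rightarrow>\<^sub>C real) \<Rightarrow>\<^sub>L real) \<Rightarrow> ('h::chilbert_space \<Rightarrow> 'h) \<Rightarrow> real" where
  "dixmier_value \<omega> T = blinfun_apply \<omega> (gamma_seq T)"

context infinite_orthonormal
begin

lemma log_average_nonneg:
  fixes T :: "'h \<Rightarrow> 'h"
  assumes "psd_op T" "compact_op T"
  shows "0 \<le> log_average T k"
  using ky_fan_nonneg[OF assms, of k] by (simp add: log_average_ky_fan)

lemma L1_inf_iff:
  fixes T :: "'h \<Rightarrow> 'h"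
  assumes T: "psd_op T"
  shows "T \<in> L1_inf \<longleftrightarrow> compact_op T \<and> (\<exists>C. \<forall>k. log_average T k \<le> C)"
proof
  assume L: "T \<in> L1_inf"
  then have c: "compact_op T" and n: "norm_1_inf T < \<infinity>" by (auto simp: L1_inf_def)
  have ge: "ereal (log_average T k) \<le> norm_1_inf T" if "1 \<le> k" for k
    unfolding norm_1_inf_def by (rule SUP_upper) (use that in simp)
  obtain C where C: "norm_1_inf T = ereal C"
    using n ge[of 1] by (cases "norm_1_inf T") auto
  \<comment> \<open>The index 0 lies outside the supremum; there the average is 0 / 0 = 0, whence
    the maximum.\<close>
  have "log_average T k \<le> max 0 C" for k
  proof (cases "1 \<le> k")
    case True
    then show ?thesis using ge[of k] C by simp
  next
    case False
    then show ?thesis by (simp add: log_average_def)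
  qed
  then show "compact_op T \<and> (\<exists>C. \<forall>k. log_average T k \<le> C)" using c by blast
next
  assume "compact_op T \<and> (\<exists>C. \<forall>k. log_average T k \<le> C)"
  then obtain C where C: "compact_op T" "\<And>k. log_average T k \<le> C" by blast
  have "norm_1_inf T \<le> ereal C" unfolding norm_1_inf_def by (rule SUP_least) (simp add: C)
  then show "T \<in> L1_inf" using C(1) by (auto simp: L1_inf_def)
qed

lemma positive_L1_infD:
  fixes T :: "'h \<Rightarrow> 'h"
  assumes "T \<in> positive_L1_inf"
  shows "psd_op T" "compact_op T" "\<exists>C. \<forall>k. log_average T k \<le> C"
  using assms L1_inf_iff by (auto simp: positive_L1_inf_def)

lemma positive_L1_infI:
  fixes T :: "'h \<Rightarrow> 'h"
  assumes "psd_op T" "compact_op T" "\<And>k. log_average T k \<le> C"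
  shows "T \<in> positive_L1_inf"
  using assms L1_inf_iff by (auto simp: positive_L1_inf_def)

lemma apply_gamma_seq:
  fixes T :: "'h \<Rightarrow> 'h"
  assumes "T \<in> positive_L1_inf"
  shows "apply_bcontfun (gamma_seq T) i = log_average T (Suc i)"
proof -
  obtain C where C: "\<And>k. log_average T k \<le> C" using positive_L1_infD[OF assms] by blast
  have "bounded (range (\<lambda>i. log_average T (Suc i)))"
    using C log_average_nonneg[OF positive_L1_infD(1,2)[OF assms]]
    by (intro boundedI[of _ C]) auto
  then show ?thesis
    unfolding gamma_seq_def by (simp add: Bcontfun_inverse bounded_seq_bcontfun)
qed

lemma zero_positive_L1_inf: "(\<lambda>_. 0 :: 'h) \<in> positive_L1_inf"
  and log_average_zero: "log_average (\<lambda>_. 0 :: 'h) k = 0"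
proof -
  have "ky_fan (\<lambda>_. 0 :: 'h) k = 0" for k
    using ky_fan_scaleR[OF psd_op_zero compact_op_zero, of 0 k] by simp
  then show *: "log_average (\<lambda>_. 0 :: 'h) k = 0" for k by (simp add: log_average_ky_fan)
  show "(\<lambda>_. 0 :: 'h) \<in> positive_L1_inf"
    by (rule positive_L1_infI[of _ 0]) (simp_all add: psd_op_zero compact_op_zero *)
qed

lemma log_average_plus_le:
  fixes S T :: "'h \<Rightarrow> 'h"
  assumes "S \<in> positive_L1_inf" "T \<in> positive_L1_inf"
  shows "log_average (\<lambda>x. S x + T x) k \<le> log_average S k + log_average T k"
  using divide_right_mono[OF ky_fan_plus_le[OF positive_L1_infD(1,2)[OF assms(1)]
        positive_L1_infD(1,2)[OF assms(2)], of k], of "ln (1 + real k)"]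
  by (simp add: log_average_ky_fan add_divide_distrib)

lemma plus_positive_L1_inf:
  fixes S T :: "'h \<Rightarrow> 'h"
  assumes S: "S \<in> positive_L1_inf" and T: "T \<in> positive_L1_inf"
  shows "(\<lambda>x. S x + T x) \<in> positive_L1_inf"
proof -
  obtain C where C: "\<And>k. log_average S k \<le> C" using positive_L1_infD[OF S] by blast
  obtain D where D: "\<And>k. log_average T k \<le> D" using positive_L1_infD[OF T] by blast
  show ?thesis
  proof (rule positive_L1_infI)
    show "log_average (\<lambda>x. S x + T x) k \<le> C + D" for k
      using log_average_plus_le[OF S T, of k] C[of k] D[of k] by linarith
  qed (use positive_L1_infD[OF S] positive_L1_infD[OF T] in \<open>auto intro: psd_op_plus compact_op_plus\<close>)
qed

lemma log_average_scaleR: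
  fixes T :: "'h \<Rightarrow> 'h"
  assumes "T \<in> positive_L1_inf" "0 \<le> r"
  shows "log_average (\<lambda>x. r *\<^sub>R T x) k = r * log_average T k"
  using ky_fan_scaleR[OF positive_L1_infD(1,2)[OF assms(1)] assms(2)] by (simp add: log_average_ky_fan)

lemma scaleR_positive_L1_inf:
  fixes T :: "'h \<Rightarrow> 'h"
  assumes T: "T \<in> positive_L1_inf" and r: "0 \<le> r"
  shows "(\<lambda>x. r *\<^sub>R T x) \<in> positive_L1_inf"
proof -
  obtain C where C: "\<And>k. log_average T k \<le> C" using positive_L1_infD[OF T] by blast
  show ?thesis
  proof (rule positive_L1_infI)
    show "log_average (\<lambda>x. r *\<^sub>R T x) k \<le> r * C" for k
      unfolding log_average_scaleR[OF T r] by (rule mult_left_mono[OF C r])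
  qed (use positive_L1_infD[OF T] r in \<open>auto intro: psd_op_scaleR compact_op_scaleR\<close>)
qed

context
  fixes \<omega> :: "(nat \<Rightarrow>\<^sub>C real) \<Rightarrow>\<^sub>L real"
  assumes \<omega>: "\<omega> \<in> DL2 TYPE('h)"
begin

lemma dixmier_value_mono:
  fixes S T :: "'h \<Rightarrow> 'h"
  assumes "S \<in> positive_L1_inf" "T \<in> positive_L1_inf" "\<And>k. log_average S k \<le> log_average T k"
  shows "dixmier_value \<omega> S \<le> dixmier_value \<omega> T"
  unfolding dixmier_value_def by (rule DL2_mono[OF \<omega>]) (simp add: apply_gamma_seq assms)

lemma dixmier_value_zero: "dixmier_value \<omega> (\<lambda>_. 0 :: 'h) = 0"
proof -
  have "gamma_seq (\<lambda>_. 0 :: 'h) = 0"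
    by (rule bcontfun_eqI) (simp add: apply_gamma_seq[OF zero_positive_L1_inf] log_average_zero)
  then show ?thesis by (simp add: dixmier_value_def blinfun.zero_right)
qed

lemma dixmier_value_nonneg:
  fixes T :: "'h \<Rightarrow> 'h"
  assumes "T \<in> positive_L1_inf"
  shows "0 \<le> dixmier_value \<omega> T"
  using dixmier_value_mono[OF zero_positive_L1_inf assms] log_average_zero
    log_average_nonneg[OF positive_L1_infD(1,2)[OF assms]] dixmier_value_zero by simp

lemma dixmier_value_le_seminorm_0:
  fixes T :: "'h \<Rightarrow> 'h"
  assumes "T \<in> positive_L1_inf"
  shows "ereal (dixmier_value \<omega> T) \<le> seminorm_0 T"
proof -
  have "ereal (dixmier_value \<omega> T) \<le> limsup (\<lambda>k. ereal (log_average T (Suc k)))"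
    unfolding dixmier_value_def
    using DL2_le_limsup[OF \<omega>, of "gamma_seq T"]
      log_average_nonneg[OF positive_L1_infD(1,2)[OF assms]]
    by (simp add: apply_gamma_seq[OF assms])
  \<comment> \<open>Storing the k-th average at position k - 1 does not change the limsup.\<close>
  also have "\<dots> = seminorm_0 T"
    unfolding seminorm_0_def using limsup_shift[of "\<lambda>k. ereal (log_average T k)"] by simp
  finally show ?thesis .
qed

lemma dixmier_value_dilation2:
  fixes T :: "'h \<Rightarrow> 'h"
  assumes "T \<in> positive_L1_inf"
  shows "blinfun_apply \<omega> (dilation2 (gamma_seq T)) = dixmier_value \<omega> T"
proof (cases "T = (\<lambda>_. 0)")
  case True
  have "dilation2 (gamma_seq T) = gamma_seq T"
    unfolding True
    by (rule bcontfun_eqI)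
      (simp add: apply_dilation2 apply_gamma_seq[OF zero_positive_L1_inf] log_average_zero)
  then show ?thesis by (simp add: dixmier_value_def)
next
  case False
  then have "positive_op T \<and> T \<in> L1_inf" using assms by (auto simp: positive_L1_inf_def positive_op_iff)
  then show ?thesis using \<omega> unfolding DL2_def dixmier_value_def by blast
qed

lemma dixmier_value_scaleR:
  fixes T :: "'h \<Rightarrow> 'h"
  assumes T: "T \<in> positive_L1_inf" and r: "0 \<le> r"
  shows "dixmier_value \<omega> (\<lambda>x. r *\<^sub>R T x) = r * dixmier_value \<omega> T"
proof -
  have "gamma_seq (\<lambda>x. r *\<^sub>R T x) = r *\<^sub>R gamma_seq T"
    by (rule bcontfun_eqI)
      (simp add: apply_gamma_seq[OF T] apply_gamma_seq[OF scaleR_positive_L1_inf[OF assms]]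
        log_average_scaleR[OF assms])
  then show ?thesis by (simp add: dixmier_value_def blinfun.scaleR_right)
qed

text \<open>Dilation invariance enters here: \<open>\<lceil>k / 2\<rceil>\<close> eigenvalues of each summand are controlled by
  \<open>k + 1\<close> eigenvalues of the sum, and \<open>ln\<close> changes by a bounded amount only.\<close>

lemma log_average_half_plus_le:
  fixes S T :: "'h \<Rightarrow> 'h"
  assumes S: "S \<in> positive_L1_inf" and T: "T \<in> positive_L1_inf"
    and C: "\<And>k. log_average (\<lambda>x. S x + T x) k \<le> C"
  shows "log_average S (Suc (i div 2)) + log_average T (Suc (i div 2))
    \<le> log_average (\<lambda>x. S x + T x) (Suc i) + 2 * C / ln ((real i + 3) / 2)"
proof -
  let ?R = "\<lambda>x. S x + T x" and ?j = "Suc (i div 2)"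
  note Rp = positive_L1_infD(1,2)[OF plus_positive_L1_inf[OF S T]]
  define L where "L = ln (1 + real ?j)"
  \<comment> \<open>With i = k - 1, the index j = i div 2 + 1 is ceil(k / 2), and 2 j is at most i +
    2: at most one singular value beyond the first i + 1 is involved.\<close>
  have i2: "real i \<le> 2 * real (i div 2) + 1"
    using div_mult_mod_eq[of i 2] by linarith
  have L': "0 < ln ((real i + 3) / 2)" by (rule ln_gt_zero) simp
  have LL: "ln ((real i + 3) / 2) \<le> L"
    unfolding L_def using i2 by (subst ln_le_cancel_iff) auto
  then have L: "0 < L" using L' by linarith
  have lk: "ln (1 + real (Suc i)) \<le> ln 2 + L"
  proof -
    have "ln (1 + real (Suc i)) \<le> ln (2 * (1 + real ?j))"
      using i2 by (subst ln_le_cancel_iff) auto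
    also have "\<dots> = ln 2 + L" unfolding L_def by (rule ln_mult_pos) auto
    finally show ?thesis .
  qed
  have C0: "0 \<le> C" using C[of 0] by (simp add: log_average_def)
  have ln2: "ln 2 \<le> (1::real)" using ln_le_minus_one[of "2::real"] by simp
  \<comment> \<open>The average at k = 1 divides by ln 2 <= 1, so C also bounds the largest singular
    value.\<close>
  have first: "ky_fan ?R 1 \<le> C"
  proof -
    have "ky_fan ?R 1 \<le> C * ln 2"
      using C[of 1] by (simp add: log_average_ky_fan field_simps)
    also have "\<dots> \<le> C * 1" by (rule mult_left_mono[OF ln2 C0])
    finally show ?thesis by simp
  qed
  let ?l = "log_average ?R (Suc i)"
  have "ky_fan S ?j + ky_fan T ?j \<le> ky_fan ?R (2 * ?j)"
    by (rule ky_fan_plus_ge[OF positive_L1_infD(1,2)[OF S] positive_L1_infD(1,2)[OF T]])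
  also have "\<dots> \<le> ky_fan ?R (Suc (Suc i))"
    by (rule ky_fan_mono[OF Rp]) simp
  also have "\<dots> \<le> ky_fan ?R (Suc i) + ky_fan ?R 1"
    using singular_value_le_first[OF Rp, of "Suc i"] by (simp add: ky_fan_Suc)
  also have "\<dots> \<le> ?l * ln (1 + real (Suc i)) + C"
    using first by (simp add: log_average_ky_fan)
  also have "\<dots> \<le> ?l * (ln 2 + L) + C"
    using lk log_average_nonneg[OF Rp] by (intro add_right_mono mult_left_mono) auto
  also have "\<dots> \<le> ?l * L + (C * 1 + C)"
    using mult_mono[OF C[of "Suc i"] ln2 C0] by (simp add: distrib_left)
  finally have "(ky_fan S ?j + ky_fan T ?j) / L \<le> (?l * L + 2 * C) / L"
    using L by (intro divide_right_mono) auto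
  also have "\<dots> = ?l + 2 * C / L" using L by (simp add: field_simps)
  \<comment> \<open>\<open>L\<close> contains i div 2; the smaller logarithm ln ((i + 3) / 2) gives
    an error in closed form that tends to 0.\<close>
  also have "\<dots> \<le> ?l + 2 * C / ln ((real i + 3) / 2)"
    using C0 L' L LL by (intro add_left_mono divide_left_mono mult_pos_pos) auto
  finally show ?thesis by (simp add: log_average_ky_fan L_def add_divide_distrib)
qed

text \<open>One inequality is Ky Fan subadditivity. For the other, the dilated averages of the
  summands are at most the average of the sum plus a null sequence d, whose value under \<omega> is
  at most 0; dilation invariance then removes the dilations.\<close>

lemma dixmier_value_plus:
  fixes S T :: "'h \<Rightarrow> 'h"
  assumes S: "S \<in> positive_L1_inf" and T: "T \<in> positive_L1_inf"
  shows "dixmier_value \<omega> (\<lambda>x. S x + T x) = dixmier_value \<omega> S + dixmier_value \<omega> T"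
proof (rule antisym)
  let ?R = "\<lambda>x. S x + T x"
  note R = plus_positive_L1_inf[OF S T]
  have "dixmier_value \<omega> ?R \<le> blinfun_apply \<omega> (gamma_seq S + gamma_seq T)"
    unfolding dixmier_value_def
    by (rule DL2_mono[OF \<omega>])
      (simp add: apply_gamma_seq R S T log_average_plus_le)
  then show "dixmier_value \<omega> ?R \<le> dixmier_value \<omega> S + dixmier_value \<omega> T"
    by (simp add: dixmier_value_def blinfun.add_right)
  obtain C where C: "\<And>k. log_average ?R k \<le> C" using positive_L1_infD[OF R] by blast
  have C0: "0 \<le> C" using C[of 0] by (simp add: log_average_def)
  define d where "d = (\<lambda>i::nat. 2 * C / ln ((real i + 3) / 2))"
  have "filterlim (\<lambda>i. (1 / 2) * (3 + real i)) at_top sequentially"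
    by (intro filterlim_tendsto_pos_mult_at_top[OF tendsto_const]
        filterlim_tendsto_add_at_top[OF tendsto_const] filterlim_real_sequentially) simp
  then have "filterlim (\<lambda>i. (real i + 3) / 2) at_top sequentially"
    by (simp add: add.commute)
  then have "filterlim (\<lambda>i. ln ((real i + 3) / 2)) at_infinity sequentially"
    by (intro filterlim_at_top_imp_at_infinity filterlim_compose[OF ln_at_top])
  then have d0: "d \<longlonglongrightarrow> 0"
    unfolding d_def by (rule tendsto_divide_0[OF tendsto_const])
  then have "d \<in> bcontfun"
    by (intro bounded_seq_bcontfun convergent_imp_bounded)
  then have d: "apply_bcontfun (Bcontfun d) = d" by (rule Bcontfun_inverse)
  have di: "d i = 2 * C / ln ((real i + 3) / 2)" for i by (simp add: d_def)
  have dnn: "0 \<le> d i" for i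
    unfolding d_def using C0 by (intro divide_nonneg_nonneg ln_ge_zero) auto
  have "blinfun_apply \<omega> (dilation2 (gamma_seq S) + dilation2 (gamma_seq T))
      \<le> blinfun_apply \<omega> (gamma_seq ?R + Bcontfun d)"
    by (rule DL2_mono[OF \<omega>])
      (use log_average_half_plus_le[OF S T C] in
        \<open>simp add: apply_dilation2 apply_gamma_seq R S T d di\<close>)
  also have "\<dots> \<le> dixmier_value \<omega> ?R"
    using DL2_null[OF \<omega>, of "Bcontfun d"] d dnn d0
    by (simp add: dixmier_value_def blinfun.add_right)
  finally show "dixmier_value \<omega> S + dixmier_value \<omega> T \<le> dixmier_value \<omega> ?R"
    by (simp add: blinfun.add_right dixmier_value_dilation2 S T)
qed

section \<open>Linear combinations of positive operators and the linear extension\<close>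

lemma dixmier_value_nonneg_combination:
  fixes A :: "('h \<Rightarrow> 'h) set"
  assumes "finite A" "A \<subseteq> positive_L1_inf" "\<And>a. 0 \<le> c a"
  shows "(\<lambda>x. \<Sum>a\<in>A. c a *\<^sub>R a x) \<in> positive_L1_inf \<and>
    dixmier_value \<omega> (\<lambda>x. \<Sum>a\<in>A. c a *\<^sub>R a x) = (\<Sum>a\<in>A. c a * dixmier_value \<omega> a)"
  using assms(1,2)
proof (induction A rule: finite_induct)
  case empty
  then show ?case by (simp add: zero_positive_L1_inf dixmier_value_zero)
next
  case (insert a A)
  then have a: "(\<lambda>x. c a *\<^sub>R a x) \<in> positive_L1_inf"
    using scaleR_positive_L1_inf assms(3) by blast
  show ?case
    using insert plus_positive_L1_inf[OF a, of "\<lambda>x. \<Sum>a\<in>A. c a *\<^sub>R a x"]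
      dixmier_value_plus[OF a, of "\<lambda>x. \<Sum>a\<in>A. c a *\<^sub>R a x"]
      dixmier_value_scaleR[of a "c a"] assms(3)
    by simp
qed

text \<open>Moving the negative coefficients to the side of T leaves nonnegative combinations within
  the cone on both sides. Their quadratic forms agree, hence so do the operators.\<close>

lemma dixmier_value_real_combination:
  fixes A :: "('h \<Rightarrow> 'h) set"
  assumes A: "finite A" "A \<subseteq> positive_L1_inf" and T: "T \<in> positive_L1_inf"
    and eq: "\<And>x. cinner x (T x) = (\<Sum>a\<in>A. of_real (c a) * cinner x (a x))"
  shows "dixmier_value \<omega> T = (\<Sum>a\<in>A. c a * dixmier_value \<omega> a)"
proof -
  define p n where "p = (\<lambda>a. max 0 (c a))" and "n = (\<lambda>a. max 0 (- c a))"
  have pn: "c a = p a - n a" for a by (simp add: p_def n_def max_def)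
  let ?P = "\<lambda>x. \<Sum>a\<in>A. p a *\<^sub>R a x" and ?N = "\<lambda>x. \<Sum>a\<in>A. n a *\<^sub>R a x"
  have P: "?P \<in> positive_L1_inf" "dixmier_value \<omega> ?P = (\<Sum>a\<in>A. p a * dixmier_value \<omega> a)"
    using dixmier_value_nonneg_combination[OF A, of p] by (auto simp: p_def)
  have N: "?N \<in> positive_L1_inf" "dixmier_value \<omega> ?N = (\<Sum>a\<in>A. n a * dixmier_value \<omega> a)"
    using dixmier_value_nonneg_combination[OF A, of n] by (auto simp: n_def)
  have "(\<lambda>x. T x + ?N x) = ?P"
  proof (rule quadratic_form_eqI)
    show "bounded_clinear (\<lambda>x. T x + ?N x)" "bounded_clinear ?P"
      using positive_L1_infD(1)[OF plus_positive_L1_inf[OF T N(1)]] positive_L1_infD(1)[OF P(1)]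
      by (simp_all add: psd_op_def)
    show "cinner x (T x + ?N x) = cinner x (?P x)" for x
      by (simp add: cinner_add_right cinner.sum_right cinner_scaleR_right eq pn
          scaleR_conv_of_real sum.distrib[symmetric] algebra_simps)
  qed
  then have "dixmier_value \<omega> T + dixmier_value \<omega> ?N = dixmier_value \<omega> ?P"
    using dixmier_value_plus[OF T N(1)] by simp
  then show ?thesis by (simp add: P(2) N(2) pn left_diff_distrib sum_subtractf)
qed

text \<open>All forms involved are real. So the real parts of the coefficients represent T, and the
  imaginary parts represent the zero operator, whose value is 0.\<close>

lemma dixmier_value_complex_combination:
  fixes A :: "('h \<Rightarrow> 'h) set"
  assumes A: "finite A" "A \<subseteq> positive_L1_inf" and T: "T \<in> positive_L1_inf"
    and eq: "\<And>x. T x = (\<Sum>a\<in>A. c a *\<^sub>C a x)"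
  shows "of_real (dixmier_value \<omega> T) = (\<Sum>a\<in>A. c a * of_real (dixmier_value \<omega> a))"
proof -
  define q where "q = (\<lambda>a x. Re (cinner x (a x :: 'h)))"
  have q: "cinner x (a x) = of_real (q a x)" if "a \<in> positive_L1_inf" for a x
    using psd_op_self[OF positive_L1_infD(1)[OF that], of x] by (simp add: q_def)
  have sum: "of_real (q T x) = (\<Sum>a\<in>A. c a * of_real (q a x))" for x
  proof -
    have "of_real (q T x) = cinner x (T x)" by (simp add: q T)
    also have "\<dots> = (\<Sum>a\<in>A. c a * cinner x (a x))"
      by (simp add: eq cinner.sum_right cinner_scaleC_right)
    also have "\<dots> = (\<Sum>a\<in>A. c a * of_real (q a x))"
      by (rule sum.cong) (use A q in auto)
    finally show ?thesis .
  qed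
  have qA: "(\<Sum>a\<in>A. of_real (r a) * cinner x (a x)) = of_real (\<Sum>a\<in>A. r a * q a x)" for r x
    unfolding of_real_sum by (rule sum.cong) (use A q in auto)
  have "dixmier_value \<omega> T = (\<Sum>a\<in>A. Re (c a) * dixmier_value \<omega> a)"
  proof (rule dixmier_value_real_combination[OF A T])
    show "cinner x (T x) = (\<Sum>a\<in>A. of_real (Re (c a)) * cinner x (a x))" for x
      unfolding qA q[OF T] using arg_cong[OF sum[of x], of Re] by simp
  qed
  moreover have "dixmier_value \<omega> (\<lambda>_. 0 :: 'h) = (\<Sum>a\<in>A. Im (c a) * dixmier_value \<omega> a)"
  proof (rule dixmier_value_real_combination[OF A zero_positive_L1_inf])
    show "cinner x 0 = (\<Sum>a\<in>A. of_real (Im (c a)) * cinner x (a x))" for x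
      unfolding qA using arg_cong[OF sum[of x], of Im] by (simp add: cinner.zero_right)
  qed
  ultimately show ?thesis by (simp add: complex_eq_iff dixmier_value_zero)
qed

text \<open>A basis of the complex vector space of all maps that contains a basis of the span of the
  positive cone yields the extension, so no decomposition of \<open>L1_inf\<close> into positive parts is needed.\<close>

lemma dixmier_extension_exists:
  "\<exists>\<phi> :: ('h \<Rightarrow> 'h) \<Rightarrow> complex. (\<forall>S T. \<phi> (\<lambda>x. S x + T x) = \<phi> S + \<phi> T) \<and>
    (\<forall>c T. \<phi> (\<lambda>x. c *\<^sub>C T x) = c * \<phi> T) \<and>
    (\<forall>T\<in>positive_L1_inf. \<phi> T = of_real (dixmier_value \<omega> T))"
proof -
  interpret V: vector_space "\<lambda>(c::complex) (T :: 'h \<Rightarrow> 'h) x. c *\<^sub>C T x"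
    by unfold_locales
      (auto simp: fun_eq_iff scaleC_add_right scaleC_add_left scaleC_scaleC)
  interpret C: vector_space "(*) :: complex \<Rightarrow> complex \<Rightarrow> complex"
    by unfold_locales (auto simp: algebra_simps)
  interpret VC: vector_space_pair "\<lambda>(c::complex) (T :: 'h \<Rightarrow> 'h) x. c *\<^sub>C T x"
    "(*) :: complex \<Rightarrow> complex \<Rightarrow> complex" ..
  obtain B where B: "B \<subseteq> positive_L1_inf" "V.independent B" "positive_L1_inf \<subseteq> V.span B"
    using V.maximal_independent_subset[of positive_L1_inf] by blast
  obtain g where g: "Vector_Spaces.linear (\<lambda>(c::complex) (T :: 'h \<Rightarrow> 'h) x. c *\<^sub>C T x) (*) g"
    "\<And>b. b \<in> B \<Longrightarrow> g b = complex_of_real (dixmier_value \<omega> b)"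
    using VC.linear_independent_extend[OF B(2), of "\<lambda>b. of_real (dixmier_value \<omega> b)"] by blast
  interpret g: Vector_Spaces.linear "\<lambda>(c::complex) (T :: 'h \<Rightarrow> 'h) x. c *\<^sub>C T x" "(*)" g by (rule g(1))
  have app: "(\<Sum>a\<in>A. f a) x = (\<Sum>a\<in>A. f a x)" if "finite A" for A and f :: "('h \<Rightarrow> 'h) \<Rightarrow> 'h \<Rightarrow> 'h" and x
    using that by (induction A rule: finite_induct) auto
  have "g T = of_real (dixmier_value \<omega> T)" if T: "T \<in> positive_L1_inf" for T
  proof -
    have "T \<in> V.span B" using B(3) T by blast
    then obtain A c where A: "finite A" "A \<subseteq> B" and Teq: "T = (\<Sum>a\<in>A. (\<lambda>x. c a *\<^sub>C a x))"
      unfolding V.span_explicit by blast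
    have "of_real (dixmier_value \<omega> T) = (\<Sum>a\<in>A. c a * complex_of_real (dixmier_value \<omega> a))"
      by (rule dixmier_value_complex_combination[OF A(1) _ T])
        (use A B(1) in \<open>auto simp: Teq app\<close>)
    also have "\<dots> = (\<Sum>a\<in>A. c a * g a)" using g(2) A(2) by (intro sum.cong) auto
    also have "\<dots> = g T" unfolding Teq g.sum g.scale ..
    finally show ?thesis by simp
  qed
  moreover have "g (\<lambda>x. S x + T x) = g S + g T" for S T
    using g.add[of S T] by (simp add: plus_fun_def)
  ultimately show ?thesis using g.scale by blast
qed

lemma zero_L1_inf: "(\<lambda>_. 0 :: 'h) \<in> L1_inf"
  using zero_positive_L1_inf by (simp add: positive_L1_inf_def)

text \<open>One existing extension validates the choice in \<open>dixmier_trace\<close>, and every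
  admissible choice has the prescribed values on the cone.\<close>

lemma dixmier_trace_positive:
  fixes T :: "'h \<Rightarrow> 'h"
  assumes T: "T \<in> positive_L1_inf"
  shows "dixmier_trace \<omega> T = of_real (dixmier_value \<omega> T)"
proof -
  let ?Q = "\<lambda>\<phi> :: ('h \<Rightarrow> 'h) \<Rightarrow> complex. (\<forall>S\<in>L1_inf. \<forall>T\<in>L1_inf. \<phi> (\<lambda>x. S x + T x) = \<phi> S + \<phi> T) \<and>
     (\<forall>c. \<forall>T\<in>L1_inf. \<phi> (\<lambda>x. c *\<^sub>C T x) = c * \<phi> T) \<and>
     (\<forall>T\<in>L1_inf. positive_op T \<longrightarrow> \<phi> T = complex_of_real (blinfun_apply \<omega> (gamma_seq T)))"
  obtain \<phi> :: "('h \<Rightarrow> 'h) \<Rightarrow> complex"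
    where "\<forall>S T. \<phi> (\<lambda>x. S x + T x) = \<phi> S + \<phi> T" "\<forall>c T. \<phi> (\<lambda>x. c *\<^sub>C T x) = c * \<phi> T"
      "\<forall>T\<in>positive_L1_inf. \<phi> T = of_real (dixmier_value \<omega> T)"
    using dixmier_extension_exists by blast
  then have "?Q \<phi>" by (auto simp: positive_L1_inf_def positive_op_iff dixmier_value_def)
  then have "?Q (SOME \<phi>. ?Q \<phi>)" by (rule someI[of ?Q])
  then have Q: "?Q (dixmier_trace \<omega>)" by (simp only: dixmier_trace_def[symmetric])
  show ?thesis
  proof (cases "T = (\<lambda>_. 0)")
    case True
    \<comment> \<open>The zero operator is not a \<open>positive_op\<close>; its value comes from
      homogeneity with factor 0.\<close>
    have "dixmier_trace \<omega> (\<lambda>x. 0 *\<^sub>C (0::'h)) = 0 * dixmier_trace \<omega> (\<lambda>_. 0 :: 'h)"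
      using bspec[OF spec[OF conjunct1[OF conjunct2[OF Q]], of 0] zero_L1_inf] .
    then show ?thesis by (simp add: True dixmier_value_zero)
  next
    case False
    then have "T \<in> L1_inf" "positive_op T" using T by (auto simp: positive_L1_inf_def positive_op_iff)
    then show ?thesis using Q by (simp add: dixmier_value_def)
  qed
qed

end

end

section \<open>Multiplication operators\<close>

lemma UN_tail_Suc: "(\<Union>j\<in>{n..}. F j) = F n \<union> (\<Union>j\<in>{Suc n..}. F j)"
proof -
  have "{n..} = insert n {Suc n..}" by auto
  then show ?thesis by simp
qed

lemma disjoint_family_tail:
  assumes "disjoint_family F" shows "F n \<inter> (\<Union>j\<in>{Suc n..}. F j) = {}"
proof -
  have "F n \<inter> F j = {}" if "Suc n \<le> j" for j
    by (rule disjoint_family_onD[OF assms]) (use that in auto)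
  then show ?thesis by blast
qed

text \<open>Disjointness puts p into at most one \<open>F i\<close>, so the tails decrease to the
  empty set.\<close>

lemma eventually_not_in_tail:
  assumes "disjoint_family F" shows "\<forall>\<^sub>F N in sequentially. p \<notin> (\<Union>j\<in>{N..}. F j)"
proof (cases "\<exists>i. p \<in> F i")
  case True
  then obtain i where "p \<in> F i" by blast
  then have "p \<notin> (\<Union>j\<in>{Suc i..}. F j)" using disjoint_family_tail[OF assms, of i] by blast
  then show ?thesis by (intro eventually_sequentiallyI[of "Suc i"]) auto
qed simp

lemma tendsto_zero_if_norm_squared:
  fixes f :: "nat \<Rightarrow> 'a::real_normed_vector"
  assumes "(\<lambda>n. (norm (f n))\<^sup>2) \<longlonglongrightarrow> 0" shows "f \<longlonglongrightarrow> 0"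
  using tendsto_real_sqrt[OF assms] by (simp add: tendsto_norm_zero_iff)

lemma tail_integral_tendsto_zero:
  fixes g :: "'f \<Rightarrow> real"
  assumes F: "range F \<subseteq> sets \<mu>" "disjoint_family F" and g: "integrable \<mu> g"
  shows "(\<lambda>N. LINT p:(\<Union>j\<in>{N..}. F j)|\<mu>. g p) \<longlonglongrightarrow> 0"
proof -
  have "(\<lambda>N. LINT p|\<mu>. indicator (\<Union>j\<in>{N..}. F j) p *\<^sub>R g p) \<longlonglongrightarrow> (LINT p|\<mu>. 0)"
  proof (rule integral_dominated_convergence)
    show "integrable \<mu> (\<lambda>p. norm (g p))" using g by (rule integrable_norm)
    have [measurable]: "(\<Union>j\<in>{N..}. F j) \<in> sets \<mu>" for N using F(1) by auto
    show "(\<lambda>p. indicator (\<Union>j\<in>{N..}. F j) p *\<^sub>R g p) \<in> borel_measurable \<mu>" for N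
      using g by measurable
    show "AE p in \<mu>. (\<lambda>N. indicator (\<Union>j\<in>{N..}. F j) p *\<^sub>R g p) \<longlonglongrightarrow> 0"
    proof (rule AE_I2)
      fix p
      have "\<forall>\<^sub>F N in sequentially. indicator (\<Union>j\<in>{N..}. F j) p *\<^sub>R g p = 0"
        using eventually_not_in_tail[OF F(2), of p] by eventually_elim simp
      then show "(\<lambda>N. indicator (\<Union>j\<in>{N..}. F j) p *\<^sub>R g p) \<longlonglongrightarrow> 0"
        by (rule tendsto_eventually)
    qed
  qed (auto simp: indicator_def)
  then show ?thesis by (simp add: set_lebesgue_integral_def)
qed

lemma borel_measurable_cnj [measurable]:
  "f \<in> borel_measurable M \<Longrightarrow> (\<lambda>x. cnj (f x)) \<in> borel_measurable M"
  by (rule measurable_compose[OF _ borel_measurable_continuous_onI]) (auto intro: continuous_intros)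

locale L2_representation =
  fixes \<mu> :: "'f measure" and U :: "'h::chilbert_space \<Rightarrow> 'f \<Rightarrow> complex"
  assumes finite_measure: "finite_measure \<mu>" and unitary: "unitary_to_L2 \<mu> U"
begin

lemma U_measurable [measurable]: "U x \<in> borel_measurable \<mu>"
  and U_integrable: "integrable \<mu> (\<lambda>p. (cmod (U x p))\<^sup>2)"
  and U_add: "AE p in \<mu>. U (x + y) p = U x p + U y p"
  and U_scale: "AE p in \<mu>. U (c *\<^sub>C x) p = c * U x p"
  and U_cinner: "cinner x y = (LINT p|\<mu>. cnj (U x p) * U y p)"
  and U_surj: "\<phi> \<in> L2 \<mu> \<Longrightarrow> \<exists>x. AE p in \<mu>. U x p = \<phi> p"
  using unitary by (auto simp: unitary_to_L2_def L2_def)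

lemma norm_U: "(norm x)\<^sup>2 = (LINT p|\<mu>. (cmod (U x p))\<^sup>2)"
proof -
  have "complex_of_real ((norm x)\<^sup>2) = (LINT p|\<mu>. of_real ((cmod (U x p))\<^sup>2))"
    unfolding cinner_self[symmetric] U_cinner complex_norm_square by (simp add: mult.commute)
  then show ?thesis unfolding integral_complex_of_real of_real_eq_iff .
qed

lemma U_diff: "AE p in \<mu>. U (x - y) p = U x p - U y p"
proof -
  have "x + (- 1) *\<^sub>C y = x - y" by (simp add: scaleC_minus_left)
  then have "AE p in \<mu>. U (x - y) p = U x p + U ((- 1) *\<^sub>C y) p"
    using U_add[of x "(- 1) *\<^sub>C y"] by simp
  then show ?thesis using U_scale[of "- 1" y] by eventually_elim simp
qed

text \<open>U is isometric and its values are representatives, so agreement almost everywhere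
  already means equality of vectors. Pointwise computations are transferred to the Hilbert space in
  this way.\<close>

lemma U_eqI:
  assumes "AE p in \<mu>. U x p = U y p" shows "x = y"
proof -
  have "AE p in \<mu>. (cmod (U (x - y) p))\<^sup>2 = 0" using assms U_diff[of x y] by eventually_elim simp
  then have "(LINT p|\<mu>. (cmod (U (x - y) p))\<^sup>2) = 0" by (intro integral_eq_zero_AE)
  then show ?thesis using norm_U[of "x - y"] by simp
qed

lemma mult_op_eqI:
  assumes "AE p in \<mu>. U y p = f p * U x p" shows "mult_op \<mu> U f x = y"
  unfolding mult_op_def
proof (rule the_equality)
  fix z assume "AE p in \<mu>. U z p = f p * U x p"
  with assms have "AE p in \<mu>. U z p = U y p" by eventually_elim simp
  then show "z = y" by (rule U_eqI)
qed (rule assms)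

lemma mult_op_AE:
  assumes f: "f \<in> L_inf \<mu>" shows "AE p in \<mu>. U (mult_op \<mu> U f x) p = f p * U x p"
proof -
  obtain C where C: "AE p in \<mu>. cmod (f p) \<le> C" and [measurable]: "f \<in> borel_measurable \<mu>"
    using f by (auto simp: L_inf_def)
  have "integrable \<mu> (\<lambda>p. (cmod (f p * U x p))\<^sup>2)"
  proof (rule Bochner_Integration.integrable_bound)
    show "integrable \<mu> (\<lambda>p. C\<^sup>2 * (cmod (U x p))\<^sup>2)" using U_integrable by simp
    show "AE p in \<mu>. norm ((cmod (f p * U x p))\<^sup>2) \<le> norm (C\<^sup>2 * (cmod (U x p))\<^sup>2)"
      using C
    proof eventually_elim
      case (elim p)
      then show ?case
        by (simp add: norm_mult power_mult_distrib mult_right_mono power_mono)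
    qed
  qed measurable
  then have "(\<lambda>p. f p * U x p) \<in> L2 \<mu>" by (simp add: L2_def)
  then obtain y where "AE p in \<mu>. U y p = f p * U x p" using U_surj by blast
  then show ?thesis using mult_op_eqI by metis
qed

lemma mult_op_cong:
  assumes f: "f \<in> L_inf \<mu>" "AE p in \<mu>. f p = g p" shows "mult_op \<mu> U f = mult_op \<mu> U g"
proof
  fix x
  have "AE p in \<mu>. U (mult_op \<mu> U f x) p = g p * U x p"
    using mult_op_AE[OF f(1), of x] f(2) by eventually_elim simp
  then show "mult_op \<mu> U f x = mult_op \<mu> U g x" by (rule mult_op_eqI[symmetric])
qed

definition proj :: "'f set \<Rightarrow> 'h \<Rightarrow> 'h" where
  "proj J = mult_op \<mu> U (indicator J)"

lemma indicator_L_inf: "J \<in> sets \<mu> \<Longrightarrow> indicator J \<in> L_inf \<mu>"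
  unfolding L_inf_def by (auto intro!: exI[of _ 1] AE_I2 simp: indicator_def)

lemma proj_AE: "J \<in> sets \<mu> \<Longrightarrow> AE p in \<mu>. U (proj J x) p = indicator J p * U x p"
  unfolding proj_def by (rule mult_op_AE[OF indicator_L_inf])

lemma proj_eqI: "AE p in \<mu>. U y p = indicator J p * U x p \<Longrightarrow> proj J x = y"
  unfolding proj_def by (rule mult_op_eqI)

lemma norm_proj:
  assumes "J \<in> sets \<mu>"
  shows "(norm (proj J x))\<^sup>2 = (LINT p:J|\<mu>. (cmod (U x p))\<^sup>2)"
  unfolding norm_U set_lebesgue_integral_def
proof (rule integral_cong_AE)
  show "(\<lambda>p. indicat_real J p *\<^sub>R (cmod (U x p))\<^sup>2) \<in> borel_measurable \<mu>"
    using assms by measurable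
  show "AE p in \<mu>. (cmod (U (proj J x) p))\<^sup>2 = indicat_real J p *\<^sub>R (cmod (U x p))\<^sup>2"
    using proj_AE[OF assms, of x] by eventually_elim (auto simp: indicator_def)
qed measurable

lemma norm_proj_le:
  assumes "J \<in> sets \<mu>" shows "norm (proj J x) \<le> norm x"
proof -
  have "(norm (proj J x))\<^sup>2 \<le> (norm x)\<^sup>2"
    unfolding norm_U
  proof (rule integral_mono_AE)
    show "AE p in \<mu>. (cmod (U (proj J x) p))\<^sup>2 \<le> (cmod (U x p))\<^sup>2"
      using proj_AE[OF assms, of x] by eventually_elim (auto simp: indicator_def)
  qed (rule U_integrable)+
  then show ?thesis by (simp add: power2_le_iff_abs_le)
qed

lemma proj_bounded_clinear:
  assumes "J \<in> sets \<mu>" shows "bounded_clinear (proj J)"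
proof (rule bounded_clinear_intro[of _ 1])
  fix x y c
  have "AE p in \<mu>. U (proj J x + proj J y) p = indicator J p * U (x + y) p"
    using U_add[of x y] U_add[of "proj J x" "proj J y"] proj_AE[OF assms, of x] proj_AE[OF assms, of y]
    by eventually_elim (simp add: distrib_left)
  then show "proj J (x + y) = proj J x + proj J y" by (rule proj_eqI)
  have "AE p in \<mu>. U (c *\<^sub>C proj J x) p = indicator J p * U (c *\<^sub>C x) p"
    using U_scale[of c x] U_scale[of c "proj J x"] proj_AE[OF assms, of x]
    by eventually_elim simp
  then show "proj J (c *\<^sub>C x) = c *\<^sub>C proj J x" by (rule proj_eqI)
  show "norm (proj J x) \<le> norm x * 1" using norm_proj_le[OF assms] by simp
qed

lemma proj_symmetric:
  assumes "J \<in> sets \<mu>" shows "cinner (proj J x) y = cinner x (proj J y)"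
  unfolding U_cinner
proof (rule integral_cong_AE)
  show "AE p in \<mu>. cnj (U (proj J x) p) * U y p = cnj (U x p) * U (proj J y) p"
    using proj_AE[OF assms, of x] proj_AE[OF assms, of y]
    by eventually_elim (auto simp: indicator_def)
qed measurable

lemma proj_Int:
  assumes "J \<in> sets \<mu>" "K \<in> sets \<mu>" shows "proj J (proj K x) = proj (J \<inter> K) x"
proof -
  have "AE p in \<mu>. U (proj J (proj K x)) p = indicator (J \<inter> K) p * U x p"
    using proj_AE[OF assms(1), of "proj K x"] proj_AE[OF assms(2), of x]
    by eventually_elim (simp add: indicator_inter_arith)
  then show ?thesis by (rule proj_eqI[symmetric])
qed

lemma proj_Un:
  assumes "J \<in> sets \<mu>" "K \<in> sets \<mu>" "J \<inter> K = {}"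
  shows "proj (J \<union> K) x = proj J x + proj K x"
proof (rule proj_eqI)
  show "AE p in \<mu>. U (proj J x + proj K x) p = indicator (J \<union> K) p * U x p"
    using proj_AE[OF assms(1), of x] proj_AE[OF assms(2), of x] U_add[of "proj J x" "proj K x"]
    by eventually_elim (use assms(3) in \<open>auto simp: indicator_def\<close>)
qed

lemma proj_null:
  assumes "J \<in> null_sets \<mu>" shows "proj J x = 0"
proof -
  have "J \<in> sets \<mu>" using assms by auto
  then have "AE p in \<mu>. U (proj J x) p = 0 * U x p"
    using proj_AE[of J x] AE_not_in[OF assms] by (auto elim: eventually_elim2)
  then have "AE p in \<mu>. U (proj J x) p = U (0 *\<^sub>C x) p"
    using U_scale[of 0 x] by eventually_elim simp
  then have "proj J x = 0 *\<^sub>C x" by (rule U_eqI)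
  then show ?thesis by simp
qed

lemma proj_empty: "proj {} x = 0"
  by (rule proj_null) simp

lemma proj_space: "proj (space \<mu>) x = x"
  by (rule proj_eqI) (rule AE_I2, simp)

lemma projection_op_proj:
  assumes "J \<in> sets \<mu>" shows "projection_op (proj J)"
  by (rule projection_opI) (simp_all add: assms proj_bounded_clinear proj_symmetric proj_Int)

text \<open>The squared norm of the remainder is a tail integral of an integrable function, hence
  tends to 0, and the series telescopes.\<close>

lemma proj_sums:
  assumes F: "range F \<subseteq> sets \<mu>" "disjoint_family F"
  shows "(\<lambda>j. proj (F j) x) sums proj (\<Union>j. F j) x"
proof -
  have Fs: "F j \<in> sets \<mu>" for j using F(1) by auto
  have tail: "(\<Union>j\<in>{n..}. F j) \<in> sets \<mu>" for n using Fs by auto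
  have "(\<lambda>n. (norm (proj (\<Union>j\<in>{n..}. F j) x))\<^sup>2) \<longlonglongrightarrow> 0"
    unfolding norm_proj[OF tail] by (rule tail_integral_tendsto_zero[OF F U_integrable])
  then have "(\<lambda>n. proj (\<Union>j\<in>{n..}. F j) x) \<longlonglongrightarrow> 0" by (rule tendsto_zero_if_norm_squared)
  from telescope_sums'[OF this]
  have "(\<lambda>n. proj (\<Union>j\<in>{n..}. F j) x - proj (\<Union>j\<in>{Suc n..}. F j) x) sums proj (\<Union>j. F j) x" by simp
  moreover have "proj (\<Union>j\<in>{n..}. F j) x = proj (F n) x + proj (\<Union>j\<in>{Suc n..}. F j) x" for n
    unfolding UN_tail_Suc[of F n] by (rule proj_Un[OF Fs tail disjoint_family_tail[OF F(2)]])
  then have "proj (\<Union>j\<in>{n..}. F j) x - proj (\<Union>j\<in>{Suc n..}. F j) x = proj (F n) x" for n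
    unfolding diff_eq_eq .
  ultimately show ?thesis by simp
qed

lemma proj_tail_suminf:
  assumes "range F \<subseteq> sets \<mu>" "disjoint_family F"
  shows "(\<Sum>j. proj (F (N + j)) x) = proj (\<Union>j\<in>{N..}. F j) x"
proof -
  have "(\<lambda>j. proj (F (N + j)) x) sums proj (\<Union>j. F (N + j)) x"
    by (rule proj_sums) (use assms in \<open>auto simp: disjoint_family_on_def\<close>)
  moreover have "{N..} = range (\<lambda>j. N + j)" by (auto simp: image_iff le_iff_add)
  then have "(\<Union>j. F (N + j)) = (\<Union>j\<in>{N..}. F j)" by (simp add: image_image)
  ultimately show ?thesis by (simp add: sums_iff)
qed

text \<open>The symbols are read off by testing on a vector u with image 1, available because the
  measure is finite. Idempotence forces each symbol to be 0 or 1 almost everywhere.\<close>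

lemma orthogonal_projections_sets:
  fixes Q :: "nat \<Rightarrow> 'h \<Rightarrow> 'h"
  assumes Q: "\<And>j. Q j \<in> mult_op \<mu> U ` L_inf \<mu>" "\<And>j x. Q j (Q j x) = Q j x"
    and orth: "\<And>i j x. i \<noteq> j \<Longrightarrow> Q i (Q j x) = 0"
  obtains F where "range F \<subseteq> sets \<mu>" "disjoint_family F" "\<And>j. Q j = proj (F j)"
proof -
  have "\<forall>j. \<exists>f\<in>L_inf \<mu>. Q j = mult_op \<mu> U f" using Q(1) by blast
  then obtain f where f: "\<And>j. f j \<in> L_inf \<mu>" "\<And>j. Q j = mult_op \<mu> U (f j)" by metis
  have [measurable]: "f j \<in> borel_measurable \<mu>" for j using f(1)[of j] by (simp add: L_inf_def)
  interpret finite_measure \<mu> by (rule finite_measure)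
  have "(\<lambda>_. 1) \<in> L2 \<mu>" by (simp add: L2_def)
  then obtain u where u: "AE p in \<mu>. U u p = 1" using U_surj by blast
  have Qu: "AE p in \<mu>. U (Q j u) p = f j p" for j
    using mult_op_AE[OF f(1), of j u] u unfolding f(2) by eventually_elim simp
  have QQu: "AE p in \<mu>. U (Q i (Q j u)) p = f i p * f j p" for i j
    using mult_op_AE[OF f(1), of i "Q j u"] Qu[of j] unfolding f(2) by eventually_elim simp
  define S where "S = (\<lambda>j. {p \<in> space \<mu>. f j p = 1})"
  have S: "S j \<in> sets \<mu>" for j unfolding S_def by measurable
  have fS: "AE p in \<mu>. f j p = indicator (S j) p" for j
    using Qu[of j] QQu[of j j] AE_space
    by eventually_elim (auto simp: Q(2) S_def indicator_def)
  have "AE p in \<mu>. U (0::'h) p = 0" using U_scale[of 0 0] by simp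
  then have "AE p in \<mu>. f i p * f j p = 0" if "i \<noteq> j" for i j
    using QQu[of i j] by eventually_elim (simp add: orth[OF that])
  then have "AE p in \<mu>. \<forall>i j. i \<noteq> j \<longrightarrow> f i p * f j p = 0"
    unfolding AE_all_countable by simp
  \<comment> \<open>Orthogonality makes the sets \<open>S j\<close> disjoint only up to null sets;
    \<open>disjointed\<close> removes the overlaps without changing the operators.\<close>
  then have "AE p in \<mu>. f j p = indicator (disjointed S j) p" for j
    using fS[of j] AE_space
  proof eventually_elim
    case (elim p)
    have "p \<in> disjointed S j" if "p \<in> S j"
    proof -
      have "p \<notin> S i" if "i < j" for i
        using elim(1)[rule_format, of i j] \<open>p \<in> S j\<close> that by (auto simp: S_def)
      then show ?thesis using that by (auto simp: disjointed_def)
    qed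
    then show ?case using elim(2) disjointed_subset[of S j] by (auto simp: indicator_def)
  qed
  then have "Q j = proj (disjointed S j)" for j
    unfolding f(2) proj_def by (rule mult_op_cong[OF f(1)])
  moreover have "range (disjointed S) \<subseteq> sets \<mu>"
    using S by (intro sets.range_disjointed_sets) auto
  ultimately show thesis using that[of "disjointed S"] disjoint_family_disjointed by blast
qed

section \<open>Compressions and reflections\<close>

definition compress :: "'f set \<Rightarrow> ('h \<Rightarrow> 'h) \<Rightarrow> ('h \<Rightarrow> 'h)" where
  "compress J T = proj J \<circ> T \<circ> proj J"

lemma compress_psd: "J \<in> sets \<mu> \<Longrightarrow> psd_op T \<Longrightarrow> psd_op (compress J T)"
  unfolding compress_def by (intro psd_op_conj proj_bounded_clinear proj_symmetric)

lemma compress_compact: "J \<in> sets \<mu> \<Longrightarrow> compact_op T \<Longrightarrow> compact_op (compress J T)"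
  unfolding compress_def
  by (intro compact_op_compose_left compact_op_compose_right proj_bounded_clinear)

text \<open>The selfadjoint unitary that is -1 on the range of \<open>proj J\<close> and 1 on its
  complement.\<close>

definition reflect :: "'f set \<Rightarrow> 'h \<Rightarrow> 'h" where
  "reflect J x = x - 2 *\<^sub>R proj J x"

lemma reflect_bounded_clinear: "J \<in> sets \<mu> \<Longrightarrow> bounded_clinear (reflect J)"
  unfolding reflect_def
  by (intro bounded_clinear_minus bounded_clinear_id[unfolded id_def] bounded_clinear_scaleR proj_bounded_clinear)

lemma reflect_symmetric: "J \<in> sets \<mu> \<Longrightarrow> cinner (reflect J x) y = cinner x (reflect J y)"
  by (simp add: reflect_def cinner.diff_left cinner.diff_right cinner_scaleR_left
      cinner_scaleR_right proj_symmetric)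

lemma proj_linear: "J \<in> sets \<mu> \<Longrightarrow> linear (proj J)"
  by (rule bounded_clinear_linear[OF proj_bounded_clinear])

lemma reflect_reflect: "J \<in> sets \<mu> \<Longrightarrow> reflect J (reflect J x) = x"
  by (simp add: reflect_def linear_diff[OF proj_linear] linear_scale[OF proj_linear] proj_Int)
    (simp add: scaleR_2)

lemma reflect_conj_compress_psd:
  assumes "J \<in> sets \<mu>" "psd_op T" "compact_op T"
  shows "psd_op (reflect J \<circ> T \<circ> reflect J)" "compact_op (reflect J \<circ> T \<circ> reflect J)"
  by (intro psd_op_conj compact_op_compose_left compact_op_compose_right
      reflect_bounded_clinear reflect_symmetric assms)+

text \<open>Averaging over the symmetry \<open>reflect K\<close> removes the off-diagonal terms.\<close>

lemma compress_pinching: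
  assumes J: "J \<in> sets \<mu>" and K: "K \<in> sets \<mu>" and JK: "J \<inter> K = {}" and T: "bounded_clinear T"
  shows "compress (J \<union> K) T x + (reflect K \<circ> compress (J \<union> K) T \<circ> reflect K) x
    = 2 *\<^sub>R (compress J T x + compress K T x)"
proof -
  note lin = linear_diff[OF proj_linear] linear_scale[OF proj_linear] linear_add[OF proj_linear]
  have KJ: "K \<inter> J = {}" using JK by blast
  have Un: "proj (J \<union> K) y = proj J y + proj K y" for y by (rule proj_Un[OF J K JK])
  have r1: "proj (J \<union> K) (reflect K y) = proj J y - proj K y" for y
    by (simp add: Un reflect_def lin J K proj_Int JK proj_empty)
      (simp add: scaleR_2)
  have r2: "reflect K (proj (J \<union> K) y) = proj J y - proj K y" for y
    by (simp add: Un reflect_def lin J K proj_Int KJ proj_empty)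
      (simp add: scaleR_2)
  show ?thesis
    unfolding compress_def comp_def r1 r2
    unfolding Un
    by (simp add: lin J K linear_add[OF bounded_clinear_linear[OF T]]
        linear_diff[OF bounded_clinear_linear[OF T]] scaleR_2 algebra_simps)
qed

end

locale L2_compression = infinite_orthonormal h + L2_representation \<mu> U
  for h :: "nat \<Rightarrow> 'h::chilbert_space" and \<mu> :: "'f measure" and U :: "'h \<Rightarrow> 'f \<Rightarrow> complex"
begin

text \<open>Pinching along J and its complement makes the sum of both compressions the mean of T and
  a unitary conjugate of T. Ky Fan sums are subadditive and unitarily invariant, and the compression
  to J lies below that sum. Hence compressions stay in the ideal.\<close>

lemma ky_fan_compress_le:
  assumes J: "J \<in> sets \<mu>" and T: "psd_op T" "compact_op T"
  shows "ky_fan (compress J T) k \<le> ky_fan T k"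
proof -
  let ?K = "space \<mu> - J"
  let ?A = "compress J T" and ?B = "compress ?K T"
  let ?W = "reflect ?K \<circ> T \<circ> reflect ?K"
  have K: "?K \<in> sets \<mu>" using J by auto
  note A = compress_psd[OF J T(1)] compress_compact[OF J T(2)]
  note B = compress_psd[OF K T(1)] compress_compact[OF K T(2)]
  note AB = psd_op_plus[OF A(1) B(1)] compact_op_plus[OF A(2) B(2)]
  note W = reflect_conj_compress_psd[OF K T]
  have un: "J \<union> ?K = space \<mu>" using sets.sets_into_space[OF J] by blast
  have "compress (space \<mu>) T = T" by (simp add: compress_def proj_space fun_eq_iff)
  then have "T x + ?W x = 2 *\<^sub>R (?A x + ?B x)" for x
    using compress_pinching[OF J K _, of T x] T(1) un by (simp add: psd_op_def)
  then have eq: "(\<lambda>x. 2 *\<^sub>R (?A x + ?B x)) = (\<lambda>x. T x + ?W x)" by simp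
  have "2 * ky_fan ?A k \<le> 2 * ky_fan (\<lambda>x. ?A x + ?B x) k"
    using ky_fan_mono_op[OF A AB, of k] psd_op_Re_nonneg[OF B(1)] by (simp add: cinner_add_right)
  also have "\<dots> = ky_fan (\<lambda>x. 2 *\<^sub>R (?A x + ?B x)) k"
    using ky_fan_scaleR[OF AB, of 2 k] by simp
  also have "\<dots> \<le> ky_fan T k + ky_fan ?W k"
    unfolding eq by (rule ky_fan_plus_le[OF T W])
  also have "ky_fan ?W k = ky_fan T k"
    by (rule ky_fan_symmetry_conj[OF T reflect_bounded_clinear[OF K] reflect_symmetric[OF K]
          reflect_reflect[OF K]])
  finally show ?thesis by simp
qed

lemma compress_positive_L1_inf:
  assumes J: "J \<in> sets \<mu>" and T: "T \<in> positive_L1_inf"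
  shows "compress J T \<in> positive_L1_inf"
proof -
  obtain C where C: "\<And>k. log_average T k \<le> C" using positive_L1_infD[OF T] by blast
  note T' = positive_L1_infD(1,2)[OF T]
  have "log_average (compress J T) k \<le> log_average T k" for k
    unfolding log_average_ky_fan
    by (intro divide_right_mono ky_fan_compress_le[OF J T']) simp
  then have "log_average (compress J T) k \<le> C" for k using C order_trans by blast
  then show ?thesis
    by (intro positive_L1_infI compress_psd compress_compact J T')
qed

section \<open>The measure defined by a Dixmier trace\<close>

context
  fixes \<omega> :: "(nat \<Rightarrow>\<^sub>C real) \<Rightarrow>\<^sub>L real" and T :: "'h \<Rightarrow> 'h"
  assumes \<omega>: "\<omega> \<in> DL2 TYPE('h)" and T: "T \<in> positive_L1_inf"
begin

text \<open>The off-diagonal blocks of the compression to the union cancel on averaging with its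
  reflected copy, and the two copies have the same singular values.\<close>

lemma dixmier_value_compress_Un:
  assumes J: "J \<in> sets \<mu>" and K: "K \<in> sets \<mu>" and JK: "J \<inter> K = {}"
  shows "dixmier_value \<omega> (compress (J \<union> K) T)
    = dixmier_value \<omega> (compress J T) + dixmier_value \<omega> (compress K T)"
proof -
  let ?A = "compress J T" and ?B = "compress K T" and ?S = "compress (J \<union> K) T"
  let ?W = "reflect K \<circ> ?S \<circ> reflect K"
  have S: "?S \<in> positive_L1_inf" using J K T by (intro compress_positive_L1_inf) auto
  note A = compress_positive_L1_inf[OF J T] and B = compress_positive_L1_inf[OF K T]
  note S' = positive_L1_infD(1,2)[OF S]
  have "log_average ?W k = log_average ?S k" for k
    unfolding log_average_ky_fan
    by (simp add: ky_fan_symmetry_conj[OF S' reflect_bounded_clinear[OF K] reflect_symmetric[OF K]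
          reflect_reflect[OF K]])
  moreover from this have W: "?W \<in> positive_L1_inf"
    using positive_L1_infD(3)[OF S] reflect_conj_compress_psd[OF K S'] positive_L1_infI by metis
  ultimately have W_eq: "dixmier_value \<omega> ?W = dixmier_value \<omega> ?S"
    using dixmier_value_mono[OF \<omega> S W] dixmier_value_mono[OF \<omega> W S] by simp
  have "bounded_clinear T" using positive_L1_infD(1)[OF T] by (simp add: psd_op_def)
  then have "(\<lambda>x. ?S x + ?W x) = (\<lambda>x. 2 *\<^sub>R (?A x + ?B x))"
    using compress_pinching[OF J K JK] by (intro ext)
  then have "dixmier_value \<omega> ?S + dixmier_value \<omega> ?W
      = 2 * (dixmier_value \<omega> ?A + dixmier_value \<omega> ?B)"
    using dixmier_value_plus[OF \<omega> S W] dixmier_value_plus[OF \<omega> A B]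
      dixmier_value_scaleR[OF \<omega> plus_positive_L1_inf[OF A B], of 2] by simp
  then show ?thesis using W_eq by simp
qed

text \<open>The remainder of the series is the value on a tail union. It lies between 0 and the
  seminorm of the tail compression, which \<open>tails\<close> sends to 0.\<close>

lemma dixmier_value_compress_sums:
  assumes tails: "projection_tails_vanish \<mu> U T"
    and F: "range F \<subseteq> sets \<mu>" "disjoint_family F"
  shows "(\<lambda>j. dixmier_value \<omega> (compress (F j) T)) sums dixmier_value \<omega> (compress (\<Union>j. F j) T)"
proof -
  let ?d = "\<lambda>J. dixmier_value \<omega> (compress J T)"
  define R where "R = (\<lambda>n. \<Union>j\<in>{n..}. F j)"
  have Fs: "F j \<in> sets \<mu>" for j using F(1) by auto
  have R: "R n \<in> sets \<mu>" for n unfolding R_def using Fs by auto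
  have split: "?d (R n) - ?d (R (Suc n)) = ?d (F n)" for n
  proof -
    have "R n = F n \<union> R (Suc n)" unfolding R_def by (rule UN_tail_Suc)
    moreover have "F n \<inter> R (Suc n) = {}" unfolding R_def by (rule disjoint_family_tail[OF F(2)])
    ultimately show ?thesis using dixmier_value_compress_Un[OF Fs R] by (metis add_diff_cancel_right')
  qed
  have tail_sum: "(\<Sum>j. proj (F (N + j)) x) = proj (R N) x" for N x
    unfolding R_def by (rule proj_tail_suminf[OF F])
  have "\<forall>j. projection_op (proj (F j)) \<and> proj (F j) \<in> mult_op \<mu> U ` L_inf \<mu>"
    using projection_op_proj[OF Fs] indicator_L_inf[OF Fs] by (auto simp: proj_def)
  moreover have "\<forall>i j. i \<noteq> j \<longrightarrow> proj (F i) \<circ> proj (F j) = (\<lambda>_. 0)"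
    using F(2) by (auto simp: fun_eq_iff proj_Int[OF Fs Fs] disjoint_family_on_def proj_empty)
  ultimately have lim: "(\<lambda>N. seminorm_0 (compress (R N) T)) \<longlonglongrightarrow> 0"
    using spec[OF tails[unfolded projection_tails_vanish_def], of "\<lambda>j. proj (F j)"]
    unfolding Let_def tail_sum compress_def by simp
  have c: "compress (R n) T \<in> positive_L1_inf" for n by (rule compress_positive_L1_inf[OF R T])
  have "(\<lambda>n. ereal (?d (R n))) \<longlonglongrightarrow> 0"
  proof (rule tendsto_sandwich[OF _ _ tendsto_const lim])
    show "\<forall>\<^sub>F n in sequentially. 0 \<le> ereal (?d (R n))"
      using dixmier_value_nonneg[OF \<omega> c] by simp
    show "\<forall>\<^sub>F n in sequentially. ereal (?d (R n)) \<le> seminorm_0 (compress (R n) T)"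
      using dixmier_value_le_seminorm_0[OF \<omega> c] by simp
  qed
  then have "(\<lambda>n. ?d (R n)) \<longlonglongrightarrow> 0" by (simp add: zero_ereal_def)
  from telescope_sums'[OF this]
  have "(\<lambda>n. ?d (R n) - ?d (R (Suc n))) sums ?d (\<Union>j. F j)" by (simp add: R_def)
  then show ?thesis by (simp add: split)
qed

lemma nu_finite_ac_measure:
  assumes tails: "projection_tails_vanish \<mu> U T"
  shows "is_finite_ac_measure \<mu> (nu \<mu> U T \<omega>)"
proof -
  let ?d = "\<lambda>J. dixmier_value \<omega> (compress J T)"
  define M where "M = measure_of (space \<mu>) (sets \<mu>) (\<lambda>J. ennreal (?d J))"
  have nonneg: "0 \<le> ?d J" if "J \<in> sets \<mu>" for J
    by (rule dixmier_value_nonneg[OF \<omega> compress_positive_L1_inf[OF that T]])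
  have nu: "nu \<mu> U T \<omega> J = of_real (?d J)" if "J \<in> sets \<mu>" for J
    using dixmier_trace_positive[OF \<omega> compress_positive_L1_inf[OF that T]]
    by (simp add: nu_def compress_def proj_def)
  \<comment> \<open>This yields both the value 0 on the empty set and absolute continuity.\<close>
  have null: "?d J = 0" if "J \<in> null_sets \<mu>" for J
  proof -
    have "compress J T = (\<lambda>_. 0)"
      by (simp add: compress_def fun_eq_iff proj_null[OF that])
    then show ?thesis by (simp add: dixmier_value_zero[OF \<omega>])
  qed
  have M: "space M = space \<mu>" "sets M = sets \<mu>"
    by (simp_all add: M_def sets.space_closed sets.sigma_sets_eq)
  have em: "emeasure M J = ennreal (?d J)" if "J \<in> sets \<mu>" for J
    unfolding M_def
  proof (rule emeasure_measure_of_sigma[OF sets.sigma_algebra_axioms _ _ that])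
    show "positive (sets \<mu>) (\<lambda>J. ennreal (?d J))"
      by (simp add: positive_def null)
    show "countably_additive (sets \<mu>) (\<lambda>J. ennreal (?d J))"
    proof (rule countably_additiveI)
      fix F :: "nat \<Rightarrow> 'f set" assume F: "range F \<subseteq> sets \<mu>" "disjoint_family F"
      have s: "(\<lambda>j. ?d (F j)) sums ?d (\<Union>j. F j)" by (rule dixmier_value_compress_sums[OF tails F])
      have "(\<Sum>j. ennreal (?d (F j))) = ennreal (\<Sum>j. ?d (F j))"
        by (rule suminf_ennreal2) (use F nonneg s in \<open>auto simp: sums_iff\<close>)
      then show "(\<Sum>j. ennreal (?d (F j))) = ennreal (?d (\<Union>j. F j))"
        using s by (simp add: sums_iff)
    qed
  qed
  show ?thesis
    unfolding is_finite_ac_measure_def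
  proof (intro exI[of _ M] conjI ballI)
    show "finite_measure M" by (rule finite_measureI) (simp add: em M)
    show "absolutely_continuous \<mu> M"
      unfolding absolutely_continuous_def
      by (auto simp: null_sets_def em M) (use null in \<open>auto simp: null_sets_def\<close>)
    show "nu \<mu> U T \<omega> J = complex_of_real (measure M J)" if "J \<in> sets \<mu>" for J
      using that nonneg by (simp add: nu measure_def em)
  qed (rule M)
qed

end

end

section \<open>Orthonormal bases and diagonal operators\<close>

locale hilbert_basis =
  fixes h :: "nat \<Rightarrow> 'h::chilbert_space"
  assumes basis: "orthonormal_basis h"
begin

sublocale infinite_orthonormal h
  by unfold_locales (use basis in \<open>simp add: orthonormal_basis_def\<close>)

lemma basis_expansion: "(\<lambda>m. cinner (h m) x *\<^sub>C h m) sums x"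
  using basis by (simp add: orthonormal_basis_def)

lemma cinner_basis: "cinner (h i) (h j) = (if i = j then 1 else 0)"
  using orthonormal by (simp add: orthonormal_on_def)

lemma parseval: "(\<lambda>m. cinner x (h m) * cinner (h m) y) sums cinner x y"
  using bounded_linear.sums[OF cinner.bounded_linear_right basis_expansion[of y], of x]
  by (simp add: cinner_scaleC_right mult.commute)

lemma cinner_times_commute: "cinner x y * cinner y x = of_real ((cmod (cinner y x))\<^sup>2)"
  using cinner_commute[of x y] by (simp only: complex_norm_square mult.commute)

lemma parseval_norm: "(\<lambda>m. (cmod (cinner (h m) x))\<^sup>2) sums (norm x)\<^sup>2"
  using parseval[of x x] unfolding cinner_times_commute cinner_self sums_of_real_iff .

lemma coeff_eqI: "(\<And>m. cinner (h m) x = cinner (h m) y) \<Longrightarrow> x = y"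
  using sums_unique2[OF basis_expansion[of x]] basis_expansion[of y] by simp

lemma norm_sum_basis:
  assumes "finite I"
  shows "(norm (\<Sum>i\<in>I. a i *\<^sub>C h i))\<^sup>2 = (\<Sum>i\<in>I. (cmod (a i))\<^sup>2)"
proof -
  have "complex_of_real ((norm (\<Sum>i\<in>I. a i *\<^sub>C h i))\<^sup>2)
      = (\<Sum>i\<in>I. \<Sum>j\<in>I. a i * (cnj (a j) * (if j = i then 1 else 0)))"
    unfolding cinner_self[symmetric] cinner.sum_left cinner.sum_right
    by (simp add: cinner_scaleC_left cinner_scaleC_right cinner_basis)
  also have "\<dots> = of_real (\<Sum>i\<in>I. (cmod (a i))\<^sup>2)"
    unfolding of_real_sum complex_norm_square using assms by (simp add: if_distrib cong: if_cong)
  finally show ?thesis unfolding of_real_eq_iff .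
qed

text \<open>By Pythagoras for finite sums, square summability is the Cauchy criterion for the series
  of vectors.\<close>

lemma riesz_fischer:
  assumes "summable (\<lambda>m. (cmod (a m))\<^sup>2)"
  shows "\<exists>x. \<forall>m. cinner (h m) x = a m"
proof -
  have "summable (\<lambda>m. a m *\<^sub>C h m)"
    unfolding summable_Cauchy
  proof (intro allI impI)
    fix e :: real assume e: "0 < e"
    then obtain N where N: "\<And>m n. N \<le> m \<Longrightarrow> norm (\<Sum>i\<in>{m..<n}. (cmod (a i))\<^sup>2) < e\<^sup>2"
      using assms unfolding summable_Cauchy by (metis zero_less_power)
    have "norm (\<Sum>i\<in>{m..<n}. a i *\<^sub>C h i) < e" if "N \<le> m" for m n
    proof -
      have "(norm (\<Sum>i\<in>{m..<n}. a i *\<^sub>C h i))\<^sup>2 < e\<^sup>2"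
        using N[OF that, of n] by (simp add: norm_sum_basis sum_nonneg)
      then show ?thesis using e by (simp add: power2_less_imp_less)
    qed
    then show "\<exists>N. \<forall>m\<ge>N. \<forall>n. norm (\<Sum>i\<in>{m..<n}. a i *\<^sub>C h i) < e" by blast
  qed
  then obtain x where x: "(\<lambda>m. a m *\<^sub>C h m) sums x" unfolding summable_def by blast
  have "cinner (h m) x = a m" for m
  proof -
    have "(\<lambda>i. cinner (h m) (a i *\<^sub>C h i)) sums cinner (h m) x"
      by (rule bounded_linear.sums[OF cinner.bounded_linear_right x])
    moreover have "(\<lambda>i. cinner (h m) (a i *\<^sub>C h i)) = (\<lambda>i. if i = m then a m else 0)"
      by (auto simp: cinner_scaleC_right cinner_basis)
    ultimately show ?thesis using sums_single[of m "\<lambda>_. a m"] sums_unique2 by metis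
  qed
  then show ?thesis by blast
qed

text \<open>Coefficients determine a vector by \<open>coeff_eqI\<close>, and for bounded a the
  chosen y exists by \<open>riesz_fischer\<close>.\<close>

definition diag :: "(nat \<Rightarrow> real) \<Rightarrow> 'h \<Rightarrow> 'h" where
  "diag a x = (SOME y. \<forall>m. cinner (h m) y = of_real (a m) * cinner (h m) x)"

lemma summable_coeff_bounded:
  assumes "\<And>m. \<bar>a m\<bar> \<le> K"
  shows "summable (\<lambda>m. a m * (cmod (cinner (h m) x))\<^sup>2)"
proof (rule summable_comparison_test')
  show "summable (\<lambda>m. K * (cmod (cinner (h m) x))\<^sup>2)"
    using parseval_norm[of x] by (intro summable_mult) (rule sums_summable)
  show "norm (a m * (cmod (cinner (h m) x))\<^sup>2) \<le> K * (cmod (cinner (h m) x))\<^sup>2" for m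
    using assms[of m] by (simp add: abs_mult mult_right_mono)
qed

lemma coeff_diag:
  assumes "\<And>m. \<bar>a m\<bar> \<le> K"
  shows "cinner (h m) (diag a x) = of_real (a m) * cinner (h m) x"
proof -
  have "\<bar>(a m)\<^sup>2\<bar> \<le> K\<^sup>2" for m using power_mono[OF assms abs_ge_zero, of m 2] by simp
  then have "summable (\<lambda>m. (cmod (of_real (a m) * cinner (h m) x))\<^sup>2)"
    using summable_coeff_bounded[of "\<lambda>m. (a m)\<^sup>2" "K\<^sup>2" x] by (simp add: norm_mult power_mult_distrib)
  from riesz_fischer[OF this]
  have "\<forall>m. cinner (h m) (diag a x) = of_real (a m) * cinner (h m) x"
    unfolding diag_def by (rule someI_ex)
  then show ?thesis by blast
qed

lemma norm_diag_sums:
  assumes "\<And>m. \<bar>a m\<bar> \<le> K"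
  shows "(\<lambda>m. (a m)\<^sup>2 * (cmod (cinner (h m) x))\<^sup>2) sums (norm (diag a x))\<^sup>2"
  using parseval_norm[of "diag a x"] by (simp add: coeff_diag[OF assms] norm_mult power_mult_distrib)

lemma diag_bounded_clinear:
  assumes "\<And>m. \<bar>a m\<bar> \<le> K"
  shows "bounded_clinear (diag a)"
proof (rule bounded_clinear_intro[of _ K])
  note c = coeff_diag[OF assms]
  show "diag a (x + y) = diag a x + diag a y" for x y
    by (rule coeff_eqI) (simp add: c cinner_add_right distrib_left)
  show "diag a (z *\<^sub>C x) = z *\<^sub>C diag a x" for x z
    by (rule coeff_eqI) (simp add: c cinner_scaleC_right)
  have K: "0 \<le> K" using assms[of 0] by simp
  show "norm (diag a x) \<le> norm x * K" for x
  proof -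
    have "(norm (diag a x))\<^sup>2 \<le> K\<^sup>2 * (norm x)\<^sup>2"
    proof (rule sums_le[OF _ norm_diag_sums[OF assms] sums_mult[OF parseval_norm]])
      show "(a m)\<^sup>2 * (cmod (cinner (h m) x))\<^sup>2 \<le> K\<^sup>2 * (cmod (cinner (h m) x))\<^sup>2" for m
        using power_mono[OF assms abs_ge_zero, of m 2] by (intro mult_right_mono) auto
    qed
    then have "(norm (diag a x))\<^sup>2 \<le> (norm x * K)\<^sup>2" by (simp add: power_mult_distrib mult.commute)
    then show ?thesis using K by (simp add: power2_le_iff_abs_le)
  qed
qed

lemma diag_symmetric:
  assumes "\<And>m. \<bar>a m\<bar> \<le> K"
  shows "cinner (diag a x) y = cinner x (diag a y)"
proof -
  have "cinner (diag a x) (h m) = of_real (a m) * cinner x (h m)" for m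
    using cinner_commute[of "diag a x" "h m"] cinner_commute[of x "h m"]
    by (simp add: coeff_diag[OF assms])
  then have "(\<lambda>m. cinner x (h m) * cinner (h m) (diag a y)) sums cinner (diag a x) y"
    using parseval[of "diag a x" y] by (simp add: coeff_diag[OF assms] mult_ac)
  then show ?thesis using sums_unique2[OF _ parseval[of x "diag a y"]] by blast
qed

lemma diag_quadratic_form:
  assumes "\<And>m. \<bar>a m\<bar> \<le> K"
  shows "cinner x (diag a x) = of_real (\<Sum>m. a m * (cmod (cinner (h m) x))\<^sup>2)"
proof -
  have "cinner x (h m) * cinner (h m) (diag a x) = of_real (a m * (cmod (cinner (h m) x))\<^sup>2)" for m
    unfolding of_real_mult cinner_times_commute[symmetric] by (simp add: coeff_diag[OF assms] mult_ac)
  then have "(\<lambda>m. complex_of_real (a m * (cmod (cinner (h m) x))\<^sup>2)) sums cinner x (diag a x)"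
    using parseval[of x "diag a x"] by simp
  moreover have "(\<lambda>m. complex_of_real (a m * (cmod (cinner (h m) x))\<^sup>2))
      sums of_real (\<Sum>m. a m * (cmod (cinner (h m) x))\<^sup>2)"
    unfolding sums_of_real_iff by (rule summable_sums[OF summable_coeff_bounded[OF assms]])
  ultimately show ?thesis by (rule sums_unique2)
qed

text \<open>S x is assembled from its coefficients <T (h m), x>, whose square sums are controlled by
  the bound on T.\<close>

lemma adjoint_exists:
  fixes T :: "'h \<Rightarrow> 'h"
  assumes T: "bounded_clinear T"
  shows "\<exists>S. bounded_clinear S \<and> (\<forall>x y. cinner (S x) y = cinner x (T y))"
proof -
  obtain K where K: "0 < K" "\<And>x. norm (T x) \<le> norm x * K" using bounded_clinear_bound[OF T] by blast
  let ?c = "\<lambda>x m. cinner (T (h m)) x"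
  have part: "(\<Sum>m<n. (cmod (?c x m))\<^sup>2) \<le> (norm x * K)\<^sup>2" for n x
  proof -
    define q where "q = (\<Sum>m<n. (cmod (?c x m))\<^sup>2)"
    \<comment> \<open>The extremal test vector: its squared norm and <T z, x> both equal q, so q <=
      norm z * K * norm x can be divided by norm z.\<close>
    define z where "z = (\<Sum>m<n. ?c x m *\<^sub>C h m)"
    have "cinner (T z) x = of_real q"
      unfolding z_def q_def linear_sum[OF bounded_clinear_linear[OF T]] cinner.sum_left of_real_sum
        complex_norm_square
      by (simp add: bounded_clinear_scaleC[OF T] cinner_scaleC_left mult.commute)
    then have "\<bar>q\<bar> \<le> norm (T z) * norm x"
      using Cauchy_Schwarz_cinner[of "T z" x] by simp
    moreover have "(norm z)\<^sup>2 = q" unfolding z_def q_def by (rule norm_sum_basis) simp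
    moreover have "norm (T z) * norm x \<le> norm z * K * norm x"
      using K(2) by (intro mult_right_mono) auto
    ultimately have le: "norm z * norm z \<le> norm z * (norm x * K)"
      by (simp add: power2_eq_square mult_ac)
    have "norm z \<le> norm x * K"
    proof (cases "norm z = 0")
      case True
      then show ?thesis using K(1) by simp
    next
      case False
      then show ?thesis using le by (subst (asm) mult_le_cancel_left_pos) auto
    qed
    then show ?thesis using \<open>(norm z)\<^sup>2 = q\<close> power_mono[of "norm z" "norm x * K" 2] by (simp add: q_def)
  qed
  have "summable (\<lambda>m. (cmod (?c x m))\<^sup>2)" for x
    by (rule summableI_nonneg_bounded[OF _ part]) simp
  then have "\<exists>y. \<forall>m. cinner (h m) y = ?c x m" for x by (rule riesz_fischer)
  then obtain S where S: "\<And>x m. cinner (h m) (S x) = ?c x m" by metis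
  have "cinner (S x) y = cinner x (T y)" for x y
  proof -
    have "(\<lambda>m. cinner x (T (cinner (h m) y *\<^sub>C h m))) sums cinner x (T y)"
      by (intro bounded_linear.sums[OF cinner.bounded_linear_right]
          bounded_linear.sums[OF bounded_clinear_bounded_linear[OF T]] basis_expansion)
    moreover have "cinner x (T (cinner (h m) y *\<^sub>C h m)) = cinner (S x) (h m) * cinner (h m) y" for m
      using cinner_commute[of "S x" "h m"] cinner_commute[of x "T (h m)"]
      by (simp add: S bounded_clinear_scaleC[OF T] cinner_scaleC_right)
    ultimately have "(\<lambda>m. cinner (S x) (h m) * cinner (h m) y) sums cinner x (T y)" by simp
    then show ?thesis using sums_unique2[OF parseval[of "S x" y]] by blast
  qed
  moreover have "bounded_clinear S"
  proof (rule bounded_clinear_intro[of _ K])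
    show "S (x + y) = S x + S y" for x y by (rule coeff_eqI) (simp add: S cinner_add_right)
    show "S (c *\<^sub>C x) = c *\<^sub>C S x" for x c by (rule coeff_eqI) (simp add: S cinner_scaleC_right)
    show "norm (S x) \<le> norm x * K" for x
    proof -
      have s: "(\<lambda>m. (cmod (?c x m))\<^sup>2) sums (norm (S x))\<^sup>2"
        using parseval_norm[of "S x"] by (simp add: S)
      have "(norm (S x))\<^sup>2 \<le> (norm x * K)\<^sup>2"
        using suminf_le_const[OF sums_summable[OF s] part] sums_unique[OF s] by simp
      then show ?thesis using K by (simp add: power2_le_iff_abs_le)
    qed
  qed
  ultimately show ?thesis by blast
qed

text \<open>The equation \<open>cadjoint P = P\<close> concerns a described object; it becomes
  symmetry of the form once an adjoint is known to exist.\<close>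

lemma projection_op_symmetric:
  assumes "projection_op (P :: 'h \<Rightarrow> 'h)"
  shows "cinner (P x) y = cinner x (P y)"
proof -
  have P: "bounded_clinear P" "cadjoint P = P"
    using assms by (auto simp: projection_op_def selfadjoint_op_def)
  obtain S where S: "bounded_clinear S" "\<And>x y. cinner (S x) y = cinner x (P y)"
    using adjoint_exists[OF P(1)] by blast
  then have "S = P" using cadjoint_eqI[of S P] P(2) by simp
  then show ?thesis using S by simp
qed

lemma projection_op_bounded_clinear: "projection_op P \<Longrightarrow> bounded_clinear P"
  and projection_op_idem: "projection_op P \<Longrightarrow> P (P x) = P x"
  by (auto simp: projection_op_def selfadjoint_op_def fun_eq_iff)

lemma projection_op_quadratic:
  assumes "projection_op (P :: 'h \<Rightarrow> 'h)"
  shows "cinner x (P x) = of_real ((norm (P x))\<^sup>2)"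
  using projection_op_symmetric[OF assms, of x "P x"]
  by (simp only: projection_op_idem[OF assms] cinner_self[symmetric])

lemma projection_op_norm_le:
  assumes "projection_op (P :: 'h \<Rightarrow> 'h)"
  shows "norm (P x) \<le> norm x"
proof (cases "P x = 0")
  case False
  have "(norm (P x))\<^sup>2 \<le> norm x * norm (P x)"
    using Cauchy_Schwarz_cinner[of x "P x"] by (simp add: projection_op_quadratic[OF assms] norm_power)
  then show ?thesis using False by (simp add: power2_eq_square)
qed simp

section \<open>Projection-valued measures\<close>

context
  fixes P :: "'a::topological_space set \<Rightarrow> 'h \<Rightarrow> 'h"
  assumes P: "projection_valued_measure P"
begin

lemma pvm_projection: "B \<in> sets borel \<Longrightarrow> projection_op (P B)"
  and pvm_UNIV: "P UNIV x = x"
  and pvm_sums: "range F \<subseteq> sets borel \<Longrightarrow> disjoint_family F \<Longrightarrow> (\<lambda>j. P (F j) x) sums P (\<Union>j. F j) x"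
  using P by (auto simp: projection_valued_measure_def)

text \<open>The empty set is a countable disjoint union of copies of itself, and a constant series
  converges only if its term is 0.\<close>

lemma pvm_empty: "P {} x = 0"
proof -
  have "(\<lambda>j::nat. P {} x) sums P (\<Union>j::nat. {}) x"
    by (rule pvm_sums) (auto simp: disjoint_family_on_def)
  then have "(\<lambda>j::nat. P {} x) \<longlonglongrightarrow> 0" by (intro summable_LIMSEQ_zero sums_summable)
  then show ?thesis by (simp add: LIMSEQ_const_iff)
qed

lemma pvm_Un:
  assumes "B \<in> sets borel" "C \<in> sets borel" "B \<inter> C = {}"
  shows "P (B \<union> C) x = P B x + P C x"
proof -
  let ?F = "\<lambda>j::nat. if j = 0 then B else if j = 1 then C else {}"
  have "(\<lambda>j. P (?F j) x) sums P (\<Union>j. ?F j) x"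
    by (rule pvm_sums) (use assms in \<open>auto simp: disjoint_family_on_def\<close>)
  moreover have "(\<Union>j. ?F j) = B \<union> C" by (auto split: if_splits)
  moreover have "(\<lambda>j. P (?F j) x) sums (\<Sum>j\<in>{0,1}. P (?F j) x)"
    by (rule sums_finite) (auto simp: pvm_empty)
  ultimately show ?thesis using sums_unique2 by fastforce
qed

text \<open>For y = P C x, additivity makes the squared norm of the projection of y onto the union
  equal to that of P B y plus that of y, while a projection cannot increase the norm.\<close>

lemma pvm_disjoint:
  assumes B: "B \<in> sets borel" and C: "C \<in> sets borel" and BC: "B \<inter> C = {}"
  shows "P B (P C x) = 0"
proof -
  let ?y = "P C x"
  have "complex_of_real ((norm (P (B \<union> C) ?y))\<^sup>2) = of_real ((norm (P B ?y))\<^sup>2 + (norm (P C ?y))\<^sup>2)"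
    unfolding of_real_add projection_op_quadratic[OF pvm_projection[OF B], symmetric]
      projection_op_quadratic[OF pvm_projection[OF C], symmetric]
      projection_op_quadratic[OF pvm_projection[OF sets.Un[OF B C]], symmetric]
    by (simp only: pvm_Un[OF B C BC] cinner_add_right)
  then have "(norm (P (B \<union> C) ?y))\<^sup>2 = (norm (P B ?y))\<^sup>2 + (norm (P C ?y))\<^sup>2"
    unfolding of_real_eq_iff .
  moreover have "P C ?y = ?y" using projection_op_idem[OF pvm_projection[OF C]] by simp
  moreover have "(norm (P (B \<union> C) ?y))\<^sup>2 \<le> (norm ?y)\<^sup>2"
    using projection_op_norm_le[OF pvm_projection[of "B \<union> C"]] B C by (intro power_mono) auto
  ultimately show ?thesis by simp
qed

text \<open>Splitting C along B and B along C reduces multiplicativity to the disjoint case.\<close>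

lemma pvm_Int:
  assumes B: "B \<in> sets borel" and C: "C \<in> sets borel"
  shows "P B (P C x) = P (B \<inter> C) x"
proof -
  have "P C x = P (B \<inter> C \<union> (C - B)) x" by (rule arg_cong[of _ _ "\<lambda>S. P S x"]) blast
  also have "\<dots> = P (B \<inter> C) x + P (C - B) x" by (rule pvm_Un) (use B C in auto)
  finally have C': "P C x = P (B \<inter> C) x + P (C - B) x" .
  let ?y = "P (B \<inter> C) x"
  have "P B ?y = P (B \<inter> C \<union> (B - C)) ?y" by (rule arg_cong[of _ _ "\<lambda>S. P S ?y"]) blast
  also have "\<dots> = P (B \<inter> C) ?y + P (B - C) ?y" by (rule pvm_Un) (use B C in auto)
  also have "P (B - C) ?y = 0" by (rule pvm_disjoint) (use B C in auto)
  also have "P (B \<inter> C) ?y = ?y" by (rule projection_op_idem[OF pvm_projection]) (use B C in auto)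
  finally have "P B ?y = ?y" by simp
  moreover have "P B (P (C - B) x) = 0" by (rule pvm_disjoint) (use B C in auto)
  ultimately show ?thesis
    using bounded_clinear_add[OF projection_op_bounded_clinear[OF pvm_projection[OF B]]] C' by simp
qed

lemma space_ssm: "space (scalar_spectral_measure P x) = UNIV"
  and sets_ssm [measurable_cong]: "sets (scalar_spectral_measure P x) = sets borel"
  by (simp_all add: scalar_spectral_measure_def sets.space_closed
      sets.sigma_sets_eq[of borel, simplified space_borel])

lemma emeasure_ssm:
  assumes "B \<in> sets borel"
  shows "emeasure (scalar_spectral_measure P x) B = ennreal ((norm (P B x))\<^sup>2)"
proof -
  have Re: "Re (cinner x (P B x)) = (norm (P B x))\<^sup>2" if "B \<in> sets borel" for B
    by (simp add: projection_op_quadratic[OF pvm_projection[OF that]])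
  have sa: "sigma_algebra UNIV (sets (borel :: 'a measure))"
    using sets.sigma_algebra_axioms[of "borel :: 'a measure"] by simp
  have "emeasure (scalar_spectral_measure P x) B = ennreal (Re (cinner x (P B x)))"
    unfolding scalar_spectral_measure_def
  proof (rule emeasure_measure_of_sigma[OF sa _ _ assms])
    show "positive (sets borel) (\<lambda>B. ennreal (Re (cinner x (P B x))))"
      by (simp add: positive_def pvm_empty cinner.zero_right)
    show "countably_additive (sets borel) (\<lambda>B. ennreal (Re (cinner x (P B x))))"
    proof (rule countably_additiveI)
      fix F :: "nat \<Rightarrow> 'a set" assume F: "range F \<subseteq> sets borel" "disjoint_family F"
      have "(\<lambda>j. Re (cinner x (P (F j) x))) sums Re (cinner x (P (\<Union>j. F j) x))"
        by (intro sums_Re bounded_linear.sums[OF cinner.bounded_linear_right] pvm_sums F)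
      moreover have "0 \<le> Re (cinner x (P (F j) x))" for j using F(1) Re[of "F j"] by auto
      ultimately show "(\<Sum>j. ennreal (Re (cinner x (P (F j) x)))) = ennreal (Re (cinner x (P (\<Union>j. F j) x)))"
        by (subst suminf_ennreal2) (auto simp: sums_iff)
    qed
  qed
  then show ?thesis using Re[OF assms] by simp
qed

lemma finite_measure_ssm: "finite_measure (scalar_spectral_measure P x)"
  by (rule finite_measureI) (simp add: space_ssm emeasure_ssm)

lemma ssm_eqI:
  assumes "\<And>B. B \<in> sets borel \<Longrightarrow> norm (P B x) = norm (P B y)"
  shows "scalar_spectral_measure P x = scalar_spectral_measure P y"
  by (rule measure_eqI) (simp_all add: sets_ssm emeasure_ssm assms)

lemma ssm_restrict:
  assumes B: "B \<in> sets borel"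
  shows "scalar_spectral_measure P (P B x)
    = density (scalar_spectral_measure P x) (\<lambda>t. ennreal (indicator B t))"
proof (rule measure_eqI)
  fix C assume "C \<in> sets (scalar_spectral_measure P (P B x))"
  then have C: "C \<in> sets borel" by (simp add: sets_ssm)
  have "emeasure (density (scalar_spectral_measure P x) (\<lambda>t. ennreal (indicator B t))) C
      = (\<integral>\<^sup>+t. ennreal (indicator B t) * indicator C t \<partial>scalar_spectral_measure P x)"
    by (rule emeasure_density) (use B C in \<open>auto simp: sets_ssm\<close>)
  also have "\<dots> = (\<integral>\<^sup>+t. indicator (B \<inter> C) t \<partial>scalar_spectral_measure P x)"
    by (rule nn_integral_cong) (auto simp: indicator_def)
  also have "\<dots> = emeasure (scalar_spectral_measure P x) (B \<inter> C)"
    using B C by (intro nn_integral_indicator) (auto simp: sets_ssm)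
  finally show "emeasure (scalar_spectral_measure P (P B x)) C
      = emeasure (density (scalar_spectral_measure P x) (\<lambda>t. ennreal (indicator B t))) C"
    using B C by (simp add: emeasure_ssm pvm_Int Int_commute)
qed (simp add: sets_ssm)

end

end

section \<open>The Borel functional calculus of a diagonal operator\<close>

locale diagonal_operator = hilbert_basis h
  for h :: "nat \<Rightarrow> 'h::chilbert_space" +
  fixes dm :: "'h set" and D :: "'h \<Rightarrow> 'h" and ev :: "nat \<Rightarrow> real"
  assumes selfadjoint: "selfadjoint_unbounded dm D"
    and eigenvector: "\<And>m. h m \<in> dm \<and> D (h m) = ev m *\<^sub>R h m"
begin

lemma dm_add: "x \<in> dm \<Longrightarrow> y \<in> dm \<Longrightarrow> x + y \<in> dm"
  and D_add: "x \<in> dm \<Longrightarrow> y \<in> dm \<Longrightarrow> D (x + y) = D x + D y"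
  and dm_scale: "x \<in> dm \<Longrightarrow> c *\<^sub>C x \<in> dm"
  and D_scale: "x \<in> dm \<Longrightarrow> D (c *\<^sub>C x) = c *\<^sub>C D x"
  using selfadjoint by (auto simp: selfadjoint_unbounded_def)

lemma D_adjoint: "(\<forall>x\<in>dm. cinner y (D x) = cinner z x) \<longleftrightarrow> y \<in> dm \<and> D y = z"
  using selfadjoint unfolding selfadjoint_unbounded_def by blast

lemma D_symmetric: "x \<in> dm \<Longrightarrow> y \<in> dm \<Longrightarrow> cinner y (D x) = cinner (D y) x"
  using D_adjoint[of y "D y"] by blast

lemma coeff_D: "x \<in> dm \<Longrightarrow> cinner (h m) (D x) = ev m *\<^sub>R cinner (h m) x"
  using D_symmetric[of x "h m"] eigenvector[of m] by (simp add: cinner_scaleR_left)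

definition spectral_proj :: "real set \<Rightarrow> 'h \<Rightarrow> 'h" where
  "spectral_proj B = diag (\<lambda>m. indicator B (ev m))"

lemma indicator_ev_le: "\<bar>indicator B (ev m) :: real\<bar> \<le> 1"
  by (simp add: indicator_def)

lemma coeff_spectral_proj:
  "cinner (h m) (spectral_proj B x) = of_real (indicator B (ev m)) * cinner (h m) x"
  unfolding spectral_proj_def by (rule coeff_diag[OF indicator_ev_le])

lemma norm_spectral_proj_sums:
  "(\<lambda>m. indicator B (ev m) * (cmod (cinner (h m) x))\<^sup>2) sums (norm (spectral_proj B x))\<^sup>2"
proof -
  have "(indicator B t :: real)\<^sup>2 = indicator B t" for t by (simp add: indicator_def)
  then show ?thesis
    using norm_diag_sums[of "\<lambda>m. indicator B (ev m)" 1 x, OF indicator_ev_le]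
    by (simp add: spectral_proj_def)
qed

lemma projection_op_spectral_proj: "projection_op (spectral_proj B)"
proof (rule projection_opI)
  show "bounded_clinear (spectral_proj B)"
    unfolding spectral_proj_def by (rule diag_bounded_clinear[OF indicator_ev_le])
  show "cinner (spectral_proj B x) y = cinner x (spectral_proj B y)" for x y
    unfolding spectral_proj_def by (rule diag_symmetric[OF indicator_ev_le])
  show "spectral_proj B (spectral_proj B x) = spectral_proj B x" for x
    by (rule coeff_eqI) (simp add: coeff_spectral_proj indicator_def)
qed

lemma spectral_proj_pvm: "projection_valued_measure spectral_proj"
  unfolding projection_valued_measure_def
proof (intro conjI ballI allI impI)
  show "projection_op (spectral_proj B)" for B by (rule projection_op_spectral_proj)
  show "spectral_proj UNIV = id"
    by (intro ext coeff_eqI) (simp add: coeff_spectral_proj)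
  fix B :: "nat \<Rightarrow> real set" and x :: 'h
  assume "range B \<subseteq> sets borel \<and> disjoint_family B"
  then have disj: "disjoint_family B" by simp
  define R where "R = (\<lambda>n. \<Union>j\<in>{n..}. B j)"
  have split: "spectral_proj (R n) x - spectral_proj (R (Suc n)) x = spectral_proj (B n) x" for n
  proof -
    have "R n = B n \<union> R (Suc n)" unfolding R_def by (rule UN_tail_Suc)
    moreover have "B n \<inter> R (Suc n) = {}" unfolding R_def by (rule disjoint_family_tail[OF disj])
    ultimately show ?thesis
      by (intro coeff_eqI) (auto simp: coeff_spectral_proj cinner.diff_right indicator_def)
  qed
  let ?f = "\<lambda>m n. indicator (R n) (ev m) * (cmod (cinner (h m) x))\<^sup>2"
  \<comment> \<open>Dominated convergence for series: the Parseval series of x is the majorant, and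
    each eigenvalue leaves the tails eventually.\<close>
  have "(\<lambda>n. \<Sum>m. ?f m n) \<longlonglongrightarrow> (\<Sum>m. 0 :: real)"
  proof (rule tannerys_theorem[THEN conjunct2, THEN conjunct2])
    show "(\<lambda>n. ?f m n) \<longlonglongrightarrow> 0" for m
    proof -
      have "eventually (\<lambda>n. ?f m n = 0) sequentially"
        using eventually_not_in_tail[OF disj, of "ev m"] by eventually_elim (simp add: R_def)
      then show ?thesis by (rule tendsto_eventually)
    qed
    show "summable (\<lambda>m. (cmod (cinner (h m) x))\<^sup>2)" by (rule sums_summable[OF parseval_norm])
    show "\<forall>\<^sub>F (m, n) in sequentially \<times>\<^sub>F sequentially. norm (?f m n) \<le> (cmod (cinner (h m) x))\<^sup>2"
      by (rule always_eventually) (auto simp: indicator_def)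
  qed simp
  then have "(\<lambda>n. (norm (spectral_proj (R n) x))\<^sup>2) \<longlonglongrightarrow> 0"
    using sums_unique[OF norm_spectral_proj_sums] by simp
  then have "(\<lambda>n. spectral_proj (R n) x) \<longlonglongrightarrow> 0" by (rule tendsto_zero_if_norm_squared)
  from telescope_sums'[OF this]
  have "(\<lambda>n. spectral_proj (R n) x - spectral_proj (R (Suc n)) x) sums spectral_proj (\<Union>j. B j) x"
    by (simp add: R_def)
  then show "(\<lambda>j. spectral_proj (B j) x) sums spectral_proj (\<Union>j. B j) x" by (simp add: split)
qed

text \<open>Agreement is demanded on Borel sets only, because this is all that determines a spectral
  measure. The results then apply to \<open>spectral_proj\<close> and to any competitor.\<close>

context
  fixes P :: "real set \<Rightarrow> 'h \<Rightarrow> 'h"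
  assumes P: "projection_valued_measure P"
    and P_eq: "\<And>B. B \<in> sets borel \<Longrightarrow> P B = spectral_proj B"
begin

text \<open>The measure is discrete: the squared coefficients of x are weights on the indices,
  transported by \<open>ev\<close>, so that equal eigenvalues accumulate. Integrals become
  series.\<close>

lemma ssm_eq_distr:
  "scalar_spectral_measure P x
    = distr (density (count_space UNIV) (\<lambda>m. ennreal ((cmod (cinner (h m) x))\<^sup>2))) borel ev"
proof (rule measure_eqI)
  fix B assume "B \<in> sets (scalar_spectral_measure P x)"
  then have B: "B \<in> sets borel" by (simp add: sets_ssm[OF P])
  let ?N = "density (count_space UNIV) (\<lambda>m. ennreal ((cmod (cinner (h m) x))\<^sup>2))"
  have "emeasure (distr ?N borel ev) B = emeasure ?N (ev -` B)"
    using B by (subst emeasure_distr) auto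
  also have "\<dots> = (\<integral>\<^sup>+m. ennreal ((cmod (cinner (h m) x))\<^sup>2) * indicator (ev -` B) m \<partial>count_space UNIV)"
    by (rule emeasure_density) auto
  also have "\<dots> = (\<integral>\<^sup>+m. ennreal (indicator B (ev m) * (cmod (cinner (h m) x))\<^sup>2) \<partial>count_space UNIV)"
    by (rule nn_integral_cong) (auto simp: indicator_def)
  also have "\<dots> = ennreal ((norm (P B x))\<^sup>2)"
    unfolding nn_integral_count_space_nat P_eq[OF B]
    using norm_spectral_proj_sums[of B x]
    by (subst suminf_ennreal2) (auto simp: sums_iff)
  also have "\<dots> = emeasure (scalar_spectral_measure P x) B" by (rule emeasure_ssm[OF P B, symmetric])
  finally show "emeasure (scalar_spectral_measure P x) B = emeasure (distr ?N borel ev) B" ..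
qed (simp add: sets_ssm[OF P])

lemma
  fixes f :: "real \<Rightarrow> 'b::{banach,second_countable_topology}"
  assumes f: "f \<in> borel_measurable borel"
  shows integrable_ssm_iff: "integrable (scalar_spectral_measure P x) f
      \<longleftrightarrow> summable (\<lambda>m. norm ((cmod (cinner (h m) x))\<^sup>2 *\<^sub>R f (ev m)))" (is ?A)
    and integral_ssm: "integrable (scalar_spectral_measure P x) f \<Longrightarrow>
      integral\<^sup>L (scalar_spectral_measure P x) f = (\<Sum>m. (cmod (cinner (h m) x))\<^sup>2 *\<^sub>R f (ev m))" (is "_ \<Longrightarrow> ?B")
proof -
  have i: "integrable (scalar_spectral_measure P x) f
      \<longleftrightarrow> integrable (count_space UNIV) (\<lambda>m. (cmod (cinner (h m) x))\<^sup>2 *\<^sub>R f (ev m))"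
    unfolding ssm_eq_distr using f
    by (subst integrable_distr_eq) (auto simp: integrable_density)
  show ?A unfolding i by (rule integrable_count_space_nat_iff)
  assume "integrable (scalar_spectral_measure P x) f"
  then have "integrable (count_space UNIV) (\<lambda>m. (cmod (cinner (h m) x))\<^sup>2 *\<^sub>R f (ev m))"
    unfolding i .
  from integral_count_space_nat[OF this] show ?B
    unfolding ssm_eq_distr using f
    by (subst integral_distr) (auto simp: integral_density)
qed

lemma spectral_integral_eq_diag:
  assumes G: "G \<in> borel_measurable borel" and K: "\<And>t. \<bar>G t\<bar> \<le> K"
  shows "spectral_integral P (\<lambda>t. complex_of_real (G t)) = diag (\<lambda>m. G (ev m))"
proof -
  have quad: "(LINT t|scalar_spectral_measure P x. complex_of_real (G t)) = cinner x (diag (\<lambda>m. G (ev m)) x)" for x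
  proof -
    have "summable (\<lambda>m. norm ((cmod (cinner (h m) x))\<^sup>2 *\<^sub>R G (ev m)))"
      using summable_coeff_bounded[of "\<lambda>m. \<bar>G (ev m)\<bar>" K x] K by (simp add: abs_mult mult.commute)
    then have "integrable (scalar_spectral_measure P x) G" using integrable_ssm_iff[OF G] by blast
    from integral_ssm[OF G this] show ?thesis
      using diag_quadratic_form[of "\<lambda>m. G (ev m)" K x] K by (simp add: integral_complex_of_real mult.commute)
  qed
  have bc: "bounded_clinear (diag (\<lambda>m. G (ev m)))" using K by (rule diag_bounded_clinear)
  show ?thesis
    unfolding spectral_integral_def quad
    by (rule the_equality) (use bc quadratic_form_eqI in auto)
qed

end

section \<open>The domain of D, uniqueness of its spectral measure, and G(D)\<close>

lemma mem_dm_iff: "x \<in> dm \<longleftrightarrow> summable (\<lambda>m. (ev m)\<^sup>2 * (cmod (cinner (h m) x))\<^sup>2)"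
proof
  assume x: "x \<in> dm"
  have "(cmod (cinner (h m) (D x)))\<^sup>2 = (ev m)\<^sup>2 * (cmod (cinner (h m) x))\<^sup>2" for m
    by (simp add: coeff_D[OF x] power_mult_distrib)
  then show "summable (\<lambda>m. (ev m)\<^sup>2 * (cmod (cinner (h m) x))\<^sup>2)"
    using sums_summable[OF parseval_norm[of "D x"]] by simp
next
  assume s: "summable (\<lambda>m. (ev m)\<^sup>2 * (cmod (cinner (h m) x))\<^sup>2)"
  have "summable (\<lambda>m. (cmod (of_real (ev m) * cinner (h m) x))\<^sup>2)"
    using s by (simp add: norm_mult power_mult_distrib)
  \<comment> \<open>z is the candidate for D x; x belongs to the domain because D is its own
    adjoint.\<close>
  then obtain z where z: "\<And>m. cinner (h m) z = of_real (ev m) * cinner (h m) x"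
    using riesz_fischer by metis
  have z': "cinner z (h m) = of_real (ev m) * cinner x (h m)" for m
    using cinner_commute[of z "h m"] cinner_commute[of x "h m"] by (simp add: z)
  have "cinner x (D w) = cinner z w" if w: "w \<in> dm" for w
  proof -
    have "(\<lambda>m. cinner z (h m) * cinner (h m) w) sums cinner x (D w)"
      using parseval[of x "D w"] by (simp add: coeff_D[OF w] z' scaleR_conv_of_real mult_ac)
    then show ?thesis using sums_unique2[OF parseval[of z w]] by metis
  qed
  then show "x \<in> dm" using D_adjoint by blast
qed

lemma spectral_proj_spectral_measure: "spectral_measure_of dm D spectral_proj"
  unfolding spectral_measure_of_def
proof (intro conjI ballI)
  note i = integrable_ssm_iff[OF spectral_proj_pvm refl] and I = integral_ssm[OF spectral_proj_pvm refl]
  show "projection_valued_measure spectral_proj" by (rule spectral_proj_pvm)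
  show "dm = {x. integrable (scalar_spectral_measure spectral_proj x) (\<lambda>t. t\<^sup>2)}"
    by (auto simp: i mem_dm_iff mult.commute)
  fix x assume x: "x \<in> dm"
  have "summable (\<lambda>m. norm ((cmod (cinner (h m) x))\<^sup>2 *\<^sub>R ev m))"
  proof (rule summable_comparison_test')
    show "summable (\<lambda>m. (cmod (cinner (h m) x))\<^sup>2 + (ev m)\<^sup>2 * (cmod (cinner (h m) x))\<^sup>2)"
      by (intro summable_add sums_summable[OF parseval_norm] mem_dm_iff[THEN iffD1, OF x])
    show "norm (norm ((cmod (cinner (h m) x))\<^sup>2 *\<^sub>R ev m))
        \<le> (cmod (cinner (h m) x))\<^sup>2 + (ev m)\<^sup>2 * (cmod (cinner (h m) x))\<^sup>2" for m
    proof -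
      \<comment> \<open>Integrability follows from square integrability through |t| <= 1 +
        t^2.\<close>
      have "0 \<le> (\<bar>ev m\<bar> - 1)\<^sup>2" by simp
      then have "2 * \<bar>ev m\<bar> \<le> 1 + (ev m)\<^sup>2" by (simp add: power2_diff)
      then have "\<bar>ev m\<bar> \<le> 1 + (ev m)\<^sup>2" using abs_ge_zero[of "ev m"] by linarith
      from mult_right_mono[OF this, of "(cmod (cinner (h m) x))\<^sup>2"] show ?thesis
        by (simp add: abs_mult algebra_simps)
    qed
  qed
  then have int: "integrable (scalar_spectral_measure spectral_proj x) (\<lambda>t. t)" by (simp add: i)
  have "cinner x (h m) * cinner (h m) (D x) = of_real ((cmod (cinner (h m) x))\<^sup>2 * ev m)" for m
    unfolding of_real_mult cinner_times_commute[symmetric]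
    by (simp add: coeff_D[OF x] scaleR_conv_of_real mult_ac)
  then have "(\<lambda>m. complex_of_real ((cmod (cinner (h m) x))\<^sup>2 * ev m)) sums cinner x (D x)"
    using parseval[of x "D x"] by simp
  moreover have "(\<lambda>m. complex_of_real ((cmod (cinner (h m) x))\<^sup>2 * ev m))
      sums of_real (\<Sum>m. (cmod (cinner (h m) x))\<^sup>2 * ev m)"
    unfolding sums_of_real_iff using int by (intro summable_sums) (simp add: i summable_norm_cancel)
  ultimately have "cinner x (D x) = of_real (\<Sum>m. (cmod (cinner (h m) x))\<^sup>2 * ev m)" by (rule sums_unique2)
  then show "cinner x (D x) = complex_of_real (LINT t|scalar_spectral_measure spectral_proj x. t)"
    using I[OF _ int] by simp
qed

text \<open>All vectors \<open>P B x + c P (- B) x\<close> with \<open>\<bar>c\<bar> = 1\<close> have the same scalar spectral measure as \<open>x\<close>;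
  so \<open>P B x\<close> and \<open>P (- B) x\<close> are orthogonal for the form of \<open>D\<close>.\<close>

lemma spectral_measure_eigenvector:
  assumes P: "spectral_measure_of dm D P" and x: "x \<in> dm" "D x = l *\<^sub>R x"
  shows "P {l} x = x"
proof -
  have pvm: "projection_valued_measure P"
    and dm: "\<And>y. y \<in> dm \<longleftrightarrow> integrable (scalar_spectral_measure P y) (\<lambda>t. t\<^sup>2)"
    and form: "\<And>y. y \<in> dm \<Longrightarrow> cinner y (D y) = complex_of_real (LINT t|scalar_spectral_measure P y. t)"
    using P by (auto simp: spectral_measure_of_def)
  note proj = pvm_projection[OF pvm]
  let ?\<mu> = "scalar_spectral_measure P x"
  interpret finite_measure ?\<mu> by (rule finite_measure_ssm[OF pvm])
  have sq: "integrable ?\<mu> (\<lambda>t. t\<^sup>2)" using x(1) dm by blast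
  have id: "integrable ?\<mu> (\<lambda>t. t)"
  proof (rule Bochner_Integration.integrable_bound)
    show "integrable ?\<mu> (\<lambda>t. 1 + t\<^sup>2)" using sq by simp
    have "\<bar>t\<bar> \<le> 1 + t\<^sup>2" for t :: real
      using zero_le_power2[of "\<bar>t\<bar> - 1"] abs_ge_zero[of t] by (simp add: power2_diff del: abs_ge_zero zero_le_power2)
    then show "AE t in ?\<mu>. norm t \<le> norm (1 + t\<^sup>2)" by (intro AE_I2) (simp add: abs_of_nonneg)
    show "(\<lambda>t. t) \<in> borel_measurable ?\<mu>" by (simp add: measurable_cong_sets[OF sets_ssm[OF pvm] refl])
  qed
  \<comment> \<open>The signed measure with density t - l vanishes on every Borel set, which forces
    the spectral measure of x to be concentrated at l.\<close>
  have main: "(LINT t|?\<mu>. indicator B t * (t - l)) = 0" if B: "B \<in> sets borel" for B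
  proof -
    have nB: "- B \<in> sets borel" using B by (simp add: sets.compl_sets[of B borel, simplified] Compl_eq_Diff_UNIV)
    define u v where "u = P B x" and "v = P (- B) x"
    have xuv: "x = u + v"
      using pvm_Un[OF pvm B nB, of x] pvm_UNIV[OF pvm, of x] by (simp add: u_def v_def)
    have same: "scalar_spectral_measure P (u + c *\<^sub>C v) = ?\<mu>" if c: "cmod c = 1" for c
    proof (rule ssm_eqI[OF pvm])
      fix C :: "real set" assume C: "C \<in> sets borel"
      note bcC = projection_op_bounded_clinear[OF proj[OF C]]
      define a b where "a = P (C \<inter> B) x" and "b = P (C \<inter> - B) x"
      have "cinner a b = cinner x (P (C \<inter> B) (P (C \<inter> - B) x))"
        unfolding a_def b_def by (rule projection_op_symmetric[OF proj]) (use B C in auto)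
      also have "P (C \<inter> B) (P (C \<inter> - B) x) = 0"
        by (rule pvm_disjoint[OF pvm]) (use B nB C in auto)
      finally have ab: "cinner a b = 0" by (simp add: cinner.zero_right)
      then have ba: "cinner b a = 0" using cinner_commute[of b a] by simp
      have n: "complex_of_real ((norm (a + c *\<^sub>C b))\<^sup>2) = of_real ((norm a)\<^sup>2 + (norm b)\<^sup>2)"
        if "cmod c = 1" for c
      proof -
        have "c * cnj c = 1" using complex_norm_square[of c] that by simp
        then have "cinner (a + c *\<^sub>C b) (a + c *\<^sub>C b) = cinner a a + cinner b b"
          using ab ba by (simp add: cinner_add_left cinner_add_right cinner_scaleC_left cinner_scaleC_right
              flip: mult.assoc)
        then show ?thesis by (simp only: cinner_self of_real_add)
      qed
      have "P C (u + c *\<^sub>C v) = a + c *\<^sub>C b" and "P C x = a + 1 *\<^sub>C b"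
        using pvm_Int[OF pvm C B] pvm_Int[OF pvm C nB] bounded_clinear_add[OF bcC, of u v, folded xuv]
        by (simp_all add: bounded_clinear_add[OF bcC] bounded_clinear_scaleC[OF bcC] u_def v_def a_def b_def)
      then have "complex_of_real ((norm (P C (u + c *\<^sub>C v)))\<^sup>2) = of_real ((norm (P C x))\<^sup>2)"
        using n[OF c] n[of 1] by simp
      then show "norm (P C (u + c *\<^sub>C v)) = norm (P C x)" unfolding of_real_eq_iff by simp
    qed
    have mem: "u + c *\<^sub>C v \<in> dm" if "cmod c = 1" for c
      using same[OF that] sq dm by simp
    \<comment> \<open>u - v has the spectral measure of x, hence lies in the domain; u and v are
      half the sum and half the difference of x and u - v.\<close>
    have "u - v \<in> dm" using mem[of "- 1"] by (simp add: scaleC_minus_left)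
    then have "(1 / 2) *\<^sub>C (x + (u - v)) \<in> dm" "(1 / 2) *\<^sub>C (x + (- 1) *\<^sub>C (u - v)) \<in> dm"
      using x(1) dm_add dm_scale by blast+
    moreover have "(1 / 2) *\<^sub>C (x + (u - v)) = u" "(1 / 2) *\<^sub>C (x + (- 1) *\<^sub>C (u - v)) = v"
      using scaleC_of_real[of "1/2" "2 *\<^sub>R u"] scaleC_of_real[of "1/2" "2 *\<^sub>R v"] by (simp_all add: xuv scaleC_minus_left flip: scaleR_2)
    ultimately have u: "u \<in> dm" and v: "v \<in> dm" by simp_all
    let ?I = "complex_of_real (LINT t|?\<mu>. t)"
    have q: "cinner u (D u) + c * cinner u (D v) + cnj c * cinner v (D u) + c * cnj c * cinner v (D v) = ?I"
      if "cmod c = 1" for c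
    proof -
      have "cinner (u + c *\<^sub>C v) (D (u + c *\<^sub>C v)) = ?I"
        using form[OF mem[OF that]] same[OF that] by simp
      then show ?thesis
        using u v dm_scale
        by (simp add: D_add D_scale cinner_add_left cinner_add_right cinner_scaleC_left cinner_scaleC_right
            algebra_simps)
    qed
    \<comment> \<open>For the cross terms b and b', the values 1 and -1 of c give b + b' = 0, and
      \<i> and -\<i> give b = b'.\<close>
    have "cinner u (D v) = 0"
      using q[of 1] q[of "- 1"] q[of \<i>] q[of "- \<i>"] by (simp add: complex_eq_iff)
    then have "cinner u (D u) = cinner u (D x)"
      unfolding xuv using u v by (simp add: D_add cinner_add_right)
    also have "\<dots> = of_real (l * (norm u)\<^sup>2)"
      using projection_op_quadratic[OF proj[OF B], of x] projection_op_symmetric[OF proj[OF B], of x x]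
      by (simp add: x(2) cinner_scaleR_right u_def scaleR_conv_of_real)
    also have "cinner u (D u) = of_real (LINT t|scalar_spectral_measure P u. t)" by (rule form[OF u])
    finally have "(LINT t|scalar_spectral_measure P u. t) = l * (norm u)\<^sup>2" unfolding of_real_eq_iff .
    moreover have "(LINT t|scalar_spectral_measure P u. t) = (LINT t|?\<mu>. indicator B t * t)"
      unfolding u_def ssm_restrict[OF pvm B]
      by (subst integral_density)
        (use B in \<open>auto simp: measurable_cong_sets[OF sets_ssm[OF pvm] refl]\<close>)
    moreover have "(norm u)\<^sup>2 = (LINT t|?\<mu>. indicator B t)"
      using B emeasure_ssm[OF pvm B, of x] by (simp add: u_def measure_def sets_ssm[OF pvm] space_ssm[OF pvm])
    moreover have Bs: "B \<in> sets ?\<mu>" using B by (simp add: sets_ssm[OF pvm])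
    then have "integrable ?\<mu> (\<lambda>t. indicator B t * t)"
      using integrable_mult_indicator[OF Bs id] by simp
    moreover have "integrable ?\<mu> (\<lambda>t. indicator B t * l)"
      using Bs by (intro integrable_mult_left) (simp add: emeasure_eq_measure)
    ultimately show ?thesis by (simp add: right_diff_distrib)
  qed
  \<comment> \<open>The sign s treats the sets above and below l alike: a nonnegative function with
    integral 0 vanishes almost everywhere.\<close>
  have zero: "P B x = 0" if B: "B \<in> sets borel" and sign: "s = 1 \<or> s = - 1"
    and pos: "\<And>t. t \<in> B \<Longrightarrow> 0 < s * (t - l)" for B and s :: real
  proof -
    have Bs: "B \<in> sets ?\<mu>" using B by (simp add: sets_ssm[OF pvm])
    have int: "integrable ?\<mu> (\<lambda>t. s * (indicator B t * (t - l)))"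
      using integrable_mult_indicator[OF Bs, of "\<lambda>t. t - l"] id by simp
    have nn: "0 \<le> s * (indicator B t * (t - l))" for t
      using pos[of t] by (auto simp: indicator_def)
    have "(LINT t|?\<mu>. s * (indicator B t * (t - l))) = 0" using main[OF B] by simp
    then have "AE t in ?\<mu>. s * (indicator B t * (t - l)) = 0"
      using integral_nonneg_eq_0_iff_AE[OF int AE_I2] nn by simp
    then have "AE t in ?\<mu>. t \<notin> B"
      by eventually_elim (use pos in \<open>force simp: indicator_def\<close>)
    then have "emeasure ?\<mu> B = 0" using Bs AE_iff_null_sets[OF Bs] by (auto simp: null_sets_def)
    then show ?thesis by (simp add: emeasure_ssm[OF pvm B])
  qed
  have "P UNIV x = P ({l} \<union> ({..<l} \<union> {l<..})) x"
    by (rule arg_cong[of _ _ "\<lambda>S. P S x"]) auto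
  also have "\<dots> = P {l} x + P ({..<l} \<union> {l<..}) x" by (rule pvm_Un[OF pvm]) auto
  also have "P ({..<l} \<union> {l<..}) x = P {..<l} x + P {l<..} x" by (rule pvm_Un[OF pvm]) auto
  also have "P {..<l} x = 0" by (rule zero[of _ "- 1"]) auto
  also have "P {l<..} x = 0" by (rule zero[of _ 1]) auto
  finally show ?thesis by (simp add: pvm_UNIV[OF pvm])
qed

text \<open>P {ev m} fixes h m, so P B either keeps or kills h m; symmetry of P B transfers this to
  the coefficients of every vector.\<close>

lemma spectral_measure_unique:
  assumes P: "spectral_measure_of dm D P" and B: "B \<in> sets borel"
  shows "P B = spectral_proj B"
proof
  fix x
  have pvm: "projection_valued_measure P" using P by (simp add: spectral_measure_of_def)
  note proj = pvm_projection[OF pvm B]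
  show "P B x = spectral_proj B x"
  proof (rule coeff_eqI)
    fix m
    have "P {ev m} (h m) = h m"
      by (rule spectral_measure_eigenvector[OF P]) (use eigenvector in auto)
    then have "P B (h m) = P (B \<inter> {ev m}) (h m)"
      using pvm_Int[OF pvm B, of "{ev m}" "h m"] by simp
    also have "\<dots> = (if ev m \<in> B then h m else 0)"
      using \<open>P {ev m} (h m) = h m\<close> by (auto simp: pvm_empty[OF pvm] Int_absorb1)
    finally have "P B (h m) = (if ev m \<in> B then h m else 0)" .
    then show "cinner (h m) (P B x) = cinner (h m) (spectral_proj B x)"
      using projection_op_symmetric[OF proj, of "h m" x]
      by (simp add: coeff_spectral_proj indicator_def cinner.zero_left split: if_splits)
  qed
qed

lemma borel_calculus_eq_diag:
  assumes G: "G \<in> borel_measurable borel" and K: "\<And>t. \<bar>G t\<bar> \<le> K"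
  shows "borel_calculus dm D G = diag (\<lambda>m. G (ev m))"
proof -
  have eq: "spectral_integral P (\<lambda>t. complex_of_real (G t)) = diag (\<lambda>m. G (ev m))"
    if P: "spectral_measure_of dm D P" for P
  proof -
    have "projection_valued_measure P" using P by (simp add: spectral_measure_of_def)
    from spectral_integral_eq_diag[OF this spectral_measure_unique[OF P] G K] show ?thesis .
  qed
  show ?thesis
    unfolding borel_calculus_def
    by (rule the_equality) (use eq spectral_proj_spectral_measure in \<open>auto intro: exI[of _ spectral_proj]\<close>)
qed

end

section \<open>Power sums and logarithmic averages\<close>

text \<open>Convexity of t powr (1 + s): the tangent at x lies below the graph at b. Young's
  inequality with exponents (1 + s) / s and 1 + s covers the boundary value 0 too. It serves
  majorization, Jensen's inequality and the power mean.\<close>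

lemma powr_tangent_le:
  fixes x b s :: real
  assumes x: "0 \<le> x" and b: "0 \<le> b" and s: "0 < s"
  shows "x powr (1 + s) - b powr (1 + s) \<le> (1 + s) * x powr s * (x - b)"
proof -
  have "x powr s * b \<le> (x powr s) powr ((1 + s) / s) / ((1 + s) / s) + b powr (1 + s) / (1 + s)"
    by (rule Youngs_inequality) (use b s in \<open>auto simp: field_simps\<close>)
  also have "(x powr s) powr ((1 + s) / s) = x powr (1 + s)" using s by (simp add: powr_powr)
  finally have "(1 + s) * (x powr s * b)
      \<le> (1 + s) * (x powr (1 + s) / ((1 + s) / s) + b powr (1 + s) / (1 + s))"
    using s by (intro mult_left_mono) auto
  also have "\<dots> = s * x powr (1 + s) + b powr (1 + s)"
  proof -
    have "1 + s \<noteq> 0" using s by simp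
    then show ?thesis by (simp add: distrib_left)
  qed
  finally have "(1 + s) * x powr s * b \<le> s * x powr (1 + s) + b powr (1 + s)" by (simp add: mult_ac)
  moreover have "x powr s * x = x powr (1 + s)" using x by (simp add: powr_add mult.commute)
  then have "(1 + s) * x powr s * x = (1 + s) * x powr (1 + s)" by (simp add: mult.assoc)
  ultimately show ?thesis by (simp add: right_diff_distrib distrib_right)
qed

text \<open>Weak majorization by Abel summation: the smallest \<open>g m\<close> is removed in each step.\<close>

lemma powr_sum_weak_majorization_aux:
  fixes g :: "'i \<Rightarrow> real" and b :: "nat \<Rightarrow> real"
  assumes s: "0 < s" and b: "\<And>i. 0 \<le> b i"
  shows "finite I \<Longrightarrow> card I = n \<Longrightarrow> (\<And>m. m \<in> I \<Longrightarrow> v \<le> g m) \<Longrightarrow> 0 \<le> v \<Longrightarrow>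
    (\<And>J. J \<subseteq> I \<Longrightarrow> sum g J \<le> (\<Sum>i<card J. b i)) \<Longrightarrow>
    (\<Sum>m\<in>I. g m powr (1 + s))
      \<le> (\<Sum>i<n. b i powr (1 + s)) + (1 + s) * v powr s * (sum g I - (\<Sum>i<n. b i))"
proof (induction n arbitrary: I v)
  case 0
  then show ?case by simp
next
  case (Suc n)
  have "I \<noteq> {}" using Suc.prems(2) by auto
  then obtain m where m: "m \<in> I" "\<And>j. j \<in> I \<Longrightarrow> g m \<le> g j"
    using ex_min_if_finite[of "g ` I"] Suc.prems(1)
    by (metis (no_types, lifting) finite_imageI image_iff image_is_empty linorder_not_less)
  define J where "J = I - {m}"
  have gm: "v \<le> g m" "0 \<le> g m" using Suc.prems(3)[OF m(1)] Suc.prems(4) by auto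
  have J: "finite J" "card J = n" using Suc.prems(1,2) m(1) by (auto simp: J_def)
  have IH: "(\<Sum>m\<in>J. g m powr (1 + s))
      \<le> (\<Sum>i<n. b i powr (1 + s)) + (1 + s) * g m powr s * (sum g J - (\<Sum>i<n. b i))"
    by (rule Suc.IH[OF J]) (use m gm Suc.prems(5) in \<open>auto simp: J_def\<close>)
  have split: "sum f I = f m + sum f J" for f :: "'i \<Rightarrow> real"
    unfolding J_def by (rule sum.remove[OF Suc.prems(1) m(1)])
  have tan: "g m powr (1 + s) \<le> b n powr (1 + s) + (1 + s) * g m powr s * (g m - b n)"
    using powr_tangent_le[OF gm(2) b[of n] s] by simp
  let ?d = "sum g I - (\<Sum>i<Suc n. b i)"
  have d: "?d \<le> 0" using Suc.prems(5)[of I] Suc.prems(2) by simp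
  have "(\<Sum>m\<in>I. g m powr (1 + s))
      \<le> (\<Sum>i<Suc n. b i powr (1 + s)) + (1 + s) * g m powr s * ?d"
    using IH tan by (simp add: split algebra_simps)
  \<comment> \<open>The total deficit is nonpositive, so lowering the coefficient from g m to v
    weakens the bound. The claim carries v so that the induction hypothesis can be used at g
    m.\<close>
  also have "(1 + s) * g m powr s * ?d \<le> (1 + s) * v powr s * ?d"
    by (rule mult_right_mono_neg[OF _ d]) (use gm Suc.prems(4) s in \<open>auto intro: powr_mono2\<close>)
  finally show ?case by simp
qed

text \<open>Taking v = 0 removes the correction term, as 0 powr s = 0.\<close>

lemma powr_sum_weak_majorization:
  fixes g :: "'i \<Rightarrow> real" and b :: "nat \<Rightarrow> real"
  assumes "0 < s" "\<And>i. 0 \<le> b i" "finite I" "\<And>m. 0 \<le> g m"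
    and "\<And>J. J \<subseteq> I \<Longrightarrow> sum g J \<le> (\<Sum>i<card J. b i)"
  shows "(\<Sum>m\<in>I. g m powr (1 + s)) \<le> (\<Sum>i<card I. b i powr (1 + s))"
  using powr_sum_weak_majorization_aux[OF assms(1,2,3) refl, of 0 g] assms by simp

text \<open>A discrete integral test: for n > 0 each term is at most the increment of -(t powr -s) /
  s from n to n + 1, so the sum telescopes. The extra 1 is the term i = 0.\<close>

lemma sum_powr_le:
  fixes s :: real
  assumes s: "0 < s"
  shows "(\<Sum>i<n. (1 + real i) powr - (1 + s)) \<le> 1 + 1 / s"
proof -
  have step: "(1 + real n) powr - (1 + s) \<le> (real n powr - s - (1 + real n) powr - s) / s" if n: "0 < n" for n
  proof -
    have "- (ln (1 + real n) - ln (real n)) = ln (real n / (1 + real n))"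
      using n by (simp add: ln_div)
    also have "\<dots> \<le> real n / (1 + real n) - 1" using n by (intro ln_le_minus_one) simp
    also have "\<dots> = - (1 / (1 + real n))" by (simp add: field_simps)
    finally have "s * (1 / (1 + real n)) \<le> s * (ln (1 + real n) - ln (real n))"
      using s by (intro mult_left_mono) auto
    then have "1 + s / (1 + real n) \<le> 1 + s * (ln (1 + real n) - ln (real n))" by simp
    also have "\<dots> \<le> exp (s * (ln (1 + real n) - ln (real n)))" by (rule exp_ge_add_one_self)
    finally have "1 + s / (1 + real n) \<le> exp (s * (ln (1 + real n) - ln (real n)))" .
    then have "(1 + real n) powr - s * (1 + s / (1 + real n))
        \<le> (1 + real n) powr - s * exp (s * (ln (1 + real n) - ln (real n)))"
      by (intro mult_left_mono) auto
    also have "\<dots> = real n powr - s"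
      using n by (simp add: powr_def exp_add[symmetric] algebra_simps)
    finally have "s * ((1 + real n) powr - s / (1 + real n)) \<le> real n powr - s - (1 + real n) powr - s"
      by (simp add: algebra_simps)
    moreover have "(1 + real n) powr - (1 + s) = (1 + real n) powr - s / (1 + real n)"
    proof -
      have eq: "- (1 + s) = - s - 1" by simp
      show ?thesis unfolding eq powr_diff by simp
    qed
    ultimately have "s * (1 + real n) powr - (1 + s) \<le> real n powr - s - (1 + real n) powr - s" by simp
    then show ?thesis using s by (subst pos_le_divide_eq) (auto simp: mult.commute)
  qed
  have "(\<Sum>i<Suc n. (1 + real i) powr - (1 + s)) \<le> 1 + (1 - (1 + real n) powr - s) / s" for n
  proof (induction n)
    case 0
    then show ?case by simp
  next
    case (Suc n)
    then show ?case using step[of "Suc n"] s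
      by (simp add: add_divide_distrib diff_divide_distrib add.commute)
  qed
  moreover have "1 + (1 - (1 + real n) powr - s) / s \<le> 1 + 1 / s" for n
    using s by (simp add: divide_right_mono)
  ultimately have "(\<Sum>i<Suc n. (1 + real i) powr - (1 + s)) \<le> 1 + 1 / s" for n
    using order_trans by blast
  moreover have "(\<Sum>i<n. (1 + real i) powr - (1 + s)) \<le> (\<Sum>i<Suc n. (1 + real i) powr - (1 + s))" by simp
  ultimately show ?thesis using order_trans by blast
qed

text \<open>The increments b i of C ln (1 + n) majorize g weakly and are at most C / (1 + i), which
  gives C powr (1 + 1/k) times 1 + k. Since 1 <= C, the first factor is at most C^2, independently
  of k.\<close>

lemma zeta_sum_bound:
  fixes g :: "'i \<Rightarrow> real" and k :: nat
  assumes g: "\<And>m. 0 \<le> g m" and C: "1 \<le> C" and k: "1 \<le> k"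
    and le: "\<And>J. finite J \<Longrightarrow> sum g J \<le> C * ln (1 + real (card J))" and I: "finite I"
  shows "(\<Sum>m\<in>I. g m powr (1 + 1 / real k)) \<le> C\<^sup>2 * (1 + real k)"
proof -
  let ?s = "1 / real k"
  have s: "0 < ?s" "?s \<le> 1" using k by auto
  define b where "b = (\<lambda>i::nat. C * (ln (2 + real i) - ln (1 + real i)))"
  have b0: "0 \<le> b i" for i unfolding b_def using C by (intro mult_nonneg_nonneg) auto
  have bsum: "(\<Sum>i<n. b i) = C * ln (1 + real n)" for n
    by (induction n) (auto simp: b_def algebra_simps)
  have ble: "b i \<le> C * (1 + real i) powr - 1" for i
  proof -
    have "ln (2 + real i) - ln (1 + real i) = ln ((2 + real i) / (1 + real i))" by (simp add: ln_div)
    also have "\<dots> \<le> (2 + real i) / (1 + real i) - 1" by (intro ln_le_minus_one) simp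
    also have "\<dots> = (1 + real i) powr - 1" by (simp add: powr_minus_divide field_simps)
    finally show ?thesis unfolding b_def using C by (intro mult_left_mono) auto
  qed
  have "(\<Sum>m\<in>I. g m powr (1 + ?s)) \<le> (\<Sum>i<card I. b i powr (1 + ?s))"
    by (rule powr_sum_weak_majorization[OF s(1) b0 I g])
      (use le finite_subset[OF _ I] in \<open>auto simp: bsum\<close>)
  also have "\<dots> \<le> (\<Sum>i<card I. C powr (1 + ?s) * (1 + real i) powr - (1 + ?s))"
  proof (rule sum_mono)
    fix i
    have "b i powr (1 + ?s) \<le> (C * (1 + real i) powr - 1) powr (1 + ?s)"
      using ble b0 s by (intro powr_mono2) auto
    also have "\<dots> = C powr (1 + ?s) * (1 + real i) powr (- 1 * (1 + ?s))"
      using C by (simp only: powr_mult powr_powr)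
    finally show "b i powr (1 + ?s) \<le> C powr (1 + ?s) * (1 + real i) powr - (1 + ?s)" by simp
  qed
  also have "\<dots> = C powr (1 + ?s) * (\<Sum>i<card I. (1 + real i) powr - (1 + ?s))"
    by (simp add: sum_distrib_left)
  also have "\<dots> \<le> C\<^sup>2 * (1 + real k)"
  proof (rule mult_mono)
    have "C powr (1 + ?s) \<le> C powr 2" using C s by (intro powr_mono) auto
    then show "C powr (1 + ?s) \<le> C\<^sup>2" using C by simp
    show "(\<Sum>i<card I. (1 + real i) powr - (1 + ?s)) \<le> 1 + real k" using sum_powr_le[OF s(1), of "card I"] by simp
  qed (auto intro: sum_nonneg)
  finally show ?thesis .
qed

text \<open>The tangent inequality at the mean a: the linear terms cancel on summation.\<close>

lemma powr_sum_le_power_mean: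
  fixes u :: "nat \<Rightarrow> real"
  assumes u: "\<And>i. i < n \<Longrightarrow> 0 \<le> u i" and s: "0 < s" and n: "0 < n"
  shows "(\<Sum>i<n. u i) powr (1 + s) \<le> real n powr s * (\<Sum>i<n. u i powr (1 + s))"
proof -
  define a where "a = (\<Sum>i<n. u i) / real n"
  have S: "0 \<le> (\<Sum>i<n. u i)" using u by (intro sum_nonneg) auto
  then have a: "0 \<le> a" by (simp add: a_def)
  have "(\<Sum>i<n. a powr (1 + s) - u i powr (1 + s)) \<le> (\<Sum>i<n. (1 + s) * a powr s * (a - u i))"
    by (rule sum_mono) (use u a s in \<open>auto intro: powr_tangent_le\<close>)
  also have "\<dots> = (1 + s) * a powr s * (real n * a - (\<Sum>i<n. u i))"
    by (simp add: sum_distrib_left[symmetric] sum_subtractf)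
  also have "\<dots> = 0" using n by (simp add: a_def)
  finally have "real n * a powr (1 + s) \<le> (\<Sum>i<n. u i powr (1 + s))" by (simp add: sum_subtractf)
  moreover have "a powr (1 + s) = (\<Sum>i<n. u i) powr (1 + s) / (real n powr s * real n)"
    using n S by (simp add: a_def powr_divide powr_add mult.commute)
  ultimately show ?thesis using n by (simp add: field_simps)
qed

section \<open>Zeta tails\<close>

locale diagonal_L2 = hilbert_basis h + L2_representation \<mu> U
  for h :: "nat \<Rightarrow> 'h::chilbert_space" and \<mu> :: "'f measure" and U :: "'h \<Rightarrow> 'f \<Rightarrow> complex" +
  fixes g :: "nat \<Rightarrow> real" and K :: real
  assumes g_nonneg: "\<And>m. 0 \<le> g m" and g_le: "\<And>m. \<bar>g m\<bar> \<le> K"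
    and diag_L1_inf: "diag g \<in> positive_L1_inf"
begin

sublocale L2_compression h \<mu> U ..

text \<open>The basis vectors form a trial system in Ky Fan's principle, so finite sums of g grow at
  most logarithmically in the number of terms.\<close>

lemma zeta_bound_exists:
  "\<exists>C\<ge>1. \<forall>k\<ge>1. \<forall>I. finite I \<longrightarrow> (\<Sum>m\<in>I. g m powr (1 + 1 / real k)) \<le> C\<^sup>2 * (1 + real k)"
proof -
  note T = positive_L1_infD(1,2)[OF diag_L1_inf]
  obtain C0 where C0: "\<And>k. log_average (diag g) k \<le> C0" using positive_L1_infD(3)[OF diag_L1_inf] by blast
  define C where "C = max 1 C0"
  have le: "sum g J \<le> C * ln (1 + real (card J))" if J: "finite J" for J
  proof (cases "J = {}")
    case False
    have on: "orthonormal_on J h" using orthonormal by (simp add: orthonormal_on_def)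
    have "sum g J = (\<Sum>m\<in>J. Re (cinner (h m) (diag g (h m))))"
      by (simp add: coeff_diag[OF g_le] cinner_basis)
    also have "\<dots> \<le> ky_fan (diag g) (card J)" by (rule ky_fan_ge[OF T on J refl])
    also have "\<dots> = log_average (diag g) (card J) * ln (1 + real (card J))"
      using False J by (simp add: log_average_ky_fan card_gt_0_iff)
    also have "\<dots> \<le> C * ln (1 + real (card J))"
      using C0[of "card J"] by (intro mult_right_mono) (auto simp: C_def)
    finally show ?thesis .
  qed simp
  have C: "1 \<le> C" by (simp add: C_def)
  then show ?thesis using zeta_sum_bound[OF g_nonneg C _ le] by blast
qed

lemma summable_zeta: "1 \<le> k \<Longrightarrow> summable (\<lambda>m. g m powr (1 + 1 / real k))"
proof -
  assume k: "1 \<le> k"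
  obtain C where "\<And>k I. 1 \<le> k \<Longrightarrow> finite I \<Longrightarrow> (\<Sum>m\<in>I. g m powr (1 + 1 / real k)) \<le> C\<^sup>2 * (1 + real k)"
    using zeta_bound_exists by blast
  from this[OF k] show ?thesis by (intro summableI_nonneg_bounded[of _ "C\<^sup>2 * (1 + real k)"]) simp_all
qed

lemma summable_zeta_weighted:
  assumes k: "1 \<le> k" and w: "\<And>m. 0 \<le> w m" "\<And>m. w m \<le> b"
  shows "summable (\<lambda>m. g m powr (1 + 1 / real k) * w m)"
proof (rule summable_comparison_test')
  show "summable (\<lambda>m. g m powr (1 + 1 / real k) * b)" by (rule summable_mult2[OF summable_zeta[OF k]])
  show "norm (g m powr (1 + 1 / real k) * w m) \<le> g m powr (1 + 1 / real k) * b" for m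
    using w by (simp add: abs_mult mult_left_mono)
qed

lemma norm_proj_basis_le: "J \<in> sets \<mu> \<Longrightarrow> (norm (proj J (h m)))\<^sup>2 \<le> 1"
  using norm_proj_le[of J "h m"] orthonormal_on_norm[OF orthonormal, of m] by (simp add: power_le_one)

text \<open>Peierls--Jensen inequality for the convex function \<open>t powr (1 + 1 / k)\<close>.\<close>

lemma compress_power_sum_le:
  assumes J: "J \<in> sets \<mu>" and k: "1 \<le> k"
    and x: "orthonormal_on {..<n} x" and eig: "\<And>i. i < n \<Longrightarrow> compress J (diag g) (x i) = u i *\<^sub>R x i"
    and u: "\<And>i. i < n \<Longrightarrow> 0 \<le> u i"
  shows "(\<Sum>i<n. u i powr (1 + 1 / real k)) \<le> (\<Sum>m. g m powr (1 + 1 / real k) * (norm (proj J (h m)))\<^sup>2)"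
proof -
  define s where "s = 1 / real k"
  have s: "0 < s" using k by (simp add: s_def)
  define w where "w = (\<lambda>i m. (cmod (cinner (x i) (proj J (h m))))\<^sup>2)"
  have w: "w i m = (cmod (cinner (h m) (proj J (x i))))\<^sup>2" for i m
    using proj_symmetric[OF J, of "x i" "h m"] by (simp add: w_def cmod_cinner_commute[of "h m"])
  have gK: "\<bar>g m powr (1 + s)\<bar> \<le> K powr (1 + s)" for m
    using g_nonneg[of m] g_le[of m] s by (simp add: powr_mono2)
  have sw: "summable (\<lambda>m. g m powr (1 + s) * w i m)" for i
    unfolding w by (rule summable_coeff_bounded[OF gK])
  have le: "u i powr (1 + s) \<le> (\<Sum>m. g m powr (1 + s) * w i m)" if i: "i < n" for i
  proof (cases "u i = 0")
    case True
    then show ?thesis using suminf_nonneg[OF sw] by (simp add: w)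
  next
    case False
    note nx = orthonormal_on_norm[OF x, of i]
    \<comment> \<open>An eigenvector with nonzero eigenvalue lies in the range of the projection, so
      its weights sum to 1 and u i is the mean of g under them.\<close>
    have "proj J (compress J (diag g) (x i)) = compress J (diag g) (x i)"
      by (simp add: compress_def proj_Int[OF J J])
    then have "u i *\<^sub>R proj J (x i) = u i *\<^sub>R x i"
      using eig[OF i] linear_scale[OF proj_linear[OF J]] by simp
    then have Px: "proj J (x i) = x i" using False by simp
    then have w1: "w i sums 1" using parseval_norm[of "x i"] nx i unfolding w by simp
    have "complex_of_real (u i) = cinner (x i) (compress J (diag g) (x i))"
      using nx i by (simp add: eig cinner_scaleR_right cinner_self scaleR_conv_of_real)
    also have "\<dots> = cinner (x i) (diag g (x i))"
      using proj_symmetric[OF J, of "x i" "diag g (x i)"] by (simp add: compress_def Px)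
    also have "\<dots> = of_real (\<Sum>m. g m * w i m)"
      unfolding w Px by (rule diag_quadratic_form[OF g_le])
    finally have u_eq: "u i = (\<Sum>m. g m * w i m)" unfolding of_real_eq_iff .
    have "summable (\<lambda>m. g m * w i m)" unfolding w by (rule summable_coeff_bounded[OF g_le])
    then have gw: "(\<lambda>m. g m * w i m) sums u i" unfolding u_eq by (rule summable_sums)
    \<comment> \<open>The tangent at u i is summed against the weights; its linear part vanishes
      because u i is the mean.\<close>
    have "(\<lambda>m. u i powr (1 + s) * w i m - (1 + s) * u i powr s * (u i * w i m - g m * w i m))
        sums (u i powr (1 + s) * 1 - (1 + s) * u i powr s * (u i * 1 - u i))"
      by (intro sums_diff sums_mult w1 gw)
    then have lhs: "(\<lambda>m. u i powr (1 + s) * w i m - (1 + s) * u i powr s * (u i * w i m - g m * w i m))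
        sums (u i powr (1 + s))" by simp
    show ?thesis
    proof (rule sums_le[OF _ lhs summable_sums[OF sw]])
      fix m
      have "(u i powr (1 + s) - (1 + s) * u i powr s * (u i - g m)) * w i m \<le> g m powr (1 + s) * w i m"
        using powr_tangent_le[OF u[OF i] g_nonneg[of m] s] by (intro mult_right_mono) (auto simp: w_def)
      then show "u i powr (1 + s) * w i m - (1 + s) * u i powr s * (u i * w i m - g m * w i m)
          \<le> g m powr (1 + s) * w i m" by (simp add: algebra_simps)
    qed
  qed
  have "(\<Sum>i<n. u i powr (1 + s)) \<le> (\<Sum>i<n. \<Sum>m. g m powr (1 + s) * w i m)"
    by (rule sum_mono) (use le in auto)
  also have "\<dots> = (\<Sum>m. \<Sum>i<n. g m powr (1 + s) * w i m)" by (rule suminf_sum[symmetric]) (rule sw)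
  \<comment> \<open>For fixed m, Bessel bounds the weights over the orthonormal x i by the squared
    norm of the projected h m.\<close>
  also have "\<dots> \<le> (\<Sum>m. g m powr (1 + s) * (norm (proj J (h m)))\<^sup>2)"
  proof (rule suminf_le)
    show "(\<Sum>i<n. g m powr (1 + s) * w i m) \<le> g m powr (1 + s) * (norm (proj J (h m)))\<^sup>2" for m
      unfolding sum_distrib_left[symmetric] w_def by (intro mult_left_mono bessel[OF x]) auto
    show "summable (\<lambda>m. \<Sum>i<n. g m powr (1 + s) * w i m)" by (rule summable_sum) (rule sw)
    show "summable (\<lambda>m. g m powr (1 + s) * (norm (proj J (h m)))\<^sup>2)"
      unfolding s_def by (rule summable_zeta_weighted[OF k, of _ 1]) (use norm_proj_basis_le[OF J] in auto)
  qed
  finally show ?thesis by (simp add: s_def)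
qed

text \<open>As ln n <= k, the power mean factor n powr (1/k) is at most e. The exponent on the left
  is then dropped: X > e c >= 1 would give X <= X powr (1 + 1/k) <= e c.\<close>

lemma ky_fan_compress_le_zeta:
  assumes J: "J \<in> sets \<mu>" and n: "0 < n" and k: "1 \<le> k" "ln (1 + real n) \<le> real k"
    and c: "1 \<le> exp 1 * c" and B: "(\<Sum>m. g m powr (1 + 1 / real k) * (norm (proj J (h m)))\<^sup>2) \<le> c"
  shows "ky_fan (compress J (diag g)) n \<le> exp 1 * c"
proof -
  let ?T = "compress J (diag g)"
  note T = positive_L1_infD(1,2)[OF compress_positive_L1_inf[OF J diag_L1_inf]]
  obtain x where x: "orthonormal_on {..<n} x"
    "\<And>i. i < n \<Longrightarrow> ?T (x i) = singular_value ?T (Suc i) *\<^sub>R x i"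
    using ky_fan_attained[OF T, of n] by metis
  define s X where "s = 1 / real k" and "X = ky_fan ?T n"
  have s: "0 < s" using k by (simp add: s_def)
  have X: "X = (\<Sum>i<n. singular_value ?T (Suc i))"
    unfolding X_def ky_fan_def by (rule sum.reindex_bij_witness[of _ Suc "\<lambda>n. n - 1"]) auto
  have "X powr (1 + s) \<le> real n powr s * (\<Sum>i<n. singular_value ?T (Suc i) powr (1 + s))"
    unfolding X by (rule powr_sum_le_power_mean[OF _ s n]) (rule singular_value_nonneg[OF T])
  also have "\<dots> \<le> exp 1 * c"
  proof (rule mult_mono)
    have "s * ln (real n) \<le> s * real k"
    proof (rule mult_left_mono)
      have "ln (real n) \<le> ln (1 + real n)" using n by simp
      then show "ln (real n) \<le> real k" using k(2) by simp
    qed (use s in simp)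
    also have "\<dots> = 1" using k by (simp add: s_def)
    finally show "real n powr s \<le> exp 1" using n by (simp add: powr_def)
    show "(\<Sum>i<n. singular_value ?T (Suc i) powr (1 + s)) \<le> c"
      unfolding s_def
      using compress_power_sum_le[OF J k(1) x singular_value_nonneg[OF T]] B by linarith
  qed (auto intro: sum_nonneg)
  finally have le: "X powr (1 + s) \<le> exp 1 * c" .
  show ?thesis
  proof (rule ccontr)
    assume "\<not> ?thesis"
    then have X1: "exp 1 * c < X" by (simp add: X_def)
    then have "X powr 1 \<le> X powr (1 + s)" using c s by (intro powr_mono) auto
    then show False using X1 le c by simp
  qed
qed

text \<open>For large n the rounded logarithm k n is at most 2 ln (1 + n), which explains the factor
  2; the factor e comes from \<open>ky_fan_compress_le_zeta\<close>.\<close>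

lemma seminorm_0_compress_le:
  assumes J: "J \<in> sets \<mu>" and eps: "0 < \<epsilon>"
    and ev: "\<forall>\<^sub>F k in sequentially. 1 / real k * (\<Sum>m. g m powr (1 + 1 / real k) * (norm (proj J (h m)))\<^sup>2) \<le> \<epsilon>"
  shows "seminorm_0 (compress J (diag g)) \<le> ereal (2 * exp 1 * \<epsilon>)"
proof -
  define k where "k = (\<lambda>n::nat. nat \<lceil>ln (1 + real n)\<rceil>)"
  have kge: "ln (1 + real n) \<le> real (k n)" for n unfolding k_def by linarith
  have kle: "real (k n) \<le> ln (1 + real n) + 1" for n
  proof -
    have "0 \<le> ln (1 + real n)" by simp
    then show ?thesis unfolding k_def by linarith
  qed
  have ln_top: "filterlim (\<lambda>n::nat. ln (1 + real n)) at_top sequentially"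
    by (intro filterlim_compose[OF ln_at_top] filterlim_tendsto_add_at_top[OF tendsto_const]
        filterlim_real_sequentially)
  have "filterlim (\<lambda>n. real (k n)) at_top sequentially"
    by (rule filterlim_at_top_mono[OF ln_top]) (simp add: kge)
  then have k_top: "filterlim k at_top sequentially"
    unfolding filterlim_sequentially_iff_filterlim_real .
  have large: "\<forall>\<^sub>F n in sequentially. max 1 (1 / (exp 1 * \<epsilon>)) \<le> ln (1 + real n)"
    using ln_top unfolding filterlim_at_top by blast
  have "\<forall>\<^sub>F n in sequentially. ereal (log_average (compress J (diag g)) n) \<le> ereal (2 * exp 1 * \<epsilon>)"
    using eventually_compose_filterlim[OF ev k_top] large eventually_gt_at_top[of 0]
  proof eventually_elim
    case (elim n)
    let ?L = "ln (1 + real n)"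
    have L1: "1 \<le> ?L" and L2: "1 / (exp 1 * \<epsilon>) \<le> ?L" using elim(2) by auto
    have k1: "1 \<le> k n" using kge[of n] L1 by linarith
    have "1 \<le> exp 1 * \<epsilon> * ?L" using L2 eps by (simp add: field_simps)
    also have "\<dots> \<le> exp 1 * \<epsilon> * real (k n)" using kge[of n] eps by (intro mult_left_mono) auto
    finally have c: "1 \<le> exp 1 * (\<epsilon> * real (k n))" by (simp add: mult.assoc)
    have B: "(\<Sum>m. g m powr (1 + 1 / real (k n)) * (norm (proj J (h m)))\<^sup>2) \<le> \<epsilon> * real (k n)"
      using elim(1) k1 by (simp add: field_simps)
    have "ky_fan (compress J (diag g)) n \<le> exp 1 * (\<epsilon> * real (k n))"
      by (rule ky_fan_compress_le_zeta[OF J elim(3) k1 kge c B])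
    also have "\<dots> \<le> exp 1 * (\<epsilon> * (2 * ?L))"
      using kle[of n] L1 eps by (intro mult_left_mono) auto
    finally have "ky_fan (compress J (diag g)) n \<le> 2 * exp 1 * \<epsilon> * ?L" by (simp add: mult_ac)
    moreover have "0 < ?L" using L1 by linarith
    ultimately show ?case by (simp only: log_average_ky_fan pos_divide_le_eq ereal_less_eq)
  qed
  then show ?thesis unfolding seminorm_0_def by (rule Limsup_bounded)
qed

section \<open>The implications between the tail conditions\<close>

lemma dominated_imp_zeta_tails:
  assumes dom: "dominated_basis \<mu> U h"
    and F: "range F \<subseteq> sets \<mu>" "disjoint_family F"
  shows "(\<lambda>N. limsup (\<lambda>k. ereal (1 / real k * (\<Sum>m. g m powr (1 + 1 / real k) *
    (LINT p:(\<Union>j\<in>{N..}. F j)|\<mu>. (cmod (U (h m) p))\<^sup>2))))) \<longlonglongrightarrow> 0"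
proof -
  obtain l :: "'f \<Rightarrow> real" where l: "integrable \<mu> l" "\<And>m. AE p in \<mu>. (cmod (U (h m) p))\<^sup>2 \<le> l p"
    using dom by (auto simp: dominated_basis_def)
  obtain C where C: "1 \<le> C"
    "\<And>k I. 1 \<le> k \<Longrightarrow> finite I \<Longrightarrow> (\<Sum>m\<in>I. g m powr (1 + 1 / real k)) \<le> C\<^sup>2 * (1 + real k)"
    using zeta_bound_exists by blast
  define R where "R = (\<lambda>N. \<Union>j\<in>{N..}. F j)"
  have R: "R N \<in> sets \<mu>" for N unfolding R_def using F(1) by auto
  define a where "a = (\<lambda>N. LINT p:R N|\<mu>. l p)"
  define w where "w = (\<lambda>N m. LINT p:R N|\<mu>. (cmod (U (h m) p))\<^sup>2)"
  \<comment> \<open>The tail integral of the dominating function bounds the weights uniformly in m,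
    so it can be taken out of the series.\<close>
  have w0: "0 \<le> w N m" and wa: "w N m \<le> a N" for N m
  proof -
    show "0 \<le> w N m" unfolding w_def norm_proj[OF R, symmetric] by simp
    show "w N m \<le> a N"
      unfolding w_def a_def set_lebesgue_integral_def
    proof (rule integral_mono_AE)
      show "integrable \<mu> (\<lambda>p. indicat_real (R N) p *\<^sub>R (cmod (U (h m) p))\<^sup>2)"
        by (rule integrable_mult_indicator[OF R U_integrable])
      show "integrable \<mu> (\<lambda>p. indicat_real (R N) p *\<^sub>R l p)"
        by (rule integrable_mult_indicator[OF R l(1)])
      show "AE p in \<mu>. indicat_real (R N) p *\<^sub>R (cmod (U (h m) p))\<^sup>2 \<le> indicat_real (R N) p *\<^sub>R l p"
        using l(2)[of m] by eventually_elim (simp add: mult_left_mono)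
    qed
  qed
  let ?z = "\<lambda>N k. 1 / real k * (\<Sum>m. g m powr (1 + 1 / real k) * w N m)"
  have z0: "0 \<le> ?z N k" if "1 \<le> k" for N k
    by (intro mult_nonneg_nonneg suminf_nonneg summable_zeta_weighted[OF that w0 wa])
      (auto simp: w0)
  have za: "?z N k \<le> 2 * C\<^sup>2 * a N" if k: "1 \<le> k" for N k
  proof -
    have a0: "0 \<le> a N" using w0[of N 0] wa[of N 0] by simp
    have "(\<Sum>m. g m powr (1 + 1 / real k) * w N m) \<le> (\<Sum>m. g m powr (1 + 1 / real k) * a N)"
      by (intro suminf_le summable_zeta_weighted[OF k w0 wa] summable_mult2 summable_zeta[OF k]
          mult_left_mono wa) auto
    also have "\<dots> = (\<Sum>m. g m powr (1 + 1 / real k)) * a N"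
      by (rule suminf_mult2[OF summable_zeta[OF k], symmetric])
    also have "\<dots> \<le> (C\<^sup>2 * (1 + real k)) * a N"
      by (intro mult_right_mono a0 suminf_le_const[OF summable_zeta[OF k]] C(2)[OF k]) simp
    \<comment> \<open>The bound 1 + k <= 2 k cancels the prefactor 1/k and leaves a bound
      independent of k.\<close>
    also have "\<dots> \<le> (C\<^sup>2 * (2 * real k)) * a N"
      using k by (intro mult_right_mono mult_left_mono a0) auto
    finally show ?thesis using k by (simp add: field_simps)
  qed
  have a_lim: "a \<longlonglongrightarrow> 0" unfolding a_def R_def by (rule tail_integral_tendsto_zero[OF F l(1)])
  have "(\<lambda>N. limsup (\<lambda>k. ereal (?z N k))) \<longlonglongrightarrow> 0"
  proof (rule tendsto_sandwich[OF _ _ tendsto_const])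
    show "\<forall>\<^sub>F N in sequentially. 0 \<le> limsup (\<lambda>k. ereal (?z N k))"
    proof (rule always_eventually, rule allI)
      fix N
      have "\<forall>\<^sub>F k in sequentially. 0 \<le> ereal (?z N k)"
        using eventually_ge_at_top[of 1] by eventually_elim (use z0 in simp)
      then show "0 \<le> limsup (\<lambda>k. ereal (?z N k))" by (intro le_Limsup) auto
    qed
    show "\<forall>\<^sub>F N in sequentially. limsup (\<lambda>k. ereal (?z N k)) \<le> ereal (2 * C\<^sup>2 * a N)"
    proof (rule always_eventually, rule allI)
      fix N
      have "\<forall>\<^sub>F k in sequentially. ereal (?z N k) \<le> ereal (2 * C\<^sup>2 * a N)"
        using eventually_ge_at_top[of 1] by eventually_elim (use za in simp)
      then show "limsup (\<lambda>k. ereal (?z N k)) \<le> ereal (2 * C\<^sup>2 * a N)" by (rule Limsup_bounded)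
    qed
    show "(\<lambda>N. ereal (2 * C\<^sup>2 * a N)) \<longlonglongrightarrow> 0"
      using tendsto_mult_right_zero[OF a_lim, of "2 * C\<^sup>2"] by (simp add: zero_ereal_def)
  qed
  then show ?thesis by (simp add: w_def R_def)
qed

lemma zeta_tails_imp_projection_tails:
  assumes zeta: "\<And>F. range F \<subseteq> sets \<mu> \<Longrightarrow> disjoint_family F \<Longrightarrow>
    (\<lambda>N. limsup (\<lambda>k. ereal (1 / real k * (\<Sum>m. g m powr (1 + 1 / real k) *
      (LINT p:(\<Union>j\<in>{N..}. F j)|\<mu>. (cmod (U (h m) p))\<^sup>2))))) \<longlonglongrightarrow> 0"
  shows "projection_tails_vanish \<mu> U (diag g)"
  unfolding projection_tails_vanish_def Let_def
proof (intro allI impI)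
  fix Q :: "nat \<Rightarrow> 'h \<Rightarrow> 'h"
  assume Q: "(\<forall>j. projection_op (Q j) \<and> Q j \<in> mult_op \<mu> U ` L_inf \<mu>) \<and>
    (\<forall>i j. i \<noteq> j \<longrightarrow> Q i \<circ> Q j = (\<lambda>_. 0))"
  obtain F where F: "range F \<subseteq> sets \<mu>" "disjoint_family F" "\<And>j. Q j = proj (F j)"
  proof (rule orthogonal_projections_sets[of Q])
    show "Q j \<in> mult_op \<mu> U ` L_inf \<mu>" "Q j (Q j x) = Q j x" for j x
      using Q by (auto simp: projection_op_idem)
    show "Q i (Q j x) = 0" if "i \<noteq> j" for i j x
      using Q that by (metis comp_apply)
  qed blast
  define R where "R = (\<lambda>N. \<Union>j\<in>{N..}. F j)"
  have R: "R N \<in> sets \<mu>" for N unfolding R_def using F(1) by auto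
  have "(\<Sum>j. Q (N + j) x) = proj (R N) x" for N x
    unfolding F(3) R_def by (rule proj_tail_suminf[OF F(1,2)])
  then have eq: "(\<lambda>x. \<Sum>j. Q (N + j) x) \<circ> diag g \<circ> (\<lambda>x. \<Sum>j. Q (N + j) x) = compress (R N) (diag g)" for N
    by (simp add: compress_def fun_eq_iff)
  let ?z = "\<lambda>N k. 1 / real k * (\<Sum>m. g m powr (1 + 1 / real k) * (norm (proj (R N) (h m)))\<^sup>2)"
  have lim: "(\<lambda>N. limsup (\<lambda>k. ereal (?z N k))) \<longlonglongrightarrow> 0"
    unfolding norm_proj[OF R] unfolding R_def by (rule zeta[OF F(1,2)])
  show "(\<lambda>N. seminorm_0 ((\<lambda>x. \<Sum>j. Q (N + j) x) \<circ> diag g \<circ> (\<lambda>x. \<Sum>j. Q (N + j) x))) \<longlonglongrightarrow> 0"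
    unfolding eq
  proof (rule order_tendstoI)
    fix b :: ereal assume "b < 0"
    moreover have "0 \<le> seminorm_0 (compress (R N) (diag g))" for N
      unfolding seminorm_0_def
      using log_average_nonneg[OF positive_L1_infD(1,2)[OF compress_positive_L1_inf[OF R diag_L1_inf]]]
      by (intro le_Limsup) auto
    ultimately show "\<forall>\<^sub>F N in sequentially. b < seminorm_0 (compress (R N) (diag g))"
      by (intro always_eventually allI) (rule less_le_trans)
  next
    fix b :: ereal assume "0 < b"
    then obtain r where r: "0 < ereal r" "ereal r < b" using ereal_dense2 by blast
    \<comment> \<open>Chosen to undo the constant 2 e of
      \<open>seminorm_0_compress_le\<close>.\<close>
    define \<epsilon> where "\<epsilon> = r / (2 * exp 1)"
    have eps: "0 < \<epsilon>" "2 * exp 1 * \<epsilon> = r" using r by (auto simp: \<epsilon>_def)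
    have "\<forall>\<^sub>F N in sequentially. limsup (\<lambda>k. ereal (?z N k)) < ereal \<epsilon>"
      using order_tendstoD(2)[OF lim] eps(1) by simp
    then show "\<forall>\<^sub>F N in sequentially. seminorm_0 (compress (R N) (diag g)) < b"
    proof eventually_elim
      case (elim N)
      \<comment> \<open>The limsup is an infimum of suprema over eventual sets, so one of these
        suprema is already below \<epsilon>.\<close>
      have "\<forall>\<^sub>F k in sequentially. ereal (?z N k) < ereal \<epsilon>" 
      proof -
        obtain A where A: "eventually A sequentially" "(SUP k\<in>Collect A. ereal (?z N k)) < ereal \<epsilon>"
          using elim unfolding Limsup_def INF_less_iff by blast
        show ?thesis
          using A(1)
        proof eventually_elim
          case (elim k)
          show ?case by (rule SUP_lessD[OF A(2)]) (use elim in simp)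
        qed
      qed
      then have "\<forall>\<^sub>F k in sequentially. ?z N k \<le> \<epsilon>" by eventually_elim simp
      then have "seminorm_0 (compress (R N) (diag g)) \<le> ereal (2 * exp 1 * \<epsilon>)"
        by (rule seminorm_0_compress_le[OF R eps(1)])
      then show ?case using r(2) by (simp add: eps(2))
    qed
  qed
qed

end

theorem proposition4p13:
  fixes dm :: "'h::chilbert_space set" and D :: "'h \<Rightarrow> 'h"
    and h :: "nat \<Rightarrow> 'h" and ev :: "nat \<Rightarrow> real" and G :: "real \<Rightarrow> real"
    and A :: "'n::finite \<Rightarrow> 'h \<Rightarrow> 'h"
    and F :: "'f::topological_space set" and \<mu> :: "'f measure"
    and U :: "'h \<Rightarrow> 'f \<Rightarrow> complex" and e :: "'f \<Rightarrow> real ^ 'n"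
  assumes "separable_space (euclidean :: 'h topology)"
    and "selfadjoint_unbounded dm D" and "compact_resolvent dm D"
    and "orthonormal_basis h" and "\<And>m. h m \<in> dm \<and> D (h m) = ev m *\<^sub>R h m"
    and "G \<in> borel_measurable borel" and "bounded (range G)" and "\<And>t. 0 \<le> G t"
    and "positive_op (borel_calculus dm D G)" and "borel_calculus dm D G \<in> L1_inf"
    and "\<And>i. selfadjoint_op (A i)" and "\<And>i j. A i \<circ> A j = A j \<circ> A i"
    and "acts_nondegenerately A"
    and "finite_measure \<mu>" and "sets \<mu> = sets (restrict_space borel F)"
    and "joint_spectral_representation A \<mu> U e" and "normal_composition A \<mu> U e"
  shows "(dominated_basis \<mu> U h \<longrightarrow> zeta_tails_vanish \<mu> U h ev G)
    \<and> (zeta_tails_vanish \<mu> U h ev G \<longrightarrow> projection_tails_vanish \<mu> U (borel_calculus dm D G))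
    \<and> (projection_tails_vanish \<mu> U (borel_calculus dm D G) \<longrightarrow>
        (\<forall>\<omega>\<in>DL2 TYPE('h). is_finite_ac_measure \<mu> (nu \<mu> U (borel_calculus dm D G) \<omega>)))"
proof -
  interpret diagonal_operator h dm D ev
    by unfold_locales (use assms in auto)
  obtain K where K: "\<And>t. \<bar>G t\<bar> \<le> K"
    using assms(7) by (auto simp: bounded_iff)
  have GD: "borel_calculus dm D G = diag (\<lambda>m. G (ev m))"
    by (rule borel_calculus_eq_diag[OF assms(6) K])
  \<comment> \<open>From here on D enters only through the numbers G (ev m).\<close>
  interpret diagonal_L2 h \<mu> U "\<lambda>m. G (ev m)" K
  proof (intro diagonal_L2.intro L2_representation.intro diagonal_L2_axioms.intro)
    show "hilbert_basis h" by (rule hilbert_basis_axioms)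
    show "finite_measure \<mu>" by (rule assms(14))
    show "unitary_to_L2 \<mu> U" using assms(16) by (simp add: joint_spectral_representation_def)
    show "diag (\<lambda>m. G (ev m)) \<in> positive_L1_inf"
      using assms(9,10) by (simp add: GD positive_L1_inf_def positive_op_iff)
  qed (use assms(8) K in auto)
  show ?thesis
    unfolding GD
  proof (intro conjI impI ballI)
    show "zeta_tails_vanish \<mu> U h ev G" if "dominated_basis \<mu> U h"
      unfolding zeta_tails_vanish_def using dominated_imp_zeta_tails[OF that] by blast
    show "projection_tails_vanish \<mu> U (diag (\<lambda>m. G (ev m)))" if "zeta_tails_vanish \<mu> U h ev G"
      by (rule zeta_tails_imp_projection_tails) (use that in \<open>auto simp: zeta_tails_vanish_def\<close>)
    show "is_finite_ac_measure \<mu> (nu \<mu> U (diag (\<lambda>m. G (ev m))) \<omega>)"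
      if "projection_tails_vanish \<mu> U (diag (\<lambda>m. G (ev m)))" "\<omega> \<in> DL2 TYPE('h)" for \<omega>
      by (rule nu_finite_ac_measure[OF that(2) diag_L1_inf that(1)])
  qed
qed

end
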